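(* Let $k,r,s,t$ be positive integers. There is a constant $C=C(k,r,s,t)>0$ such that for all positive integers $2\leq m\leq n$, \[\mathrm{ex}(m,n,K_{s,t}^{(2k)}(r))\leq C\left(m^{\frac{1}{2}+\frac{1}{2k}}n^{\frac{1}{2}}+n\log m\right)\quad\text{and}\quad \mathrm{ex}(m,n,K_{s,t}^{(2k)})\leq C\left(m^{\frac{1}{2}+\frac{1}{2k}-\frac{1}{2ks}}n^{\frac{1}{2}}+n\log m\right).\]
   Context: For a graph $H$ and positive integers $m\le n$, $\mathrm{ex}(m,n,H)$ is the maximum number of edges in an $H$-free bipartite graph with parts of sizes $m$ and $n$. For a graph $H$ and positive integers $k,r$, $H^{(k)}(r)$ is the graph obtained from $H$ by replacing each edge $uv$ by $r$ paths of length $k$ between $u$ and $v$, such that all these $r\,e(H)$ paths are pairwise internally vertex-disjoint (and internally disjoint from $V(H)$); $H^{(k)}=H^{(k)}(1)$ is the $k$-subdivision of $H$. $K_{s,t}$ is the complete bipartite graph with parts of sizes $s$ and $t$. *)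

theory Defs
  imports Complex_Main
begin

text \<open>A finite simple graph is a pair of a vertex set and a set of two-element edges.\<close>

type_synonym 'a sgraph = "'a set \<times> 'a set set"

abbreviation verts :: "'a sgraph \<Rightarrow> 'a set" where "verts G \<equiv> fst G"

abbreviation edges :: "'a sgraph \<Rightarrow> 'a set set" where "edges G \<equiv> snd G"

definition simple_graph :: "'a sgraph \<Rightarrow> bool" where
  "simple_graph G \<longleftrightarrow> finite (verts G) \<and> (\<forall>e\<in>edges G. e \<subseteq> verts G \<and> card e = 2)"

text \<open>Containment is as a subgraph, not necessarily induced.\<close>

definition contains_copy :: "'a sgraph \<Rightarrow> 'b sgraph \<Rightarrow> bool" where
  "contains_copy G H \<longleftrightarrow>
     (\<exists>f. inj_on f (verts H) \<and> f ` verts H \<subseteq> verts G \<and> (\<forall>e\<in>edges H. f ` e \<in> edges G))"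

definition bipartite_with_parts :: "'a sgraph \<Rightarrow> 'a set \<Rightarrow> 'a set \<Rightarrow> bool" where
  "bipartite_with_parts G A B \<longleftrightarrow>
     simple_graph G \<and> verts G = A \<union> B \<and> A \<inter> B = {} \<and>
     (\<forall>e\<in>edges G. \<exists>a\<in>A. \<exists>b\<in>B. e = {a, b})"

text \<open>Every finite graph is isomorphic to one on natural numbers, so the host graphs
  range over graphs with vertices in \<^typ>\<open>nat\<close>.\<close>

definition bip_free_sizes :: "nat \<Rightarrow> nat \<Rightarrow> 'b sgraph \<Rightarrow> nat set" where
  "bip_free_sizes m n H =
     {card (edges G) | G :: nat sgraph.
        (\<exists>A B. bipartite_with_parts G A B \<and> card A = m \<and> card B = n) \<and> \<not> contains_copy G H}"

definition ex_bip :: "nat \<Rightarrow> nat \<Rightarrow> 'b sgraph \<Rightarrow> nat" where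
  "ex_bip m n H = Max (bip_free_sizes m n H)"

definition complete_bipartite :: "nat \<Rightarrow> nat \<Rightarrow> nat sgraph" where
  "complete_bipartite s t = ({..<s + t}, {{i, j} | i j. i < s \<and> s \<le> j \<and> j < s + t})"

text \<open>\<open>Internal e i j\<close> is the \<open>j\<close>-th vertex (\<open>0 < j < k\<close>) of the \<open>i\<close>-th path (\<open>i < r\<close>)
  replacing the edge \<open>e\<close>. The linear order on vertices only serves to choose
  a direction in which the paths replacing \<open>e\<close> are numbered.\<close>

datatype 'a subdiv_vertex = Branch 'a | Internal "'a set" nat nat

definition path_vertex :: "nat \<Rightarrow> 'a::linorder set \<Rightarrow> nat \<Rightarrow> nat \<Rightarrow> 'a subdiv_vertex" where
  "path_vertex k e i j =
     (if j = 0 then Branch (Min e) else if j = k then Branch (Max e) else Internal e i j)"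

text \<open>For \<open>k = 1\<close> and \<open>r > 1\<close> the parallel paths would be multiple edges, which
  collapse here; the construction is meant for \<open>k \<ge> 2\<close> or \<open>r = 1\<close>.\<close>

definition multi_subdivision :: "'a::linorder sgraph \<Rightarrow> nat \<Rightarrow> nat \<Rightarrow> 'a subdiv_vertex sgraph" where
  "multi_subdivision H k r =
     (Branch ` verts H \<union> {Internal e i j | e i j. e \<in> edges H \<and> i < r \<and> 0 < j \<and> j < k},
      {{path_vertex k e i j, path_vertex k e i (Suc j)} | e i j. e \<in> edges H \<and> i < r \<and> j < k})"

abbreviation subdivision :: "'a::linorder sgraph \<Rightarrow> nat \<Rightarrow> 'a subdiv_vertex sgraph" where
  "subdivision H k \<equiv> multi_subdivision H k 1"

text \<open>The maximum in \<^const>\<open>ex_bip\<close> is attained whenever \<open>H\<close> has an edge.\<close>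

lemma finite_bip_free_sizes: "finite (bip_free_sizes m n H)"
proof (rule finite_subset)
  show "bip_free_sizes m n H \<subseteq> {..2 ^ (m + n)}"
  proof
    fix x assume "x \<in> bip_free_sizes m n H"
    then obtain G :: "nat sgraph" and A B where x: "x = card (edges G)"
      and G: "bipartite_with_parts G A B" and AB: "card A = m" "card B = n"
      unfolding bip_free_sizes_def by blast
    have fin: "finite (A \<union> B)" and sub: "edges G \<subseteq> Pow (A \<union> B)"
      using G by (auto simp: bipartite_with_parts_def simple_graph_def)
    have "card (edges G) \<le> card (Pow (A \<union> B))"
      using fin sub by (intro card_mono) auto
    also have "\<dots> = 2 ^ card (A \<union> B)"
      using fin by (simp add: card_Pow)
    also have "\<dots> \<le> 2 ^ (m + n)"
      using card_Un_le[of A B] AB by (intro power_increasing) auto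
    finally show "x \<in> {..2 ^ (m + n)}" using x by simp
  qed
qed simp

lemma bip_free_sizes_nonempty:
  assumes "edges H \<noteq> {}"
  shows "bip_free_sizes m n H \<noteq> {}"
proof -
  let ?G = "({..<m} \<union> {m..<m + n}, {}) :: nat sgraph"
  have "bipartite_with_parts ?G {..<m} {m..<m + n}"
    by (auto simp: bipartite_with_parts_def simple_graph_def)
  moreover have "\<not> contains_copy ?G H"
    using assms by (auto simp: contains_copy_def)
  ultimately have "card (edges ?G) \<in> bip_free_sizes m n H"
    unfolding bip_free_sizes_def
    by (intro CollectI exI[of _ ?G] conjI exI[of _ "{..<m}"] exI[of _ "{m..<m + n}"]) auto
  then show ?thesis by blast
qed

lemma simple_graph_complete_bipartite: "simple_graph (complete_bipartite s t)"
  by (auto simp: simple_graph_def complete_bipartite_def card_insert_if)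

lemma simple_graph_multi_subdivision:
  assumes "simple_graph H" "0 < k"
  shows "simple_graph (multi_subdivision H k r)"
proof -
  have finE: "finite (edges H)"
    using assms(1) by (auto simp: simple_graph_def intro: finite_subset[of _ "Pow (verts H)"])
  have "{Internal e i j | e i j. e \<in> edges H \<and> i < r \<and> 0 < j \<and> j < k}
          \<subseteq> (\<lambda>(e, i, j). Internal e i j) ` (edges H \<times> {..<r} \<times> {..<k})"
    by force
  then have fin: "finite {Internal e i j | e i j. e \<in> edges H \<and> i < r \<and> 0 < j \<and> j < k}"
    using finE by (meson finite_SigmaI finite_imageI finite_lessThan finite_subset)
  have edge: "Min e \<in> verts H \<and> Max e \<in> verts H \<and> Min e \<noteq> Max e" if "e \<in> edges H" for e
  proof -
    have e_sub: "e \<subseteq> verts H" and "card e = 2"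
      using assms(1) that by (simp_all add: simple_graph_def)
    then obtain a b where e: "e = {a, b}" "a \<noteq> b"
      unfolding card_2_iff by blast
    moreover have "a \<in> verts H" "b \<in> verts H"
      using e_sub e(1) by simp_all
    ultimately show ?thesis
      by (simp add: min_def max_def)
  qed
  have "{path_vertex k e i j, path_vertex k e i (Suc j)} \<subseteq> verts (multi_subdivision H k r) \<and>
        card {path_vertex k e i j, path_vertex k e i (Suc j)} = 2"
    if "e \<in> edges H" "i < r" "j < k" for e i j
    using edge[OF that(1)] that
    by (auto simp: multi_subdivision_def path_vertex_def card_insert_if)
  moreover have "finite (verts (multi_subdivision H k r))"
    using fin assms(1) by (simp add: multi_subdivision_def simple_graph_def)
  moreover have "\<exists>e i j. x = {path_vertex k e i j, path_vertex k e i (Suc j)} \<and>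
      e \<in> edges H \<and> i < r \<and> j < k" if "x \<in> edges (multi_subdivision H k r)" for x
    using that by (simp add: multi_subdivision_def)
  ultimately show ?thesis
    unfolding simple_graph_def by (metis (no_types, lifting))
qed

end

theory Submission
  imports Defs "HOL-Library.Multiset" "HOL-Library.FuncSet"
begin

text \<open>
  Pass to a subgraph in which every degree on the small side is at least \<open>d = e / 4m\<close> and every
  degree on the large side at least \<open>D = e / 4n\<close>, and weight walks and spiders (several walks
  leaving a common centre) by the stationary random walk.  No upper bound on degrees is needed.

  Call the pair of ends of a path, or the tuple of ends of a spider, saturated if no bounded set
  of other vertices meets a quarter of the weight joining them.  If the ends are not saturated,
  the weight is controlled by that of shorter configurations; so if saturation is rare at
  all lengths, then most paths of length \<open>2k\<close> (spiders with \<open>s\<close> legs of length \<open>2k\<close>) have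
  bounded total weight for each choice of ends, and counting the choices of ends bounds
  \<open>(d D)^k\<close> by a constant times \<open>m\<close> (respectively \<open>(d D)^(k s)\<close> by a constant times \<open>m^(s - 1)\<close>).

  If saturation has positive probability at some length, prune the saturated configurations so
  that every end can be exchanged for many others and any few vertices can be avoided.  A
  configuration can then be lengthened by two: go from an end to the penultimate vertex of some
  leg and back out to another end.  This reaches length \<open>2k\<close> exactly (an odd defect is repaired by
  using the penultimate vertex as branch vertex), and a greedy choice builds the subdivision.
\<close>

section \<open>Light classes and dense relations\<close>

text \<open>The weights do the work of an upper bound on degrees: their total is the same at every
  length, while a single path weighs at most the product of the reciprocals of the minimum degrees
  at its interior positions. So it is enough to bound the weight of each class with fixed ends by a
  constant times the bound for one member. Such a bound is proved by cutting a configuration at a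
  blocking vertex, and both pieces must then belong to families that are already under control.
  Hence goodness is defined by recursion on length: saturation is tested only among configurations
  whose shorter pieces are good. The gain in the second bound comes from the count: mass of order
  \<open>|A| d\<close> is shared by \<open>|A| ^ s\<close> tuples of ends, each of weight at most
  about \<open>d / (d D) ^ (k s)\<close>. The constants do not interact: \<open>K\<close> (room for
  everything to be avoided) and \<open>\<epsilon>\<close> (tolerated mass of saturated
  configurations) depend on \<open>k\<close>, \<open>r\<close>, \<open>s\<close>, \<open>t\<close>
  only, then \<open>q0\<close> (an auxiliary set in a rectangle argument) on
  \<open>\<epsilon>\<close>, and finally the degree bound \<open>Q\<close> on all of them.\<close>

lemma prune_light_classes:
  fixes w :: "'b \<Rightarrow> real" and cl :: "'j \<Rightarrow> 'b \<Rightarrow> 'c" and \<theta> :: "'j \<Rightarrow> 'c \<Rightarrow> real"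
  assumes "finite E" "finite J" and nonneg: "\<And>j c. \<theta> j c \<ge> 0"
  shows "\<exists>E'\<subseteq>E. sum w E' \<ge> sum w E - (\<Sum>j\<in>J. \<Sum>c\<in>cl j ` E. \<theta> j c) \<and>
    (\<forall>j\<in>J. \<forall>x\<in>E'. sum w {y\<in>E'. cl j y = cl j x} \<ge> \<theta> j (cl j x))"
  using assms(1)
proof (induction "card E" arbitrary: E rule: less_induct)
  case less
  show ?case
  proof (cases "\<forall>j\<in>J. \<forall>x\<in>E. sum w {y\<in>E. cl j y = cl j x} \<ge> \<theta> j (cl j x)")
    case True
    have "(\<Sum>j\<in>J. \<Sum>c\<in>cl j ` E. \<theta> j c) \<ge> 0" using nonneg by (intro sum_nonneg) auto
    with True show ?thesis by (intro exI[of _ E]) auto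
  next
    case False
    then obtain j x where j: "j \<in> J" and x: "x \<in> E"
      and light: "sum w {y\<in>E. cl j y = cl j x} < \<theta> j (cl j x)" by (meson not_le)
    define C where "C = {y\<in>E. cl j y = cl j x}"
    have C: "C \<subseteq> E" "x \<in> C" using x by (auto simp: C_def)
    have "card (E - C) < card E"
      using C less.prems by (intro psubset_card_mono) auto
    from less.hyps[OF this finite_Diff[OF less.prems]] obtain E' where E': "E' \<subseteq> E - C"
      "sum w E' \<ge> sum w (E - C) - (\<Sum>j\<in>J. \<Sum>c\<in>cl j ` (E - C). \<theta> j c)"
      "\<forall>j\<in>J. \<forall>x\<in>E'. sum w {y\<in>E'. cl j y = cl j x} \<ge> \<theta> j (cl j x)"
      by blast
    have le: "(\<Sum>c\<in>cl i ` (E - C). \<theta> i c) \<le> (\<Sum>c\<in>cl i ` E. \<theta> i c)" for i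
      using less.prems nonneg by (intro sum_mono2) auto
    \<comment> \<open>The label of a deleted class never returns in partition \<open>j\<close>, so
      its threshold is charged only once; in the other partitions the set of labels can only
      shrink.\<close>
    have "cl j ` (E - C) \<subseteq> cl j ` E - {cl j x}" by (auto simp: C_def)
    then have "(\<Sum>c\<in>cl j ` (E - C). \<theta> j c) \<le> (\<Sum>c\<in>cl j ` E - {cl j x}. \<theta> j c)"
      using less.prems nonneg by (intro sum_mono2) auto
    also have "\<dots> = (\<Sum>c\<in>cl j ` E. \<theta> j c) - \<theta> j (cl j x)"
      using less.prems x by (subst sum_diff1) auto
    finally have lej: "(\<Sum>c\<in>cl j ` (E - C). \<theta> j c) \<le> (\<Sum>c\<in>cl j ` E. \<theta> j c) - \<theta> j (cl j x)" .
    have "(\<Sum>i\<in>J. \<Sum>c\<in>cl i ` (E - C). \<theta> i c) =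
        (\<Sum>c\<in>cl j ` (E - C). \<theta> j c) + (\<Sum>i\<in>J-{j}. \<Sum>c\<in>cl i ` (E - C). \<theta> i c)"
      using assms(2) j by (intro sum.remove) auto
    also have "\<dots> \<le> (\<Sum>c\<in>cl j ` E. \<theta> j c) - \<theta> j (cl j x) + (\<Sum>i\<in>J-{j}. \<Sum>c\<in>cl i ` E. \<theta> i c)"
      using le lej by (intro add_mono sum_mono) auto
    also have "\<dots> = (\<Sum>i\<in>J. \<Sum>c\<in>cl i ` E. \<theta> i c) - \<theta> j (cl j x)"
      using sum.remove[OF assms(2) j, of "\<lambda>i. \<Sum>c\<in>cl i ` E. \<theta> i c"] by simp
    finally have "(\<Sum>i\<in>J. \<Sum>c\<in>cl i ` (E - C). \<theta> i c) \<le> (\<Sum>i\<in>J. \<Sum>c\<in>cl i ` E. \<theta> i c) - \<theta> j (cl j x)" .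
    moreover have "sum w (E - C) = sum w E - sum w C"
      using less.prems C by (intro sum_diff) auto
    ultimately have "sum w E' \<ge> sum w E - (\<Sum>j\<in>J. \<Sum>c\<in>cl j ` E. \<theta> j c)"
      using E'(2) light unfolding C_def by linarith
    moreover have "E' \<subseteq> E" using E'(1) by blast
    ultimately show ?thesis using E'(3) by blast
  qed
qed

section \<open>Rectangles in dense relations\<close>

lemma card_large_values:
  fixes f :: "'a \<Rightarrow> nat" and \<epsilon> M :: real
  assumes "finite X" "M > 0" "\<And>x. x \<in> X \<Longrightarrow> real (f x) \<le> M"
    and "(\<Sum>x\<in>X. real (f x)) \<ge> \<epsilon> * M * card X" "\<epsilon> \<ge> 0"
  shows "real (card {x\<in>X. real (f x) \<ge> \<epsilon> / 2 * M}) \<ge> \<epsilon> / 2 * card X"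
proof -
  let ?L = "{x\<in>X. real (f x) \<ge> \<epsilon> / 2 * M}"
  have "(\<Sum>x\<in>X. real (f x)) = (\<Sum>x\<in>?L. real (f x)) + (\<Sum>x\<in>X-?L. real (f x))"
    using sum.subset_diff[of ?L X "\<lambda>x. real (f x)"] assms(1) by (simp add: add.commute)
  also have "(\<Sum>x\<in>?L. real (f x)) \<le> real (card ?L) * M"
    using assms(3) by (intro sum_bounded_above) auto
  also have "(\<Sum>x\<in>X-?L. real (f x)) \<le> real (card (X - ?L)) * (\<epsilon> / 2 * M)"
    by (intro sum_bounded_above) auto
  also have "real (card (X - ?L)) * (\<epsilon> / 2 * M) \<le> real (card X) * (\<epsilon> / 2 * M)"
    using assms by (intro mult_right_mono) (auto intro!: card_mono)
  finally have "\<epsilon> * M * card X \<le> real (card ?L) * M + real (card X) * (\<epsilon> / 2 * M)"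
    using assms(4) by linarith
  then have "M * (\<epsilon> / 2 * card X) \<le> M * real (card ?L)" by (simp add: algebra_simps)
  then show ?thesis using assms(2) by simp
qed

text \<open>A Kovari-Sos-Turan argument with fixed density. Only \<open>q\<close> columns with many
  rows are kept, so a row has at most \<open>2 ^ q\<close> traces on them. Double counting gives
  many rows with a trace of size at least \<open>\<epsilon> / 4 * q\<close>, and by pigeonhole
  \<open>s\<close> of these rows have the same trace.\<close>

lemma dense_relation_contains_rectangle:
  fixes R :: "('a \<times> 'b) set" and \<epsilon> :: real and q s t :: nat
  assumes fin: "finite X" "finite Y" and R: "R \<subseteq> X \<times> Y"
    and dens: "real (card R) \<ge> \<epsilon> * card X * card Y" and eps: "\<epsilon> > 0"
    and s: "s > 0"
    and q: "\<epsilon> / 4 * q \<ge> t" "q > 0" and Y: "\<epsilon> / 2 * card Y \<ge> q" and X: "\<epsilon> / 4 * card X \<ge> s * 2 ^ q"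
  shows "\<exists>X' Y'. X' \<subseteq> X \<and> Y' \<subseteq> Y \<and> card X' = s \<and> card Y' = t \<and> X' \<times> Y' \<subseteq> R"
proof -
  have Xpos: "real (card X) > 0"
  proof (rule ccontr)
    assume "\<not> ?thesis"
    then have "card X = 0" by simp
    with X s have "real s * 2 ^ q \<le> 0" by simp
    moreover have "real s * 2 ^ q > 0" using s by simp
    ultimately show False by linarith
  qed
  define ny where "ny y = {x\<in>X. (x, y) \<in> R}" for y
  have "R = (\<Union>y\<in>Y. ny y \<times> {y})" using R by (auto simp: ny_def)
  then have "card R = card (\<Union>y\<in>Y. ny y \<times> {y})" by simp
  also have "\<dots> = (\<Sum>y\<in>Y. card (ny y \<times> {y}))"
    using fin by (intro card_UN_disjoint) (auto simp: ny_def)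
  finally have cR: "card R = (\<Sum>y\<in>Y. card (ny y))" by (simp add: card_cartesian_product)
  have ny_le: "real (card (ny y)) \<le> card X" for y
    using fin by (auto simp: ny_def intro!: card_mono)
  define Y1 where "Y1 = {y\<in>Y. real (card (ny y)) \<ge> \<epsilon> / 2 * card X}"
  have "real (card Y1) \<ge> \<epsilon> / 2 * card Y"
    unfolding Y1_def using dens eps fin Xpos ny_le
    by (intro card_large_values) (auto simp: cR mult_ac)
  then have "card Y1 \<ge> q" using Y by linarith
  then obtain Y2 where Y2: "Y2 \<subseteq> Y1" "card Y2 = q" by (meson obtain_subset_with_card_n)
  have finY2: "finite Y2" using Y2 fin by (auto simp: Y1_def intro: finite_subset)
  define nx where "nx x = {y\<in>Y2. (x, y) \<in> R}" for x
  have "(\<Sum>x\<in>X. card (nx x)) = card (SIGMA x:X. nx x)"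
    using fin finY2 by (subst card_SigmaI) (auto simp: nx_def)
  also have "\<dots> = card ((\<lambda>(y, x). (x, y)) ` (SIGMA y:Y2. ny y))"
    by (intro arg_cong[of _ _ card]) (auto simp: nx_def ny_def)
  also have "\<dots> = card (SIGMA y:Y2. ny y)"
    by (intro card_image) (auto simp: inj_on_def)
  also have "\<dots> = (\<Sum>y\<in>Y2. card (ny y))"
    using fin finY2 by (subst card_SigmaI) (auto simp: ny_def)
  finally have "(\<Sum>x\<in>X. real (card (nx x))) = (\<Sum>y\<in>Y2. real (card (ny y)))"
    by (simp flip: of_nat_sum)
  moreover have "(\<Sum>y\<in>Y2. real (card (ny y))) \<ge> real (card Y2) * (\<epsilon> / 2 * card X)"
    using Y2 by (intro sum_bounded_below) (auto simp: Y1_def)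
  ultimately have dens2: "(\<Sum>x\<in>X. real (card (nx x))) \<ge> \<epsilon> / 2 * real q * card X"
    using Y2 by (simp add: mult_ac)
  have nx_le: "real (card (nx x)) \<le> real q" for x
    using finY2 Y2 by (auto simp: nx_def intro!: card_mono)
  define X1 where "X1 = {x\<in>X. real (card (nx x)) \<ge> \<epsilon> / 2 / 2 * real q}"
  have "real (card X1) \<ge> \<epsilon> / 2 / 2 * card X"
    unfolding X1_def using dens2 eps fin q nx_le by (intro card_large_values) auto
  then have X1: "real (card X1) \<ge> real s * 2 ^ q" using X by simp
  have finX1: "finite X1" using fin by (auto simp: X1_def)
  have "\<exists>Z\<in>Pow Y2. card {x\<in>X1. nx x = Z} \<ge> s"
  proof (rule ccontr)
    assume none: "\<not> ?thesis"
    have less: "card {x\<in>X1. nx x = Z} \<le> s - 1" if "Z \<in> Pow Y2" for Z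
    proof -
      have "\<not> s \<le> card {x\<in>X1. nx x = Z}" using none that by blast
      then show ?thesis by simp
    qed
    have "card X1 \<le> card (\<Union>Z\<in>Pow Y2. {x\<in>X1. nx x = Z})"
    proof (intro card_mono)
      have "nx x \<in> Pow Y2" for x by (auto simp: nx_def)
      then show "X1 \<subseteq> (\<Union>Z\<in>Pow Y2. {x\<in>X1. nx x = Z})" by blast
    qed (use finX1 finY2 in simp)
    also have "\<dots> \<le> (\<Sum>Z\<in>Pow Y2. card {x\<in>X1. nx x = Z})"
      using finY2 by (intro card_UN_le) auto
    also have "\<dots> \<le> of_nat (card (Pow Y2)) * (s - 1)"
      using less by (intro sum_bounded_above) auto
    also have "\<dots> = 2 ^ q * (s - 1)" using finY2 Y2 by (simp add: card_Pow)
    also have "\<dots> < 2 ^ q * s" using s by simp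
    finally have "real (card X1) < real (2 ^ q * s)" by (simp only: of_nat_less_iff)
    then show False using X1 by (simp add: mult_ac)
  qed
  then obtain Z where Z: "Z \<subseteq> Y2" "card {x\<in>X1. nx x = Z} \<ge> s" by auto
  then obtain X' where X': "X' \<subseteq> {x\<in>X1. nx x = Z}" "card X' = s"
    by (meson obtain_subset_with_card_n)
  then obtain x where "x \<in> X'" using s by fastforce
  then have "real (card Z) \<ge> \<epsilon> / 4 * q" using X' by (auto simp: X1_def)
  then have "card Z \<ge> t" using q by linarith
  then obtain Y' where Y': "Y' \<subseteq> Z" "card Y' = t" by (meson obtain_subset_with_card_n)
  have "X' \<times> Y' \<subseteq> R" using X' Y' by (auto simp: nx_def)
  moreover have "X' \<subseteq> X" "Y' \<subseteq> Y" using X' Y' Z Y2 by (auto simp: X1_def Y1_def)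
  ultimately show ?thesis using X' Y' by blast
qed

lemma sum_over_union_le:
  fixes w :: "'b \<Rightarrow> real"
  assumes "finite I" "\<And>i. i \<in> I \<Longrightarrow> finite (X i)" "\<And>x. w x \<ge> 0" "Z \<subseteq> (\<Union>i\<in>I. X i)"
  shows "sum w Z \<le> (\<Sum>i\<in>I. sum w (X i))"
proof -
  have "sum w Z \<le> sum w (\<Union>i\<in>I. X i)" using assms by (intro sum_mono2) auto
  also have "\<dots> \<le> (\<Sum>i\<in>I. sum w (X i))"
    using assms(1,2)
  proof (induction I rule: finite_induct)
    case (insert i I)
    have "sum w (\<Union>i\<in>insert i I. X i) = sum w (X i) + sum w (\<Union>i\<in>I. X i) - sum w (X i \<inter> (\<Union>i\<in>I. X i))"
      using insert by (simp add: sum_Un)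
    moreover have "sum w (X i \<inter> (\<Union>i\<in>I. X i)) \<ge> 0" using assms(3) by (intro sum_nonneg) auto
    ultimately show ?case using insert by simp
  qed simp
  finally show ?thesis .
qed

section \<open>Random-walk weights\<close>

locale walk_graph =
  fixes V :: "'a set" and N :: "'a \<Rightarrow> 'a set"
  assumes finV: "finite V" and N_sub: "N v \<subseteq> V" and N_sym: "u \<in> N v \<Longrightarrow> v \<in> N u"
    and N_irrefl: "v \<notin> N v" and N_ne: "v \<in> V \<Longrightarrow> N v \<noteq> {}"
begin

definition deg :: "'a \<Rightarrow> real" where "deg v = real (card (N v))"

definition walk :: "'a list \<Rightarrow> bool" where
  "walk P \<longleftrightarrow> P \<noteq> [] \<and> set P \<subseteq> V \<and> successively (\<lambda>u v. v \<in> N u) P"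

text \<open>The probability that the random walk started at \<^term>\<open>hd P\<close> follows \<^term>\<open>P\<close>.\<close>

definition q :: "'a list \<Rightarrow> real" where "q P = prod_list (map (\<lambda>v. 1 / deg v) (butlast P))"

text \<open>The degree of the start cancels: by \<open>wt_Cons\<close>, a walk with at least one
  edge weighs the product of the reciprocals of its interior degrees, which is the same in both
  directions. Up to the factor \<open>total\<close> this is the law of the stationary walk.\<close>

definition wt :: "'a list \<Rightarrow> real" where "wt P = deg (hd P) * q P"

definition walks :: "nat \<Rightarrow> 'a list set" where "walks h = {P. walk P \<and> length P = Suc h}"

definition total :: real where "total = (\<Sum>v\<in>V. deg v)"

lemma finN: "finite (N v)" using finite_subset[OF N_sub finV] .

lemma deg_pos: "v \<in> V \<Longrightarrow> deg v > 0"
  using N_ne finN by (simp add: deg_def card_gt_0_iff)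

lemma deg_nonneg: "deg v \<ge> 0" by (simp add: deg_def)

lemma walk_ne: "walk P \<Longrightarrow> P \<noteq> []" by (simp add: walk_def)

lemma walk_snoc: "P \<noteq> [] \<Longrightarrow> walk (P @ [x]) \<longleftrightarrow> walk P \<and> x \<in> N (last P)"
  using N_sub by (auto simp: walk_def successively_append_iff)

lemma walk_Cons: "P \<noteq> [] \<Longrightarrow> walk (x # P) \<longleftrightarrow> walk P \<and> x \<in> N (hd P)"
  using N_sub N_sym by (auto simp: walk_def successively_Cons)

lemma walk_single: "walk [v] \<longleftrightarrow> v \<in> V" by (simp add: walk_def)

lemma walk_take: "walk P \<Longrightarrow> i > 0 \<Longrightarrow> walk (take i P)"
  using successively_append_iff[of _ "take i P" "drop i P"]
  by (auto simp: walk_def dest: in_set_takeD)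

lemma walk_drop: "walk P \<Longrightarrow> i < length P \<Longrightarrow> walk (drop i P)"
  using successively_append_iff[of _ "take i P" "drop i P"]
  by (auto simp: walk_def dest: in_set_dropD)

lemma walk_rev: "walk P \<Longrightarrow> walk (rev P)"
  using N_sym by (auto simp: walk_def elim: successively_mono)

lemma walk_set: "walk P \<Longrightarrow> set P \<subseteq> V" by (simp add: walk_def)

lemma walk_hd_last: "walk P \<Longrightarrow> hd P \<in> V \<and> last P \<in> V"
  unfolding walk_def using hd_in_set last_in_set by blast

lemma walk_nth: "walk P \<Longrightarrow> Suc i < length P \<Longrightarrow> P ! Suc i \<in> N (P ! i)"
  unfolding walk_def
proof (elim conjE)
  assume s: "successively (\<lambda>u v. v \<in> N u) P" and i: "Suc i < length P"
  have "P = take (Suc i) P @ drop (Suc i) P" by simp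
  then have "successively (\<lambda>u v. v \<in> N u) (take (Suc i) P @ drop (Suc i) P)" using s by simp
  then have "hd (drop (Suc i) P) \<in> N (last (take (Suc i) P))"
    using i unfolding successively_append_iff by auto
  then show ?thesis using i by (simp add: hd_drop_conv_nth take_Suc_conv_app_nth)
qed

lemma q_nonneg: "q P \<ge> 0"
  unfolding q_def by (rule prod_list_nonneg) (auto simp: deg_nonneg)

lemma wt_nonneg: "wt P \<ge> 0" by (simp add: wt_def q_nonneg deg_nonneg)

lemma q_pos: "walk P \<Longrightarrow> q P > 0"
proof -
  assume w: "walk P"
  have "\<forall>v\<in>set (butlast P). deg v > 0"
    using deg_pos walk_set[OF w] in_set_butlastD by fastforce
  then have "\<forall>x\<in>set (map (\<lambda>v. 1 / deg v) (butlast P)). x > 0" by auto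
  moreover have "(\<forall>x\<in>set xs. x > 0) \<Longrightarrow> prod_list xs > 0" for xs :: "real list"
    by (induction xs) auto
  ultimately show ?thesis unfolding q_def by blast
qed

lemma q_single [simp]: "q [v] = 1" by (simp add: q_def)

lemma q_snoc: "P \<noteq> [] \<Longrightarrow> q (P @ [x]) = q P / deg (last P)"
  by (cases P rule: rev_cases) (simp_all add: q_def butlast_append)

lemma q_split: "i < length P \<Longrightarrow> q P = q (take (Suc i) P) * q (drop i P)"
proof -
  assume i: "i < length P"
  have "butlast P = take i P @ butlast (drop i P)"
    using i by (metis append_take_drop_id butlast_append drop_eq_Nil leD)
  then show ?thesis using i unfolding q_def
    by (simp add: butlast_take flip: map_append prod_list.append)
qed

lemma wt_Cons: "P \<noteq> [] \<Longrightarrow> x \<in> V \<Longrightarrow> wt (x # P) = q P"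
  using deg_pos[of x] by (simp add: wt_def q_def)

lemma wt_split:
  assumes "walk P" "i < length P"
  shows "wt P = wt (take (Suc i) P) * wt (drop i P) / deg (P ! i)"
proof -
  have "deg (P ! i) > 0" using deg_pos walk_set[OF assms(1)] nth_mem[OF assms(2)] by blast
  moreover have "hd (take (Suc i) P) = hd P" by simp
  ultimately show ?thesis using assms q_split[of i P]
    by (simp add: wt_def hd_drop_conv_nth)
qed

lemma finite_walks: "finite (walks h)"
proof (rule finite_subset)
  show "walks h \<subseteq> {P. set P \<subseteq> V \<and> length P = Suc h}" by (auto simp: walks_def walk_def)
  show "finite {P. set P \<subseteq> V \<and> length P = Suc h}" using finV by (rule finite_lists_length_eq)
qed

lemma sum_wt_snoc:
  assumes X: "X \<subseteq> walks h"
  shows "sum wt {P\<in>walks (Suc h). butlast P \<in> X \<and> R P} =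
    (\<Sum>P\<in>X. wt P * real (card {x\<in>N (last P). R (P @ [x])}) / deg (last P))"
proof -
  have finX: "finite X" using X finite_walks finite_subset by blast
  have ne: "P \<noteq> []" if "P \<in> X" for P using that X by (auto simp: walks_def)
  have eq: "{P\<in>walks (Suc h). butlast P \<in> X \<and> R P} =
      (\<lambda>(P, x). P @ [x]) ` (SIGMA P:X. {x\<in>N (last P). R (P @ [x])})"
  proof (intro equalityI subsetI)
    fix P assume P: "P \<in> {P\<in>walks (Suc h). butlast P \<in> X \<and> R P}"
    then have "P \<noteq> []" by (auto simp: walks_def)
    then have e: "P = butlast P @ [last P]" by simp
    have "walk (butlast P @ [last P])" using P e by (auto simp: walks_def)
    then have "last P \<in> N (last (butlast P))" using walk_snoc ne P by blast
    then show "P \<in> (\<lambda>(P, x). P @ [x]) ` (SIGMA P:X. {x\<in>N (last P). R (P @ [x])})"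
      using P e by (intro image_eqI[of _ _ "(butlast P, last P)"]) auto
  next
    fix P assume "P \<in> (\<lambda>(P, x). P @ [x]) ` (SIGMA P:X. {x\<in>N (last P). R (P @ [x])})"
    then obtain P' x where "P' \<in> X" "x \<in> N (last P')" "R (P' @ [x])" "P = P' @ [x]" by auto
    then show "P \<in> {P\<in>walks (Suc h). butlast P \<in> X \<and> R P}"
      using X ne[of P'] walk_snoc[of P' x] by (auto simp: walks_def)
  qed
  have "sum wt {P\<in>walks (Suc h). butlast P \<in> X \<and> R P} =
      (\<Sum>(P, x)\<in>(SIGMA P:X. {x\<in>N (last P). R (P @ [x])}). wt (P @ [x]))"
    unfolding eq by (subst sum.reindex) (auto simp: inj_on_def case_prod_unfold)
  also have "\<dots> = (\<Sum>P\<in>X. \<Sum>x\<in>{x\<in>N (last P). R (P @ [x])}. wt (P @ [x]))"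
    using finX finN by (intro sum.Sigma[symmetric]) auto
  also have "\<dots> = (\<Sum>P\<in>X. wt P * real (card {x\<in>N (last P). R (P @ [x])}) / deg (last P))"
  proof (intro sum.cong refl)
    fix P assume "P \<in> X"
    then have "wt (P @ [x]) = wt P / deg (last P)" for x
      using ne q_snoc by (simp add: wt_def)
    then show "(\<Sum>x\<in>{x\<in>N (last P). R (P @ [x])}. wt (P @ [x])) =
        wt P * real (card {x\<in>N (last P). R (P @ [x])}) / deg (last P)" by simp
  qed
  finally show ?thesis .
qed

lemma sum_wt_butlast:
  assumes X: "X \<subseteq> walks h"
  shows "sum wt {P\<in>walks (Suc h). butlast P \<in> X} = sum wt X"
proof -
  have "wt P * real (card {x\<in>N (last P). True}) / deg (last P) = wt P" if "P \<in> X" for P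
    using that X walk_hd_last[of P] deg_pos[of "last P"] by (auto simp: walks_def deg_def)
  then show ?thesis using sum_wt_snoc[OF X, of "\<lambda>_. True"] by simp
qed

text \<open>Reversibility: each of the \<open>deg (hd P)\<close> neighbours that can be put in front
  of \<open>P\<close> gives a walk of weight \<open>q P\<close>, and these add up to
  \<open>wt P\<close>. Together with \<open>sum_wt_butlast\<close> this allows a walk to be
  shortened at either end without loss of mass.\<close>

lemma sum_wt_tl:
  assumes X: "X \<subseteq> walks h"
  shows "sum wt {P\<in>walks (Suc h). tl P \<in> X} = sum wt X"
proof -
  have finX: "finite X" using X finite_walks finite_subset by blast
  have ne: "P \<noteq> []" if "P \<in> X" for P using that X by (auto simp: walks_def)
  have eq: "{P\<in>walks (Suc h). tl P \<in> X} = (\<lambda>(P, x). x # P) ` (SIGMA P:X. N (hd P))"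
  proof (intro equalityI subsetI)
    fix P assume P: "P \<in> {P\<in>walks (Suc h). tl P \<in> X}"
    then have e: "P = hd P # tl P" by (cases P) (auto simp: walks_def)
    then have "hd P \<in> N (hd (tl P))" using walk_Cons[of "tl P" "hd P"] ne P by (auto simp: walks_def)
    then show "P \<in> (\<lambda>(P, x). x # P) ` (SIGMA P:X. N (hd P))"
      using P e by (intro image_eqI[of _ _ "(tl P, hd P)"]) auto
  next
    fix P assume "P \<in> (\<lambda>(P, x). x # P) ` (SIGMA P:X. N (hd P))"
    then obtain P' x where "P' \<in> X" "x \<in> N (hd P')" "P = x # P'" by auto
    then show "P \<in> {P\<in>walks (Suc h). tl P \<in> X}"
      using X ne[of P'] walk_Cons[of P' x] by (auto simp: walks_def)
  qed
  have "sum wt {P\<in>walks (Suc h). tl P \<in> X} = (\<Sum>(P, x)\<in>(SIGMA P:X. N (hd P)). wt (x # P))"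
    unfolding eq by (subst sum.reindex) (auto simp: inj_on_def case_prod_unfold)
  also have "\<dots> = (\<Sum>P\<in>X. \<Sum>x\<in>N (hd P). wt (x # P))"
    using finX finN by (intro sum.Sigma[symmetric]) auto
  also have "\<dots> = sum wt X"
  proof (intro sum.cong refl)
    fix P assume "P \<in> X"
    then have "wt (x # P) = q P" if "x \<in> N (hd P)" for x
      using ne wt_Cons N_sub that by blast
    then show "(\<Sum>x\<in>N (hd P). wt (x # P)) = wt P" by (simp add: wt_def deg_def)
  qed
  finally show ?thesis .
qed

lemma sum_wt_walks: "sum wt (walks h) = total"
proof (induction h)
  case 0
  have "walks 0 = (\<lambda>v. [v]) ` V"
    by (auto simp: walks_def walk_def length_Suc_conv)
  then show ?case by (simp add: total_def sum.reindex inj_on_def wt_def)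
next
  case (Suc h)
  have "{P\<in>walks (Suc h). butlast P \<in> walks h} = walks (Suc h)"
  proof -
    have "butlast P \<in> walks h" if "P \<in> walks (Suc h)" for P
    proof -
      have "walk (take (Suc h) P)" using that by (intro walk_take) (auto simp: walks_def)
      then show ?thesis using that by (auto simp: walks_def butlast_conv_take)
    qed
    then show ?thesis by auto
  qed
  then show ?case using sum_wt_butlast[of "walks h" h] Suc by simp
qed

end

section \<open>Spiders\<close>

context walk_graph
begin

text \<open>A spider is the list of its legs, all of which start at the common centre.\<close>

definition spiders :: "'a set \<Rightarrow> nat \<Rightarrow> (nat \<Rightarrow> nat) \<Rightarrow> 'a list list set" where
  "spiders Z s lg = {S. length S = s \<and>
     (\<exists>v\<in>Z. \<forall>i<s. walk (S ! i) \<and> hd (S ! i) = v \<and> length (S ! i) = Suc (lg i))}"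

definition centre :: "'a list list \<Rightarrow> 'a" where "centre S = hd (hd S)"

text \<open>The law of independent walks from a stationary centre: the degree of the centre occurs
  once, and every leg contributes only its transition probabilities.\<close>

definition sw :: "'a list list \<Rightarrow> real" where "sw S = deg (centre S) * prod_list (map q S)"

text \<open>The centre is listed once, so that \<open>distinct (vlist S)\<close> says both that the
  legs are paths and that they meet only in the centre.\<close>

definition vlist :: "'a list list \<Rightarrow> 'a list" where "vlist S = centre S # concat (map tl S)"

lemma spiders_iff:
  assumes "s > 0"
  shows "S \<in> spiders Z s lg \<longleftrightarrow> length S = s \<and> centre S \<in> Z \<and>
    (\<forall>i<s. walk (S ! i) \<and> hd (S ! i) = centre S \<and> length (S ! i) = Suc (lg i))"
proof -
  have "centre S = hd (S ! 0)" if "length S = s"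
    using that assms by (auto simp: centre_def hd_conv_nth)
  then show ?thesis using assms unfolding spiders_def by auto
qed

lemma spiders_cong: "(\<And>i. i < s \<Longrightarrow> lg i = lg' i) \<Longrightarrow> spiders Z s lg = spiders Z s lg'"
  by (auto simp: spiders_def)

lemma finite_spiders:
  assumes "finite Z"
  shows "finite (spiders Z s lg)"
proof (rule finite_subset)
  let ?U = "{P. set P \<subseteq> V \<and> length P \<le> Suc (\<Sum>i<s. lg i)}"
  show "spiders Z s lg \<subseteq> {S. set S \<subseteq> ?U \<and> length S = s}"
  proof
    fix S assume S: "S \<in> spiders Z s lg"
    have "set S \<subseteq> ?U"
    proof
      fix P assume "P \<in> set S"
      then obtain i where i: "i < length S" "P = S ! i" by (metis in_set_conv_nth)
      then have "walk P" "length P = Suc (lg i)" using S by (auto simp: spiders_def)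
      moreover have "lg i \<le> (\<Sum>i<s. lg i)" using i S by (intro member_le_sum) (auto simp: spiders_def)
      ultimately show "P \<in> ?U" by (auto simp: walk_def)
    qed
    then show "S \<in> {S. set S \<subseteq> ?U \<and> length S = s}" using S by (auto simp: spiders_def)
  qed
  show "finite {S. set S \<subseteq> ?U \<and> length S = s}"
    using finite_lists_length_le[OF finV] by (intro finite_lists_length_eq)
qed

lemma centre_update: "i < length S \<Longrightarrow> hd P = centre S \<Longrightarrow> centre (S[i := P]) = centre S"
  by (cases S) (auto simp: centre_def split: nat.splits)

lemma spiders_update:
  assumes "s > 0" "S \<in> spiders Z s lg" "i < s" "walk P" "hd P = centre S" "length P = Suc h"
  shows "S[i := P] \<in> spiders Z s (lg(i := h))"
  using assms centre_update[of i S P] by (auto simp: spiders_iff nth_list_update)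

lemma prod_list_q_update:
  "i < length S \<Longrightarrow> prod_list (map q (S[i := P])) =
     prod_list (map q (take i S)) * q P * prod_list (map q (drop (Suc i) S))"
  by (simp add: upd_conv_take_nth_drop)

lemma sw_update:
  assumes "i < length S" "hd P = centre S" "q P = q (S ! i) * c"
  shows "sw (S[i := P]) = sw S * c"
  using prod_list_q_update[OF assms(1), of P] prod_list_q_update[OF assms(1), of "S ! i"]
    centre_update[OF assms(1,2)] assms(3) by (simp add: sw_def)

lemma sw_nonneg: "sw S \<ge> 0"
  unfolding sw_def by (intro mult_nonneg_nonneg prod_list_nonneg) (auto simp: deg_nonneg q_nonneg)

lemma sw_pos:
  assumes "s > 0" "Z \<subseteq> V" "S \<in> spiders Z s lg"
  shows "sw S > 0"
proof -
  have "\<forall>P\<in>set S. q P > 0"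
    using assms q_pos by (auto simp: spiders_iff in_set_conv_nth)
  moreover have "(\<forall>P\<in>set xs. q P > 0) \<Longrightarrow> prod_list (map q xs) > 0" for xs
    by (induction xs) auto
  moreover have "deg (centre S) > 0" using assms deg_pos by (auto simp: spiders_iff)
  ultimately show ?thesis by (simp add: sw_def)
qed

text \<open>A new leg changes a block in the middle of the list; equality up to order is enough to
  transfer distinctness and vertex sets.\<close>

lemma mset_vlist_update:
  assumes "i < length S" "hd P = centre S"
  shows "mset (vlist (S[i := P])) + mset (tl (S ! i)) = mset (vlist S) + mset (tl P)"
proof -
  have eq: "mset (vlist (S[i := R])) = {#centre S#} + mset (concat (map tl (take i S))) + mset (tl R)
      + mset (concat (map tl (drop (Suc i) S)))" if "centre (S[i := R]) = centre S" for R
    using assms(1) that by (simp add: vlist_def upd_conv_take_nth_drop)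
  show ?thesis
    using eq[of P] eq[of "S ! i"] centre_update[OF assms] by simp
qed

lemma set_leg_subset_vlist:
  assumes "S \<in> spiders Z s lg" "i < s"
  shows "set (S ! i) \<subseteq> set (vlist S)"
proof -
  have s: "s > 0" using assms(2) by simp
  then have "S ! i \<noteq> []" "hd (S ! i) = centre S" "S ! i \<in> set S"
    using assms by (auto simp: spiders_iff walk_ne)
  then have "set (S ! i) = insert (centre S) (set (tl (S ! i)))" by (cases "S ! i") auto
  then show ?thesis using \<open>S ! i \<in> set S\<close> by (auto simp: vlist_def)
qed

lemma distinct_legs:
  assumes S: "S \<in> spiders Z s lg" and d: "distinct (vlist S)" and ij: "i < s" "j < s" "i \<noteq> j"
    and a: "a \<in> set (tl (S ! i))"
  shows "a \<notin> set (S ! j)"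
proof -
  have s: "s > 0" using ij by simp
  \<comment> \<open>With leg \<open>i\<close> made trivial, \<open>vlist S\<close> splits up to
    order into \<open>vlist S'\<close> and \<open>tl (S ! i)\<close>, and leg \<open>j\<close> lies
    within the former.\<close>
  define S' where "S' = S[i := [centre S]]"
  have "centre S \<in> V" using S s ij walk_hd_last[of "S ! i"] by (auto simp: spiders_iff)
  then have S': "S' \<in> spiders Z s (lg(i := 0))"
    unfolding S'_def using S s ij by (intro spiders_update) (auto simp: walk_single)
  have "mset (vlist S') + mset (tl (S ! i)) = mset (vlist S)"
    unfolding S'_def using mset_vlist_update[of i S "[centre S]"] S ij by (simp add: spiders_def)
  then have "mset (vlist S' @ tl (S ! i)) = mset (vlist S)" by simp
  then have "distinct (vlist S' @ tl (S ! i))" using d mset_eq_imp_distinct_iff by blast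
  then have "a \<notin> set (vlist S')" using a by auto
  moreover have "S' ! j = S ! j" using ij by (simp add: S'_def)
  ultimately show ?thesis using set_leg_subset_vlist[OF S' ij(2)] by auto
qed

lemma distinct_leg:
  assumes S: "S \<in> spiders Z s lg" and d: "distinct (vlist S)" and i: "i < s"
  shows "distinct (S ! i)"
proof -
  have s: "s > 0" using i by simp
  then have *: "S ! i \<noteq> []" "hd (S ! i) = centre S" "S ! i \<in> set S"
    using S i by (auto simp: spiders_iff walk_ne)
  have "distinct (tl (S ! i))" "centre S \<notin> set (tl (S ! i))"
    using d * by (auto simp: vlist_def distinct_concat_iff)
  then show ?thesis using * by (cases "S ! i") auto
qed

section \<open>Mass of spiders under extension and truncation; pruning and lengthening\<close>

lemma sum_sw_snoc:
  assumes s: "s > 0" and Z: "Z \<subseteq> V" and X: "X \<subseteq> spiders Z s lg" and i: "i < s"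
  shows "sum sw {S\<in>spiders Z s (lg(i := Suc (lg i))). S[i := butlast (S ! i)] \<in> X \<and> R S} =
    (\<Sum>S\<in>X. sw S * real (card {x\<in>N (last (S ! i)). R (S[i := S ! i @ [x]])}) / deg (last (S ! i)))"
proof -
  have finX: "finite X" using X finite_spiders finV Z finite_subset by metis
  have leg: "length S = s" "S ! i \<noteq> []" "walk (S ! i)" "hd (S ! i) = centre S" "length (S ! i) = Suc (lg i)"
    if "S \<in> X" for S using that X s i by (auto simp: spiders_iff walk_ne)
  let ?ext = "\<lambda>(S, x). S[i := S ! i @ [x]]"
  let ?Sg = "SIGMA S:X. {x\<in>N (last (S ! i)). R (S[i := S ! i @ [x]])}"
  have eq: "{S\<in>spiders Z s (lg(i := Suc (lg i))). S[i := butlast (S ! i)] \<in> X \<and> R S} = ?ext ` ?Sg"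
  proof (intro equalityI subsetI)
    fix S assume S: "S \<in> {S\<in>spiders Z s (lg(i := Suc (lg i))). S[i := butlast (S ! i)] \<in> X \<and> R S}"
    then have S2: "length S = s" "walk (S ! i)" using s i by (auto simp: spiders_iff)
    then have ne: "S ! i \<noteq> []" by (auto simp: walk_ne)
    let ?S' = "S[i := butlast (S ! i)]"
    have b: "?S' ! i = butlast (S ! i)" using S2 i by simp
    have e: "butlast (S ! i) @ [last (S ! i)] = S ! i" using ne by simp
    have "butlast (S ! i) \<noteq> []" using leg(2)[of ?S'] S b by auto
    then have "last (S ! i) \<in> N (last (butlast (S ! i)))" using walk_snoc S2 e by metis
    then show "S \<in> ?ext ` ?Sg"
      using S b e by (intro image_eqI[of _ _ "(?S', last (S ! i))"]) auto
  next
    fix S assume "S \<in> ?ext ` ?Sg"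
    then obtain S' x where S': "S' \<in> X" "x \<in> N (last (S' ! i))" "R S" "S = S'[i := S' ! i @ [x]]" by auto
    have "walk (S' ! i @ [x])" using leg[OF S'(1)] S' walk_snoc by blast
    then have "S \<in> spiders Z s (lg(i := Suc (lg i)))"
      unfolding S'(4) using X S'(1) leg[OF S'(1)] s i by (intro spiders_update) auto
    moreover have "S[i := butlast (S ! i)] = S'" using S' leg[OF S'(1)] i by simp
    ultimately show "S \<in> {S\<in>spiders Z s (lg(i := Suc (lg i))). S[i := butlast (S ! i)] \<in> X \<and> R S}"
      using S' by simp
  qed
  have inj: "inj_on ?ext ?Sg"
  proof (rule inj_onI, clarify)
    fix S x S' x' assume *: "S \<in> X" "S' \<in> X" "S[i := S ! i @ [x]] = S'[i := S' ! i @ [x']]"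
    have "S ! i @ [x] = S' ! i @ [x']"
      using arg_cong[OF *(3), of "\<lambda>T. T ! i"] leg[OF *(1)] leg[OF *(2)] i by simp
    moreover have "S = (S[i := S ! i @ [x]])[i := S ! i]" "S' = (S'[i := S' ! i @ [x']])[i := S' ! i]"
      by simp_all
    ultimately show "S = S' \<and> x = x'" using *(3) by (metis append1_eq_conv)
  qed
  have "sum sw {S\<in>spiders Z s (lg(i := Suc (lg i))). S[i := butlast (S ! i)] \<in> X \<and> R S} =
      (\<Sum>(S, x)\<in>?Sg. sw (S[i := S ! i @ [x]]))"
    unfolding eq by (subst sum.reindex[OF inj]) (auto simp: case_prod_unfold)
  also have "\<dots> = (\<Sum>S\<in>X. \<Sum>x\<in>{x\<in>N (last (S ! i)). R (S[i := S ! i @ [x]])}. sw (S[i := S ! i @ [x]]))"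
    using finX finN by (intro sum.Sigma[symmetric]) auto
  also have "\<dots> = (\<Sum>S\<in>X. sw S * real (card {x\<in>N (last (S ! i)). R (S[i := S ! i @ [x]])}) / deg (last (S ! i)))"
  proof (intro sum.cong refl)
    fix S assume "S \<in> X"
    note l = leg[OF this]
    have "sw (S[i := S ! i @ [x]]) = sw S * (1 / deg (last (S ! i)))" for x
      using l i q_snoc[of "S ! i" x] by (intro sw_update) auto
    then show "(\<Sum>x\<in>{x\<in>N (last (S ! i)). R (S[i := S ! i @ [x]])}. sw (S[i := S ! i @ [x]])) =
        sw S * real (card {x\<in>N (last (S ! i)). R (S[i := S ! i @ [x]])}) / deg (last (S ! i))" by simp
  qed
  finally show ?thesis .
qed

lemma sum_sw_butlast:
  assumes "s > 0" "Z \<subseteq> V" "X \<subseteq> spiders Z s lg" "i < s"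
  shows "sum sw {S\<in>spiders Z s (lg(i := Suc (lg i))). S[i := butlast (S ! i)] \<in> X} = sum sw X"
proof -
  have "sw S * real (card {x\<in>N (last (S ! i)). True}) / deg (last (S ! i)) = sw S" if "S \<in> X" for S
  proof -
    have "walk (S ! i)" using that assms by (auto simp: spiders_iff)
    then have "deg (last (S ! i)) > 0" using walk_hd_last deg_pos by blast
    then show ?thesis by (auto simp: deg_def)
  qed
  then show ?thesis using sum_sw_snoc[OF assms, of "\<lambda>_. True"] by simp
qed

lemma spiders_butlast:
  assumes "s > 0" "S \<in> spiders Z s lg" "i < s" "lg i = Suc h"
  shows "S[i := butlast (S ! i)] \<in> spiders Z s (lg(i := h))"
proof -
  have l: "walk (S ! i)" "length (S ! i) = Suc (Suc h)" "hd (S ! i) = centre S"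
    using assms by (auto simp: spiders_iff)
  have "walk (take (Suc h) (S ! i))" using l by (intro walk_take) auto
  moreover have "take (Suc h) (S ! i) = butlast (S ! i)" using l by (simp add: butlast_conv_take)
  moreover have "hd (take (Suc h) (S ! i)) = centre S" using l by simp
  ultimately show ?thesis using assms l by (intro spiders_update) auto
qed

text \<open>Marginalisation: the steps beyond the truncated lengths are summed out one at a time,
  and each sum over a last step contributes the factor one.\<close>

lemma sum_sw_truncate:
  assumes s: "s > 0" and Z: "Z \<subseteq> V" and X: "X \<subseteq> spiders Z s lg'" and le: "\<And>i. i < s \<Longrightarrow> lg' i \<le> lg i"
  shows "sum sw {S\<in>spiders Z s lg. map (\<lambda>i. take (Suc (lg' i)) (S ! i)) [0..<s] \<in> X} = sum sw X"
  using le
proof (induction "\<Sum>i<s. lg i - lg' i" arbitrary: lg)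
  case 0
  then have eq: "lg i = lg' i" if "i < s" for i using that by (simp add: le_antisym)
  then have SPeq: "spiders Z s lg = spiders Z s lg'" by (rule spiders_cong)
  have "map (\<lambda>i. take (Suc (lg' i)) (S ! i)) [0..<s] = S" if "S \<in> spiders Z s lg'" for S
    using that s by (intro nth_equalityI) (auto simp: spiders_iff)
  then have "{S\<in>spiders Z s lg. map (\<lambda>i. take (Suc (lg' i)) (S ! i)) [0..<s] \<in> X} = X"
    unfolding SPeq using X by auto
  then show ?case by simp
next
  case (Suc n)
  have "\<exists>i<s. lg i - lg' i > 0"
  proof (rule ccontr)
    assume "\<not> ?thesis"
    then have "lg i - lg' i = 0" if "i < s" for i using that by (metis neq0_conv)
    then have "(\<Sum>i<s. lg i - lg' i) = 0" by simp
    then show False using Suc.hyps(2) by simp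
  qed
  then obtain i where i: "i < s" "lg' i < lg i" by auto
  then obtain h where h: "lg i = Suc h" by (cases "lg i") auto
  define m where "m = lg(i := h)"
  have ml: "lg = m(i := Suc (m i))" using h by (auto simp: m_def)
  have "(\<Sum>j<s. lg j - lg' j) = (lg i - lg' i) + (\<Sum>j\<in>{..<s}-{i}. lg j - lg' j)"
    using i by (intro sum.remove) auto
  moreover have "(\<Sum>j<s. m j - lg' j) = (m i - lg' i) + (\<Sum>j\<in>{..<s}-{i}. m j - lg' j)"
    using i by (intro sum.remove) auto
  moreover have "(\<Sum>j\<in>{..<s}-{i}. m j - lg' j) = (\<Sum>j\<in>{..<s}-{i}. lg j - lg' j)"
    by (intro sum.cong) (auto simp: m_def)
  ultimately have "n = (\<Sum>j<s. m j - lg' j)" using Suc.hyps(2) i h by (simp add: m_def)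
  moreover have "lg' j \<le> m j" if "j < s" for j using Suc.prems that i h by (auto simp: m_def)
  ultimately have IH:
    "sum sw {S\<in>spiders Z s m. map (\<lambda>i. take (Suc (lg' i)) (S ! i)) [0..<s] \<in> X} = sum sw X"
    using Suc.hyps(1) by blast
  let ?X = "{S\<in>spiders Z s m. map (\<lambda>i. take (Suc (lg' i)) (S ! i)) [0..<s] \<in> X}"
  have "{S\<in>spiders Z s lg. S[i := butlast (S ! i)] \<in> ?X} =
      {S\<in>spiders Z s lg. map (\<lambda>i. take (Suc (lg' i)) (S ! i)) [0..<s] \<in> X}"
  proof (intro Collect_cong conj_cong refl)
    fix S assume S: "S \<in> spiders Z s lg"
    have l: "length S = s" "length (S ! i) = Suc (Suc h)" using S s i h by (auto simp: spiders_iff)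
    have eqm: "map (\<lambda>j. take (Suc (lg' j)) (S[i := butlast (S ! i)] ! j)) [0..<s] =
        map (\<lambda>j. take (Suc (lg' j)) (S ! j)) [0..<s]"
      using l i h by (intro nth_equalityI) (auto simp: nth_list_update butlast_conv_take min_def)
    show "S[i := butlast (S ! i)] \<in> ?X \<longleftrightarrow> map (\<lambda>i. take (Suc (lg' i)) (S ! i)) [0..<s] \<in> X"
      unfolding mem_Collect_eq eqm m_def using spiders_butlast[OF s S i(1) h] by blast
  qed
  then show ?case
    using sum_sw_butlast[OF s Z, of ?X m i] i IH by (simp flip: ml)
qed

text \<open>With every leg truncated to length zero, one spider of weight \<open>deg v\<close>
  remains for each centre \<open>v\<close>.\<close>

lemma sum_sw_spiders:
  assumes s: "s > 0" and Z: "Z \<subseteq> V"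
  shows "sum sw (spiders Z s lg) = (\<Sum>v\<in>Z. deg v)"
proof -
  let ?t = "\<lambda>S. map (\<lambda>i. take (Suc 0) (S ! i)) [0..<s]"
  have 0: "spiders Z s (\<lambda>_. 0) = (\<lambda>v. replicate s [v]) ` Z"
  proof (intro equalityI subsetI)
    fix S assume S: "S \<in> spiders Z s (\<lambda>_. 0)"
    have "S ! i = [centre S]" if "i < s" for i
      using S s that by (cases "S ! i") (auto simp: spiders_iff)
    then have "S = replicate s [centre S]" using S s by (intro nth_equalityI) (auto simp: spiders_iff)
    then show "S \<in> (\<lambda>v. replicate s [v]) ` Z" using S s by (auto simp: spiders_iff)
  next
    fix S assume "S \<in> (\<lambda>v. replicate s [v]) ` Z"
    then obtain v where "v \<in> Z" "S = replicate s [v]" by blast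
    then show "S \<in> spiders Z s (\<lambda>_. 0)"
      using Z unfolding spiders_def by (intro CollectI conjI bexI[of _ v]) (auto simp: walk_single)
  qed
  have "?t S \<in> spiders Z s (\<lambda>_. 0)" if "S \<in> spiders Z s lg" for S
  proof -
    have "take (Suc 0) (S ! i) = [centre S]" if "i < s" for i
    proof -
      have "walk (S ! i)" "hd (S ! i) = centre S" using \<open>S \<in> _\<close> that s by (auto simp: spiders_iff)
      then show ?thesis by (cases "S ! i") (auto simp: walk_def)
    qed
    then have "?t S = replicate s [centre S]" by (intro nth_equalityI) auto
    then show ?thesis using that s 0 by (auto simp: spiders_iff)
  qed
  then have "{S\<in>spiders Z s lg. ?t S \<in> spiders Z s (\<lambda>_. 0)} = spiders Z s lg" by auto
  moreover have "inj_on (\<lambda>v. replicate s [v]) Z" using s by (auto simp: inj_on_def)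
  moreover have "prod_list (map q (replicate n [v])) = 1" for n v by (induction n) auto
  ultimately show ?thesis
    using sum_sw_truncate[OF s Z, of "spiders Z s (\<lambda>_. 0)" "\<lambda>_. 0" lg] s
    by (auto simp: 0 sum.reindex sw_def centre_def intro!: sum.cong)
qed

text \<open>Two kinds of classes are protected by \<open>prune_light_classes\<close>: spiders with
  the same ends keep at least half of their original weight, and spiders that agree after deletion
  of the last vertex of a leg keep an \<open>\<epsilon> / (4 * s)\<close> share of the weight of the
  shortened spider. The loss is half of \<open>E\<close> plus at most \<open>\<epsilon> / 4\<close>
  of the whole mass, so \<open>\<epsilon> / 4\<close> survives. A set meeting at most a quarter of a
  saturated class cannot meet all of the surviving half, which gives avoidance; the share of
  one-step extensions gives many exchangeable ends.\<close>

lemma prune_spiders: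
  assumes s: "s > 0" and Z: "Z \<subseteq> V" and E: "E \<subseteq> spiders Z s lg"
    and sat: "\<And>S Y. S \<in> E \<Longrightarrow> finite Y \<Longrightarrow> card Y \<le> K \<Longrightarrow> Y \<inter> set (map last S) = {} \<Longrightarrow>
      4 * sum sw {S'\<in>E. map last S' = map last S \<and> set (vlist S') \<inter> Y \<noteq> {}}
        \<le> sum sw {S'\<in>E. map last S' = map last S}"
    and eps: "\<epsilon> > 0" and big: "sum sw E \<ge> \<epsilon> * (\<Sum>v\<in>Z. deg v)"
    and Q: "\<And>v. v \<in> V \<Longrightarrow> deg v \<ge> Q" and QK: "\<epsilon> / (4 * s) * Q > real (K + s)"
  obtains E' where "E' \<subseteq> E" "sum sw E' \<ge> \<epsilon> / 4 * (\<Sum>v\<in>Z. deg v)"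
    "\<And>S i. S \<in> E' \<Longrightarrow> i < s \<Longrightarrow> lg i \<ge> 1 \<Longrightarrow> card {x. S[i := butlast (S ! i) @ [x]] \<in> E'} > K + s"
    "\<And>S F. S \<in> E' \<Longrightarrow> finite F \<Longrightarrow> card F \<le> K \<Longrightarrow> F \<inter> set (map last S) = {} \<Longrightarrow>
      \<exists>S'\<in>E'. map last S' = map last S \<and> set (vlist S') \<inter> F = {}"
proof -
  define T where "T = (\<Sum>v\<in>Z. deg v)"
  have T0: "T \<ge> 0" unfolding T_def by (intro sum_nonneg) (simp add: deg_nonneg)
  have finZ: "finite Z" using finV Z finite_subset by blast
  have finE: "finite E" using E finite_spiders[OF finZ] finite_subset by blast
  define J where "J = insert s {i. i < s \<and> lg i \<ge> 1}"
  \<comment> \<open>Index \<open>s\<close> stands for the partition by ends. The ends are wrapped in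
    singleton lists so that labels of both kinds have the same type.\<close>
  define cl :: "nat \<Rightarrow> 'a list list \<Rightarrow> 'a list list" where
    "cl j S = (if j = s then map (\<lambda>P. [last P]) S else S[j := butlast (S ! j)])" for j S
  define \<theta> where "\<theta> j c = (if j = s then 1 / 2 * sum sw {S\<in>E. cl s S = c} else \<epsilon> / (4 * s) * sw c)" for j c
  have ends: "cl s S = cl s S' \<longleftrightarrow> map last S = map last S'" for S S'
  proof -
    have e: "cl s S = map (\<lambda>x. [x]) (map last S)" for S by (simp add: cl_def)
    have "inj (\<lambda>x::'a. [x])" by (simp add: inj_def)
    then show ?thesis unfolding e by (rule inj_map_eq_map)
  qed
  have finJ: "finite J" by (simp add: J_def)
  have nonneg: "\<theta> j c \<ge> 0" for j c
    using eps by (auto simp: \<theta>_def sw_nonneg intro!: sum_nonneg mult_nonneg_nonneg)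
  have bs: "(\<Sum>c\<in>cl s ` E. \<theta> s c) = 1 / 2 * sum sw E"
    using sum.image_gen[OF finE, of sw "cl s"] by (simp add: \<theta>_def sum_divide_distrib)
  have bj: "(\<Sum>c\<in>cl j ` E. \<theta> j c) \<le> \<epsilon> / (4 * s) * T" if j: "j < s" "lg j \<ge> 1" for j
  proof -
    obtain h where h: "lg j = Suc h" using j by (cases "lg j") auto
    have "cl j ` E \<subseteq> spiders Z s (lg(j := h))"
      using E spiders_butlast[of s _ Z lg j h] s j h by (auto simp: cl_def)
    then have "(\<Sum>c\<in>cl j ` E. sw c) \<le> sum sw (spiders Z s (lg(j := h)))"
      using finite_spiders[OF finZ] sw_nonneg by (intro sum_mono2) auto
    also have "\<dots> = T" using sum_sw_spiders[OF s Z] by (simp add: T_def)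
    finally have "\<epsilon> / (4 * s) * (\<Sum>c\<in>cl j ` E. sw c) \<le> \<epsilon> / (4 * s) * T"
      using eps by (intro mult_left_mono) auto
    then show ?thesis using j by (simp add: \<theta>_def sum_distrib_left)
  qed
  have "(\<Sum>j\<in>J. \<Sum>c\<in>cl j ` E. \<theta> j c) = (\<Sum>c\<in>cl s ` E. \<theta> s c) + (\<Sum>j\<in>{i. i < s \<and> lg i \<ge> 1}. \<Sum>c\<in>cl j ` E. \<theta> j c)"
    unfolding J_def by (subst sum.insert) auto
  also have "(\<Sum>j\<in>{i. i < s \<and> lg i \<ge> 1}. \<Sum>c\<in>cl j ` E. \<theta> j c) \<le> real (card {i. i < s \<and> lg i \<ge> 1}) * (\<epsilon> / (4 * s) * T)"
    using bj by (intro sum_bounded_above) auto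
  also have "\<dots> \<le> real s * (\<epsilon> / (4 * s) * T)"
  proof (intro mult_right_mono)
    have "card {i. i < s \<and> lg i \<ge> 1} \<le> card {..<s}" by (intro card_mono) auto
    then show "real (card {i. i < s \<and> lg i \<ge> 1}) \<le> real s" by simp
  qed (use eps T0 in simp)
  also have "\<dots> = \<epsilon> / 4 * T" using s by simp
  finally have tot: "(\<Sum>j\<in>J. \<Sum>c\<in>cl j ` E. \<theta> j c) \<le> 1 / 2 * sum sw E + \<epsilon> / 4 * T" using bs by simp
  obtain E' where E': "E' \<subseteq> E" "sum sw E' \<ge> sum sw E - (\<Sum>j\<in>J. \<Sum>c\<in>cl j ` E. \<theta> j c)"
    "\<forall>j\<in>J. \<forall>S\<in>E'. sum sw {y\<in>E'. cl j y = cl j S} \<ge> \<theta> j (cl j S)"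
    using prune_light_classes[OF finE finJ, where ?w=sw and ?cl=cl and ?\<theta>=\<theta>] nonneg by blast
  have finE': "finite E'" using E'(1) finE finite_subset by blast
  show ?thesis
  proof (rule that[OF E'(1)])
    show "sum sw E' \<ge> \<epsilon> / 4 * (\<Sum>v\<in>Z. deg v)"
      using E'(2) tot big by (simp add: T_def)
  next
    fix S i assume S: "S \<in> E'" and i: "i < s" "lg i \<ge> 1"
    obtain h where h: "lg i = Suc h" using i by (cases "lg i") auto
    have SE: "S \<in> spiders Z s lg" using S E' E by blast
    define c where "c = S[i := butlast (S ! i)]"
    have c: "c \<in> spiders Z s (lg(i := h))" unfolding c_def by (rule spiders_butlast[OF s SE i(1) h])
    have ci: "c ! i = butlast (S ! i)" using SE i by (simp add: c_def spiders_def)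
    have cl: "walk (c ! i)" "hd (c ! i) = centre c" "length c = s" using c s i by (auto simp: spiders_iff)
    let ?A = "{x. S[i := butlast (S ! i) @ [x]] \<in> E'}"
    let ?Y = "{y\<in>E'. cl i y = c}"
    have y_eq: "y = c[i := c ! i @ [last (y ! i)]]" if y: "y \<in> ?Y" for y
    proof -
      have yi: "length y = s" "y ! i \<noteq> []"
        using y E' E s i by (auto simp: spiders_iff walk_ne)
      have cy: "c = y[i := butlast (y ! i)]" using y i by (simp add: cl_def)
      then have "c ! i = butlast (y ! i)" using yi i by simp
      then have "c ! i @ [last (y ! i)] = y ! i" using yi by simp
      then show ?thesis using cy by simp
    qed
    have img: "(\<lambda>y. last (y ! i)) ` ?Y \<subseteq> ?A"
    proof
      fix x assume "x \<in> (\<lambda>y. last (y ! i)) ` ?Y"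
      then obtain y where y: "y \<in> ?Y" "x = last (y ! i)" by blast
      then have "y = S[i := butlast (S ! i) @ [x]]" using y_eq[of y] ci by (simp add: c_def)
      then show "x \<in> ?A" using y by simp
    qed
    have finA: "finite ?A"
    proof (rule finite_subset)
      show "?A \<subseteq> (\<lambda>y. last (y ! i)) ` E'"
      proof
        fix x assume "x \<in> ?A"
        then show "x \<in> (\<lambda>y. last (y ! i)) ` E'" using SE i
          by (intro image_eqI[of _ _ "S[i := butlast (S ! i) @ [x]]"]) (auto simp: spiders_def)
      qed
    qed (use finE' in simp)
    have inj: "inj_on (\<lambda>y. last (y ! i)) ?Y"
      by (rule inj_onI) (metis y_eq)
    have "card ?Y = card ((\<lambda>y. last (y ! i)) ` ?Y)" using card_image[OF inj] by simp
    also have "\<dots> \<le> card ?A" using card_mono[OF finA img] .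
    finally have cardY: "card ?Y \<le> card ?A" .
    have dpos: "deg (last (c ! i)) > 0" using cl walk_hd_last deg_pos by blast
    \<comment> \<open>All extensions of \<open>c\<close> along leg \<open>i\<close> have equal
      weight, so a lower bound on their weight is a lower bound on the number of possible
      ends.\<close>
    have "sw y = sw c * (1 / deg (last (c ! i)))" if "y \<in> ?Y" for y
      using y_eq[OF that] cl i q_snoc[of "c ! i" "last (y ! i)"] sw_update[of i c "c ! i @ [last (y ! i)]"]
      by (metis hd_append2 divide_inverse inverse_eq_divide walk_ne)
    then have "sum sw ?Y = real (card ?Y) * (sw c * (1 / deg (last (c ! i))))" by simp
    moreover have "i \<in> J" using i by (simp add: J_def)
    then have "sum sw {y\<in>E'. cl i y = cl i S} \<ge> \<theta> i (cl i S)" using E'(3) S by blast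
    then have "sum sw ?Y \<ge> \<epsilon> / (4 * s) * sw c" using i by (simp add: \<theta>_def cl_def c_def)
    ultimately have "\<epsilon> / (4 * s) * sw c \<le> real (card ?Y) * (sw c * (1 / deg (last (c ! i))))" by simp
    then have "sw c * (\<epsilon> / (4 * s) * deg (last (c ! i))) \<le> sw c * real (card ?Y)"
      using dpos by (simp add: field_simps)
    then have "\<epsilon> / (4 * s) * deg (last (c ! i)) \<le> real (card ?Y)"
      using sw_pos[OF s Z c] mult_le_cancel_left_pos by blast
    moreover have "\<epsilon> / (4 * s) * deg (last (c ! i)) \<ge> \<epsilon> / (4 * s) * Q"
      using eps Q walk_hd_last[OF cl(1)] by (intro mult_left_mono) auto
    ultimately have "real (K + s) < real (card ?A)" using QK cardY by linarith
    then show "card ?A > K + s" by linarith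
  next
    fix S F assume S: "S \<in> E'" and F: "finite F" "card F \<le> K" "F \<inter> set (map last S) = {}"
    have SE: "S \<in> E" using S E' by blast
    let ?C = "{S'\<in>E. map last S' = map last S}"
    let ?C' = "{S'\<in>E'. map last S' = map last S}"
    let ?H = "{S'\<in>E. map last S' = map last S \<and> set (vlist S') \<inter> F \<noteq> {}}"
    have "s \<in> J" by (simp add: J_def)
    then have "sum sw {y\<in>E'. cl s y = cl s S} \<ge> \<theta> s (cl s S)" using E'(3) S by blast
    then have half: "sum sw ?C' \<ge> 1 / 2 * sum sw ?C" by (simp add: \<theta>_def ends)
    have "sum sw ?C > 0"
      using finE SE sw_pos[OF s Z] E by (intro sum_pos2[of _ S]) (auto simp: sw_nonneg)
    show "\<exists>S'\<in>E'. map last S' = map last S \<and> set (vlist S') \<inter> F = {}"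
    proof (rule ccontr)
      assume "\<not> ?thesis"
      then have "?C' \<subseteq> ?H" using E'(1) by blast
      then have "sum sw ?C' \<le> sum sw ?H" using finE by (intro sum_mono2) (auto simp: sw_nonneg)
      then show False using sat[OF SE F] half \<open>sum sw ?C > 0\<close> by linarith
    qed
  qed
qed

text \<open>To gain two edges on a leg with end \<open>x\<close> and penultimate vertex
  \<open>y\<close>, exchange \<open>x\<close> for a fresh end \<open>z\<close>, reach
  \<open>z\<close> by the induction hypothesis while avoiding \<open>x\<close> and \<open>y\<close>,
  and continue from \<open>z\<close> to \<open>y\<close> and on to \<open>x\<close>. The ends are
  unchanged in total. Each round adds two vertices to the set to be avoided, whence the term
  \<open>2 * (\<Sum>i<s. g i)\<close> in the budget \<open>K\<close>. By the hypothesis on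
  penultimate vertices \<open>y\<close> is not an end, so it may be avoided. A leg of length zero
  has no penultimate vertex and keeps its length.\<close>

lemma lengthen_spider:
  assumes s: "s > 0" and E: "E \<subseteq> spiders Z s lg" and nd: "\<And>S. S \<in> E \<Longrightarrow> distinct (vlist S)"
    and alt: "\<And>S i. S \<in> E \<Longrightarrow> i < s \<Longrightarrow> lg i \<ge> 1 \<Longrightarrow> card {x. S[i := butlast (S ! i) @ [x]] \<in> E} > K + s"
    and avoid: "\<And>S F. S \<in> E \<Longrightarrow> finite F \<Longrightarrow> card F \<le> K \<Longrightarrow> F \<inter> set (map last S) = {} \<Longrightarrow>
      \<exists>S'\<in>E. map last S' = map last S \<and> set (vlist S') \<inter> F = {}"
    and pen: "\<And>S i. S \<in> E \<Longrightarrow> i < s \<Longrightarrow> lg i \<ge> 1 \<Longrightarrow> last (butlast (S ! i)) \<notin> set (map last S)"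
    and S: "S \<in> E" and g: "\<And>i. i < s \<Longrightarrow> lg i = 0 \<Longrightarrow> g i = 0"
    and F: "finite F" "card F + 2 * (\<Sum>i<s. g i) \<le> K" "F \<inter> set (map last S) = {}"
  shows "\<exists>T\<in>spiders Z s (\<lambda>i. lg i + 2 * g i). distinct (vlist T) \<and> map last T = map last S \<and> set (vlist T) \<inter> F = {}"
  using S g F
proof (induction "\<Sum>i<s. g i" arbitrary: S g F)
  case 0
  then have "g i = 0" if "i < s" for i using that by simp
  then have "spiders Z s (\<lambda>i. lg i + 2 * g i) = spiders Z s lg" by (intro spiders_cong) auto
  moreover obtain S' where "S' \<in> E" "map last S' = map last S" "set (vlist S') \<inter> F = {}"
    using avoid[OF 0(2) 0(4) _ 0(6)] 0(5) by auto
  ultimately show ?case using E nd by (intro bexI[of _ S']) auto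
next
  case (Suc n)
  have "\<exists>i<s. g i > 0"
  proof (rule ccontr)
    assume "\<not> ?thesis"
    then have "(\<Sum>i<s. g i) = 0" by simp
    then show False using Suc.hyps(2) by simp
  qed
  then obtain i where i: "i < s" "g i > 0" by auto
  then have lgi: "lg i \<ge> 1" using Suc.prems(2)[of i] by (cases "lg i") auto
  obtain S1 where S1: "S1 \<in> E" "map last S1 = map last S" "set (vlist S1) \<inter> F = {}"
    using avoid[OF Suc.prems(1) Suc.prems(3) _ Suc.prems(5)] Suc.prems(4) by auto
  have S1S: "S1 \<in> spiders Z s lg" using S1 E by blast
  have leg: "length S1 = s" "walk (S1 ! i)" "length (S1 ! i) = Suc (lg i)"
    using S1S s i by (auto simp: spiders_iff)
  define x where "x = last (S1 ! i)"
  define y where "y = last (butlast (S1 ! i))"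
  let ?A = "{x. S1[i := butlast (S1 ! i) @ [x]] \<in> E}"
  have "finite (F \<union> set (map last S1))" using Suc.prems(3) by simp
  moreover have "card (F \<union> set (map last S1)) \<le> K + s"
  proof -
    have "card (F \<union> set (map last S1)) \<le> card F + card (set (map last S1))" by (rule card_Un_le)
    also have "card (set (map last S1)) \<le> s" using card_length[of "map last S1"] leg by simp
    finally show ?thesis using Suc.prems(4) by linarith
  qed
  moreover have "card ?A > K + s" using alt[OF S1(1) i(1) lgi] .
  ultimately have "\<not> ?A \<subseteq> F \<union> set (map last S1)"
    using card_mono[of "F \<union> set (map last S1)" ?A] by linarith
  then obtain z where z: "z \<in> ?A" "z \<notin> F" "z \<notin> set (map last S1)" by blast
  define S2 where "S2 = S1[i := butlast (S1 ! i) @ [z]]"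
  have S2: "S2 \<in> E" using z by (simp add: S2_def)
  have ne: "butlast (S1 ! i) \<noteq> []" using leg lgi by (cases "S1 ! i") auto
  have xy: "x \<in> N y"
  proof -
    have "butlast (S1 ! i) @ [x] = S1 ! i" using walk_ne[OF leg(2)] by (simp add: x_def)
    then show ?thesis using walk_snoc[OF ne, of x] leg(2) by (simp add: y_def)
  qed
  have "walk (butlast (S1 ! i) @ [z])"
  proof -
    have "S2 \<in> spiders Z s lg" using S2 E by blast
    then have "walk (S2 ! i)" using s i by (auto simp: spiders_iff)
    then show ?thesis using leg i by (simp add: S2_def)
  qed
  then have zy: "z \<in> N y" using walk_snoc[OF ne] by (auto simp: y_def)
  have ml2: "map last S2 = (map last S1)[i := z]" by (simp add: S2_def map_update)
  have ynot: "y \<notin> set (map last S1)" using pen[OF S1(1) i(1) lgi] by (simp add: y_def)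
  have xnot: "x \<notin> set (map last S2)"
  proof
    assume "x \<in> set (map last S2)"
    then obtain j where j: "j < s" "x = (map last S1)[i := z] ! j"
      using leg by (auto simp: in_set_conv_nth ml2)
    show False
    proof (cases "j = i")
      case True
      then show False using j z leg i by (auto simp: x_def)
    next
      case False
      then have "x = last (S1 ! j)" using j leg by simp
      moreover have "S1 ! j \<noteq> []" using S1S s j by (auto simp: spiders_iff walk_ne)
      ultimately have "x \<in> set (S1 ! j)" by simp
      moreover have "x \<in> set (tl (S1 ! i))"
        using leg lgi unfolding x_def by (cases "S1 ! i") (auto split: if_splits)
      ultimately show False
        using distinct_legs[OF S1S nd[OF S1(1)] i(1) j(1)] False by blast
    qed
  qed
  have ynot2: "y \<notin> set (map last S2)"
  proof
    assume "y \<in> set (map last S2)"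
    then have "y \<in> insert z (set (map last S1))"
      unfolding ml2 using set_update_subset_insert by fast
    then show False using ynot zy N_irrefl by auto
  qed
  define g' where "g' = g(i := g i - 1)"
  define F' where "F' = insert x (insert y F)"
  have "(\<Sum>j<s. g j) = g i + (\<Sum>j\<in>{..<s}-{i}. g j)" using i by (intro sum.remove) auto
  moreover have "(\<Sum>j<s. g' j) = g' i + (\<Sum>j\<in>{..<s}-{i}. g' j)" using i by (intro sum.remove) auto
  moreover have "(\<Sum>j\<in>{..<s}-{i}. g' j) = (\<Sum>j\<in>{..<s}-{i}. g j)" by (intro sum.cong) (auto simp: g'_def)
  ultimately have good_spiders: "Suc (\<Sum>j<s. g' j) = (\<Sum>j<s. g j)" using i by (simp add: g'_def)
  have "card F' \<le> card F + 2"
    unfolding F'_def using Suc.prems(3) by (simp add: card_insert_if)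
  then have cF': "card F' + 2 * (\<Sum>j<s. g' j) \<le> K" using Suc.prems(4) good_spiders by linarith
  have F'd: "F' \<inter> set (map last S2) = {}"
  proof -
    have "set (map last S2) \<subseteq> insert z (set (map last S1))"
      unfolding ml2 by (rule set_update_subset_insert)
    then have "F \<inter> set (map last S2) = {}" using z Suc.prems(5) S1(2) by auto
    then show ?thesis using xnot ynot2 by (auto simp: F'_def)
  qed
  have "\<exists>T\<in>spiders Z s (\<lambda>i. lg i + 2 * g' i). distinct (vlist T) \<and> map last T = map last S2 \<and> set (vlist T) \<inter> F' = {}"
  proof (rule Suc.hyps(1)[OF _ S2 _ _ cF' F'd])
    show "n = (\<Sum>j<s. g' j)" using good_spiders Suc.hyps(2) by simp
    show "finite F'" using Suc.prems(3) by (simp add: F'_def)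
    show "\<And>j. j < s \<Longrightarrow> lg j = 0 \<Longrightarrow> g' j = 0" using Suc.prems(2) by (auto simp: g'_def)
  qed
  then obtain T where T: "T \<in> spiders Z s (\<lambda>i. lg i + 2 * g' i)" "distinct (vlist T)"
    "map last T = map last S2" "set (vlist T) \<inter> F' = {}" by blast
  have Tl: "length T = s" "walk (T ! i)" "hd (T ! i) = centre T" "length (T ! i) = Suc (lg i + 2 * g' i)"
    using T(1) s i by (auto simp: spiders_iff)
  have "last (T ! i) = map last T ! i" using Tl i by simp
  also have "\<dots> = z" using T(3) ml2 leg i by simp
  finally have lz: "last (T ! i) = z" .
  define T' where "T' = T[i := T ! i @ [y, x]]"
  have Tne: "T ! i \<noteq> []" using Tl walk_ne by blast
  have w1: "walk (T ! i @ [y])" using walk_snoc[OF Tne] Tl lz N_sym[OF zy] by simp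
  have w: "walk (T ! i @ [y, x])" using walk_snoc[of "T ! i @ [y]" x] w1 xy by simp
  have "T' \<in> spiders Z s ((\<lambda>i. lg i + 2 * g' i)(i := lg i + 2 * g i))"
    unfolding T'_def using T(1) s i w Tl Tne by (intro spiders_update) (auto simp: g'_def)
  moreover have "(\<lambda>i. lg i + 2 * g' i)(i := lg i + 2 * g i) = (\<lambda>i. lg i + 2 * g i)"
    by (auto simp: g'_def)
  ultimately have T'S: "T' \<in> spiders Z s (\<lambda>i. lg i + 2 * g i)" by simp
  have "mset (vlist T') = mset (vlist T @ [y, x])"
  proof -
    have "tl (T ! i @ [y, x]) = tl (T ! i) @ [y, x]" using Tne by simp
    then show ?thesis
      using mset_vlist_update[of i T "T ! i @ [y, x]"] Tl i Tne by (simp add: T'_def)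
  qed
  then have dT': "distinct (vlist T') \<longleftrightarrow> distinct (vlist T @ [y, x])" and sT': "set (vlist T') = set (vlist T @ [y, x])"
    using mset_eq_imp_distinct_iff mset_eq_setD by blast+
  have "x \<noteq> y" using xy N_irrefl by auto
  then have "distinct (vlist T')" unfolding dT' using T(2,4) by (auto simp: F'_def)
  moreover have "set (vlist T') \<inter> F = {}"
  proof -
    have "x \<in> set (S1 ! i)" using leg walk_ne unfolding x_def by auto
    moreover have "y \<in> set (S1 ! i)" unfolding y_def using ne by (meson in_set_butlastD last_in_set)
    ultimately have "x \<notin> F" "y \<notin> F" using set_leg_subset_vlist[OF S1S i(1)] S1(3) by blast+
    then show ?thesis unfolding sT' using T(4) by (auto simp: F'_def)
  qed
  moreover have "map last T' = map last S"
  proof -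
    have "map last T' = (map last T)[i := x]" by (simp add: T'_def map_update)
    also have "\<dots> = (map last S1)[i := x]" using T(3) ml2 by simp
    also have "\<dots> = map last S1" using leg i by (simp add: x_def list_update_same_conv)
    finally show ?thesis using S1(2) by simp
  qed
  ultimately show ?case using T'S by blast
qed

end

section \<open>Good paths\<close>

context walk_graph
begin

definition path_class :: "'a list set \<Rightarrow> 'a \<Rightarrow> 'a \<Rightarrow> 'a list set" where
  "path_class X x y = {P\<in>X. hd P = x \<and> last P = y}"

text \<open>A quarter leaves room for pruning: when half of a class has survived, a set meeting at
  most a quarter of the class still misses some survivor. The set \<open>Y\<close> omits the ends,
  which lie on every path of the class.\<close>

definition path_saturated :: "nat \<Rightarrow> 'a list set \<Rightarrow> 'a \<Rightarrow> 'a \<Rightarrow> bool" where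
  "path_saturated K X x y \<longleftrightarrow> (\<forall>Y. finite Y \<and> card Y \<le> K \<and> x \<notin> Y \<and> y \<notin> Y \<longrightarrow>
     4 * sum wt {P\<in>path_class X x y. set P \<inter> Y \<noteq> {}} \<le> sum wt (path_class X x y))"

text \<open>Both truncations by one vertex are required, so that by iteration all subpaths of a good
  path are good.\<close>

definition adm_paths :: "'a list set \<Rightarrow> nat \<Rightarrow> 'a list set" where
  "adm_paths X h = {P\<in>walks (Suc h). distinct P \<and> butlast P \<in> X \<and> tl P \<in> X}"

text \<open>Single edges are exempt from the test: their class consists of one path without interior
  vertices and would always count as saturated.\<close>

primrec good_paths :: "nat \<Rightarrow> nat \<Rightarrow> 'a list set" where
  "good_paths K 0 = walks 0"
| "good_paths K (Suc h) = {P\<in>adm_paths (good_paths K h) h. h = 0 \<or> \<not> path_saturated K (adm_paths (good_paths K h) h) (hd P) (last P)}"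

definition saturated_paths :: "nat \<Rightarrow> nat \<Rightarrow> 'a list set" where
  "saturated_paths K h = {P\<in>adm_paths (good_paths K h) h. path_saturated K (adm_paths (good_paths K h) h) (hd P) (last P)}"

lemma good_paths_walks: "good_paths K h \<subseteq> walks h"
  by (cases h) (auto simp: adm_paths_def)

lemma good_paths_distinct: "P \<in> good_paths K h \<Longrightarrow> distinct P"
  by (cases h) (auto simp: adm_paths_def walks_def length_Suc_conv)

lemma good_paths_take: "P \<in> good_paths K (i + j) \<Longrightarrow> take (Suc i) P \<in> good_paths K i"
proof (induction j arbitrary: P)
  case 0
  then show ?case using good_paths_walks[of K i] by (auto simp: walks_def)
next
  case (Suc j)
  then have "butlast P \<in> good_paths K (i + j)" by (auto simp: adm_paths_def)
  then have "take (Suc i) (butlast P) \<in> good_paths K i" by (rule Suc.IH)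
  moreover have "length P = Suc (Suc (i + j))" using Suc.prems good_paths_walks[of K "i + Suc j"] by (auto simp: walks_def)
  ultimately show ?case by (simp add: butlast_conv_take min_def)
qed

lemma good_paths_drop: "P \<in> good_paths K (i + j) \<Longrightarrow> drop j P \<in> good_paths K i"
proof (induction j arbitrary: P)
  case (Suc j)
  then have "tl P \<in> good_paths K (i + j)" by (auto simp: adm_paths_def)
  then have "drop j (tl P) \<in> good_paths K i" by (rule Suc.IH)
  then show ?case by (simp add: drop_Suc)
qed simp

text \<open>A walk of length \<open>h + 1\<close> fails to be good because its front part is not
  good, its back part is not good, its last vertex repeats, or its ends are saturated. The first two
  cost the previous bad mass each, by stationarity, and the other two cost
  \<open>\<epsilon> * total\<close> each. The factor \<open>2 ^ Suc h - 2\<close> solves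
  \<open>b (h + 1) = 2 * b h + 2\<close> with \<open>b 0 = 0\<close>.\<close>

lemma mass_good_paths:
  assumes Q: "\<And>v. v \<in> V \<Longrightarrow> deg v \<ge> Q" and Qe: "real (Suc H) \<le> \<epsilon> * Q" "Q > 0" "\<epsilon> \<ge> 0"
    and sat: "\<And>h. 1 \<le> h \<Longrightarrow> h < H \<Longrightarrow> sum wt (saturated_paths K h) \<le> \<epsilon> * total"
  shows "h \<le> H \<Longrightarrow> sum wt (walks h - good_paths K h) \<le> (2 ^ Suc h - 2) * \<epsilon> * total"
proof (induction h)
  case 0
  then show ?case by simp
next
  case (Suc h)
  have tot0: "total \<ge> 0" unfolding total_def by (intro sum_nonneg) (simp add: deg_nonneg)
  let ?c1 = "{P\<in>walks (Suc h). butlast P \<in> walks h - good_paths K h}"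
  let ?c2 = "{P\<in>walks (Suc h). tl P \<in> walks h - good_paths K h}"
  let ?c3 = "{P\<in>walks (Suc h). butlast P \<in> good_paths K h \<and> last P \<in> set (butlast P)}"
  let ?c4 = "if h = 0 then {} else saturated_paths K h"
  have bl: "butlast P \<in> walks h" "tl P \<in> walks h" if "P \<in> walks (Suc h)" for P
  proof -
    have "walk (take (Suc h) P)" "walk (drop 1 P)"
      using that by (auto simp: walks_def intro!: walk_take walk_drop)
    then show "butlast P \<in> walks h" "tl P \<in> walks h"
      using that by (auto simp: walks_def butlast_conv_take drop_Suc)
  qed
  have sub: "walks (Suc h) - good_paths K (Suc h) \<subseteq> ?c1 \<union> ?c2 \<union> ?c3 \<union> ?c4"
  proof
    fix P assume P: "P \<in> walks (Suc h) - good_paths K (Suc h)"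
    have Pne: "P \<noteq> []" using P by (auto simp: walks_def)
    show "P \<in> ?c1 \<union> ?c2 \<union> ?c3 \<union> ?c4"
    proof (cases "butlast P \<in> good_paths K h \<and> tl P \<in> good_paths K h")
      case False
      then show ?thesis using P bl[of P] by auto
    next
      case True
      show ?thesis
      proof (cases "distinct P")
        case False
        have "distinct (butlast P)" using True good_paths_distinct by blast
        moreover have "P = butlast P @ [last P]" using Pne by simp
        ultimately have "last P \<in> set (butlast P)"
          using False by (metis distinct_append distinct_singleton disjoint_insert(1) empty_set inf_bot_right list.simps(15))
        then show ?thesis using P True by auto
      next
        case d: True
        then have "P \<in> adm_paths (good_paths K h) h" using P True by (auto simp: adm_paths_def)
        then show ?thesis using P by (auto simp: saturated_paths_def)
      qed
    qed
  qed
  have fin: "finite ?c1" "finite ?c2" "finite ?c3" "finite ?c4"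
    using finite_walks by (auto simp: saturated_paths_def adm_paths_def)
  have "sum wt (walks (Suc h) - good_paths K (Suc h)) \<le> sum wt (?c1 \<union> ?c2 \<union> ?c3 \<union> ?c4)"
    using fin sub wt_nonneg by (intro sum_mono2) auto
  also have "\<dots> \<le> sum wt ?c1 + sum wt ?c2 + sum wt ?c3 + sum wt ?c4"
  proof -
    have un: "sum wt (X \<union> Y) \<le> sum wt X + sum wt Y" if "finite X" "finite Y" for X Y
      using sum_Un[OF that, of wt] sum_nonneg[of "X \<inter> Y" wt] wt_nonneg by simp
    have "sum wt (?c1 \<union> ?c2 \<union> ?c3 \<union> ?c4) \<le> sum wt (?c1 \<union> ?c2 \<union> ?c3) + sum wt ?c4"
      using fin by (intro un finite_UnI)
    also have "sum wt (?c1 \<union> ?c2 \<union> ?c3) \<le> sum wt (?c1 \<union> ?c2) + sum wt ?c3"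
      using fin by (intro un finite_UnI)
    also have "sum wt (?c1 \<union> ?c2) \<le> sum wt ?c1 + sum wt ?c2"
      using fin by (intro un)
    finally show ?thesis by simp
  qed
  also have "sum wt ?c1 = sum wt (walks h - good_paths K h)" by (rule sum_wt_butlast) auto
  also have "sum wt ?c2 = sum wt (walks h - good_paths K h)" by (rule sum_wt_tl) auto
  \<comment> \<open>Repetition: at most \<open>h + 1\<close> of at least \<open>Q\<close> equally
    likely next vertices are already on the path.\<close>
  also have "sum wt ?c3 \<le> \<epsilon> * total"
  proof -
    have "sum wt ?c3 = (\<Sum>P\<in>good_paths K h. wt P * real (card {x\<in>N (last P). last (P @ [x]) \<in> set (butlast (P @ [x]))}) / deg (last P))"
      using good_paths_walks by (intro sum_wt_snoc)
    also have "\<dots> \<le> (\<Sum>P\<in>good_paths K h. wt P * \<epsilon>)"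
    proof (intro sum_mono)
      fix P assume "P \<in> good_paths K h"
      then have P: "walk P" "length P = Suc h" using good_paths_walks by (auto simp: walks_def)
      have dg: "deg (last P) \<ge> Q" using Q walk_hd_last P by blast
      have "card {x\<in>N (last P). last (P @ [x]) \<in> set (butlast (P @ [x]))} \<le> card (set P)"
        by (intro card_mono) auto
      also have "\<dots> \<le> Suc h" using card_length[of P] P by simp
      finally have "real (card {x\<in>N (last P). last (P @ [x]) \<in> set (butlast (P @ [x]))}) \<le> real (Suc h)"
        by (simp only: of_nat_le_iff)
      also have "\<dots> \<le> real (Suc H)" using Suc.prems by simp
      also have "\<dots> \<le> \<epsilon> * deg (last P)" using Qe dg by (meson mult_left_mono order_trans)
      finally have "wt P * (real (card {x\<in>N (last P). last (P @ [x]) \<in> set (butlast (P @ [x]))}) / deg (last P)) \<le> wt P * \<epsilon>"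
        using dg Qe by (intro mult_left_mono wt_nonneg) (auto simp: divide_simps)
      then show "wt P * real (card {x\<in>N (last P). last (P @ [x]) \<in> set (butlast (P @ [x]))}) / deg (last P) \<le> wt P * \<epsilon>"
        by simp
    qed
    also have "\<dots> = \<epsilon> * sum wt (good_paths K h)" by (simp add: sum_distrib_left mult.commute)
    also have "\<dots> \<le> \<epsilon> * total"
      unfolding sum_wt_walks[symmetric, of h]
      using Qe good_paths_walks finite_walks wt_nonneg by (intro mult_left_mono sum_mono2) auto
    finally show ?thesis .
  qed
  also have "sum wt ?c4 \<le> \<epsilon> * total" using sat[of h] Suc.prems tot0 Qe by auto
  finally have "sum wt (walks (Suc h) - good_paths K (Suc h)) \<le> 2 * sum wt (walks h - good_paths K h) + 2 * (\<epsilon> * total)" by simp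
  also have "\<dots> \<le> 2 * ((2 ^ Suc h - 2) * \<epsilon> * total) + 2 * (\<epsilon> * total)" using Suc by simp
  finally show ?case by (simp add: algebra_simps)
qed

end

section \<open>Weight of the good paths between two given vertices\<close>

primrec path_bd :: "nat \<Rightarrow> nat \<Rightarrow> real" where
  "path_bd K 0 = 1"
| "path_bd K (Suc h) = path_bd K h + 4 * real K * real (Suc h) * (path_bd K h)\<^sup>2"

lemma path_bd_ge1: "path_bd K h \<ge> 1"
  by (induction h) (auto intro: order_trans)

lemma path_bd_nonneg: "path_bd K h \<ge> 0" using path_bd_ge1[of K h] by simp

lemma path_bd_mono: "i \<le> h \<Longrightarrow> path_bd K i \<le> path_bd K h"
proof (induction h)
  case (Suc h)
  have "path_bd K h \<le> path_bd K (Suc h)" by simp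
  then show ?case using Suc by (cases "i = Suc h") (auto simp del: path_bd.simps)
qed simp

locale bip_graph = walk_graph V N for V :: "'a set" and N +
  fixes A :: "'a set" and d D :: real
  assumes A_sub: "A \<subseteq> V" and N_A: "x \<in> A \<Longrightarrow> N x \<inter> A = {}" and N_B: "x \<in> V - A \<Longrightarrow> N x \<subseteq> A"
    and d_pos: "d > 0" "D > 0" and deg_A: "x \<in> A \<Longrightarrow> deg x \<ge> d" and deg_B: "x \<in> V - A \<Longrightarrow> deg x \<ge> D"
begin

text \<open>\<open>c\<close> tells whether the walk starts in \<open>A\<close>; the value is the
  lower bound for the degree at position \<open>j\<close>.\<close>

definition side_deg :: "bool \<Rightarrow> nat \<Rightarrow> real" where "side_deg c j = (if c = even j then d else D)"

text \<open>The largest possible weight of a single path of length \<open>h\<close> under the two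
  degree bounds: one factor for each interior position.\<close>

definition path_scale :: "bool \<Rightarrow> nat \<Rightarrow> real" where "path_scale c h = (\<Prod>j\<in>{1..<h}. 1 / side_deg c j)"

lemma side_deg_pos: "side_deg c j > 0" using d_pos by (simp add: side_deg_def)

lemma path_scale_pos: "path_scale c h > 0" unfolding path_scale_def using side_deg_pos by (intro prod_pos) auto

text \<open>The vertex at position \<open>i\<close> is interior to the whole path but to neither
  piece, hence its separate factor. The second piece starts there, in \<open>A\<close> exactly if
  \<open>c = even i\<close>.\<close>

lemma path_scale_split:
  assumes "1 \<le> i" "i < h"
  shows "path_scale c h = path_scale c i * (1 / side_deg c i) * path_scale (c = even i) (h - i)"
proof -
  have "{1..<h} = {1..<i} \<union> insert i ((\<lambda>j. i + j) ` {1..<h-i})"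
  proof (intro equalityI subsetI)
    fix j assume j: "j \<in> {1..<h}"
    show "j \<in> {1..<i} \<union> insert i ((\<lambda>j. i + j) ` {1..<h-i})"
    proof (cases "j > i")
      case True
      then show ?thesis using j by (auto intro!: image_eqI[of _ _ "j - i"])
    qed (use j in auto)
  qed (use assms in auto)
  then have "path_scale c h = (\<Prod>j\<in>{1..<i} \<union> insert i ((\<lambda>j. i + j) ` {1..<h-i}). 1 / side_deg c j)"
    by (simp add: path_scale_def)
  also have "\<dots> = (\<Prod>j\<in>{1..<i}. 1 / side_deg c j) * (\<Prod>j\<in>insert i ((\<lambda>j. i + j) ` {1..<h-i}). 1 / side_deg c j)"
    by (intro prod.union_disjoint) auto
  also have "(\<Prod>j\<in>insert i ((\<lambda>j. i + j) ` {1..<h-i}). 1 / side_deg c j) =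
      1 / side_deg c i * (\<Prod>j\<in>(\<lambda>j. i + j) ` {1..<h-i}. 1 / side_deg c j)"
    by (intro prod.insert) auto
  also have "(\<Prod>j\<in>(\<lambda>j. i + j) ` {1..<h-i}. 1 / side_deg c j) = (\<Prod>j\<in>{1..<h-i}. 1 / side_deg c (i + j))"
    by (subst prod.reindex) auto
  also have "\<dots> = path_scale (c = even i) (h - i)"
    unfolding path_scale_def by (intro prod.cong refl) (auto simp: side_deg_def)
  finally show ?thesis by (simp add: path_scale_def mult.assoc)
qed

lemma side_nth: "walk P \<Longrightarrow> i < length P \<Longrightarrow> P ! i \<in> A \<longleftrightarrow> ((hd P \<in> A) = even i)"
proof (induction i)
  case 0
  then show ?case by (simp add: hd_conv_nth walk_ne)
next
  case (Suc i)
  then have "P ! Suc i \<in> N (P ! i)" by (intro walk_nth)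
  moreover have "P ! i \<in> V" "P ! Suc i \<in> V" using Suc.prems walk_set by (meson Suc_lessD nth_mem subsetD)+
  ultimately have "P ! Suc i \<in> A \<longleftrightarrow> P ! i \<notin> A" using N_A N_B by blast
  then show ?case using Suc by auto
qed

lemma deg_side: "x \<in> V \<Longrightarrow> deg x \<ge> side_deg (x \<in> A) 0"
  using deg_A deg_B by (auto simp: side_deg_def)

text \<open>Paths between a pair that is not saturated mostly pass through a bounded set, so
  their weight is controlled by that of shorter paths.\<close>

lemma good_paths_weight_bound:
  "1 \<le> h \<Longrightarrow> sum wt (path_class (good_paths K h) x y) \<le> path_bd K h * path_scale (x \<in> A) h"
proof (induction h arbitrary: x y rule: less_induct)
  case (less h)
  have finpcl: "finite (path_class X x y)" if "X \<subseteq> walks n" for X n x y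
    using that finite_walks[of n] by (auto simp: path_class_def intro: finite_subset)
  have rhs: "path_bd K h * path_scale (x \<in> A) h \<ge> 0" using path_bd_ge1[of K h] path_scale_pos[of "x \<in> A" h] by simp
  show ?case
  proof (cases "h = 1")
    case True
    have "path_class (good_paths K h) x y \<subseteq> {[x, y]}"
      using good_paths_walks[of K 1] by (auto simp: path_class_def True walks_def length_Suc_conv)
    then have "sum wt (path_class (good_paths K h) x y) \<le> sum wt {[x, y]}"
      by (intro sum_mono2) (auto simp: wt_nonneg)
    also have "\<dots> \<le> 1" by (auto simp: wt_def q_def deg_def)
    also have "\<dots> \<le> path_bd K h * path_scale (x \<in> A) h" using path_bd_ge1[of K h] by (simp add: True path_scale_def)
    finally show ?thesis .
  next
    case False
    then obtain n where n: "h = Suc n" "n \<ge> 1" using less.prems by (cases h) auto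
    show ?thesis
    proof (cases "path_class (good_paths K h) x y = {}")
      case True
      then show ?thesis using rhs by simp
    next
      case False
      define Ad where "Ad = adm_paths (good_paths K n) n"
      have AdW: "Ad \<subseteq> walks h" by (auto simp: Ad_def adm_paths_def n)
      from False obtain P0 where "P0 \<in> good_paths K h" "hd P0 = x" "last P0 = y" by (auto simp: path_class_def)
      \<comment> \<open>The test depends only on the ends, so one good path in the class shows that
        the pair is not saturated.\<close>
      then have "\<not> path_saturated K Ad x y" using n by (auto simp: Ad_def)
      then obtain Y where Y: "finite Y" "card Y \<le> K" "x \<notin> Y" "y \<notin> Y"
        and hit: "4 * sum wt {P\<in>path_class Ad x y. set P \<inter> Y \<noteq> {}} > sum wt (path_class Ad x y)"
        by (auto simp: path_saturated_def not_le)
      let ?M = "(path_bd K n)\<^sup>2 * path_scale (x \<in> A) h"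
      \<comment> \<open>A cut at position \<open>i\<close> gives two good paths, because both
        truncations of an admissible path are good. The weight is multiplicative except for the
        factor \<open>1 / deg z\<close> of the cut vertex.\<close>
      have thru: "sum wt {P\<in>path_class Ad x y. P ! i = z} \<le> ?M" if i: "1 \<le> i" "i < h" for i z
      proof (cases "{P\<in>path_class Ad x y. P ! i = z} = {}")
        case True
        show ?thesis unfolding True using path_scale_pos[of "x \<in> A" h] by simp
      next
        case False
        then obtain P1 where P1: "P1 \<in> Ad" "hd P1 = x" "P1 ! i = z" by (auto simp: path_class_def)
        then have w1: "walk P1" "length P1 = Suc h" using AdW by (auto simp: walks_def)
        have zA: "(z \<in> A) = ((x \<in> A) = even i)" using side_nth[OF w1(1), of i] P1 w1 i by auto
        have zV: "z \<in> V" using P1 w1 i walk_set nth_mem by fastforce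
        have dz: "deg z \<ge> side_deg (x \<in> A) i"
          using deg_side[OF zV] zA by (auto simp: side_deg_def)
        define G1 where "G1 = path_class (good_paths K i) x z"
        define G2 where "G2 = path_class (good_paths K (h - i)) z y"
        let ?f = "\<lambda>P. (take (Suc i) P, drop i P)"
        have fin: "finite G1" "finite G2" using finpcl[OF good_paths_walks] by (auto simp: G1_def G2_def)
        have sub: "?f ` {P\<in>path_class Ad x y. P ! i = z} \<subseteq> G1 \<times> G2"
        proof clarify
          fix P assume P: "P \<in> path_class Ad x y" "z = P ! i"
          then have PA: "P \<in> Ad" "hd P = x" "last P = y" by (auto simp: path_class_def)
          then have wP: "walk P" "length P = Suc h" using AdW by (auto simp: walks_def)
          have b: "butlast P \<in> good_paths K n" "tl P \<in> good_paths K n" using PA by (auto simp: Ad_def adm_paths_def)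
          have "take (Suc i) (butlast P) \<in> good_paths K i"
            using good_paths_take[of "butlast P" K i "n - i"] b i n by simp
          moreover have "take (Suc i) (butlast P) = take (Suc i) P"
            using i wP by (simp add: butlast_conv_take min_def)
          ultimately have 1: "take (Suc i) P \<in> good_paths K i" by simp
          have "drop (i - 1) (tl P) \<in> good_paths K (h - i)"
            using good_paths_drop[of "tl P" K "h - i" "i - 1"] b i n by simp
          moreover have "drop (i - 1) (tl P) = drop i P" using i by (simp add: drop_Suc[symmetric])
          ultimately have 2: "drop i P \<in> good_paths K (h - i)" by simp
          have "hd (take (Suc i) P) = x" using PA by simp
          moreover have "last (take (Suc i) P) = P ! i"
            using i wP by (simp add: take_Suc_conv_app_nth)
          moreover have "hd (drop i P) = P ! i" using i wP by (simp add: hd_drop_conv_nth)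
          moreover have "last (drop i P) = y" using i wP PA by simp
          ultimately show "take (Suc i) P \<in> G1 \<and> drop i P \<in> G2"
            using 1 2 P by (simp add: G1_def G2_def path_class_def)
        qed
        have inj: "inj_on ?f {P\<in>path_class Ad x y. P ! i = z}"
        proof (rule inj_onI)
          fix P P' assume "?f P = ?f P'"
          then have "take i (take (Suc i) P) = take i (take (Suc i) P')" "drop i P = drop i P'" by auto
          then have "take i P = take i P'" "drop i P = drop i P'" by (simp_all add: min_def)
          then show "P = P'" by (metis append_take_drop_id)
        qed
        have "sum wt {P\<in>path_class Ad x y. P ! i = z} = (\<Sum>P\<in>{P\<in>path_class Ad x y. P ! i = z}. wt (fst (?f P)) * wt (snd (?f P)) / deg z)"
        proof (intro sum.cong refl)
          fix P assume "P \<in> {P\<in>path_class Ad x y. P ! i = z}"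
          then have "walk P" "i < length P" "P ! i = z" using AdW i by (auto simp: path_class_def walks_def)
          then show "wt P = wt (fst (?f P)) * wt (snd (?f P)) / deg z" using wt_split by auto
        qed
        also have "\<dots> = (\<Sum>p\<in>?f ` {P\<in>path_class Ad x y. P ! i = z}. wt (fst p) * wt (snd p) / deg z)"
          using inj by (subst sum.reindex) auto
        also have "\<dots> \<le> (\<Sum>p\<in>G1 \<times> G2. wt (fst p) * wt (snd p) / deg z)"
          using fin sub by (intro sum_mono2) (auto simp: wt_nonneg deg_nonneg)
        also have "\<dots> = sum wt G1 * sum wt G2 / deg z"
          by (simp add: sum_product sum.cartesian_product case_prod_unfold sum_divide_distrib)
        also have "\<dots> \<le> (path_bd K i * path_scale (x \<in> A) i) * (path_bd K (h - i) * path_scale (z \<in> A) (h - i)) / side_deg (x \<in> A) i"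
        proof (intro frac_le mult_mono)
          show "sum wt G1 \<le> path_bd K i * path_scale (x \<in> A) i" unfolding G1_def using i by (intro less.IH) auto
          show "sum wt G2 \<le> path_bd K (h - i) * path_scale (z \<in> A) (h - i)" unfolding G2_def using i by (intro less.IH) auto
        qed (use dz side_deg_pos path_scale_pos in \<open>auto simp: wt_nonneg less_imp_le path_bd_nonneg intro!: sum_nonneg mult_nonneg_nonneg\<close>)
        also have "\<dots> = path_bd K i * path_bd K (h - i) * path_scale (x \<in> A) h"
          using path_scale_split[OF i, of "x \<in> A"] zA by simp
        also have "\<dots> \<le> path_bd K n * path_bd K n * path_scale (x \<in> A) h"
          using i n path_scale_pos[of "x \<in> A" h] path_bd_ge1 path_bd_mono
          by (intro mult_right_mono mult_mono) (auto simp: path_bd_nonneg less_imp_le)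
        finally show ?thesis by (simp add: power2_eq_square)
      qed
      have sub2: "{P\<in>path_class Ad x y. set P \<inter> Y \<noteq> {}} \<subseteq> (\<Union>p\<in>Y \<times> {1..<h}. {P\<in>path_class Ad x y. P ! snd p = fst p})"
      proof
        fix P assume P: "P \<in> {P\<in>path_class Ad x y. set P \<inter> Y \<noteq> {}}"
        then have lP: "length P = Suc h" "hd P = x" "last P = y" using AdW by (auto simp: path_class_def walks_def)
        then obtain i where i: "i < Suc h" "P ! i \<in> Y" using P by (auto simp: in_set_conv_nth)
        have "P \<noteq> []" using lP by auto
        then have "P ! 0 = x" "P ! h = y" using lP by (auto simp: hd_conv_nth last_conv_nth)
        then have "i \<noteq> 0" "i \<noteq> h" using i Y by metis+
        then show "P \<in> (\<Union>p\<in>Y \<times> {1..<h}. {P\<in>path_class Ad x y. P ! snd p = fst p})"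
          using i P by (intro UN_I[of "(P ! i, i)"]) auto
      qed
      have "sum wt {P\<in>path_class Ad x y. set P \<inter> Y \<noteq> {}} \<le> (\<Sum>p\<in>Y \<times> {1..<h}. sum wt {P\<in>path_class Ad x y. P ! snd p = fst p})"
        using Y sub2 finpcl[OF AdW] by (intro sum_over_union_le) (auto simp: wt_nonneg)
      also have "\<dots> \<le> real (card (Y \<times> {1..<h})) * ?M"
        using thru by (intro sum_bounded_above) auto
      also have "\<dots> \<le> (real K * real h) * ?M"
      proof (intro mult_right_mono)
        have "card (Y \<times> {1..<h}) \<le> K * h" unfolding card_cartesian_product using Y by (intro mult_mono) auto
        then show "real (card (Y \<times> {1..<h})) \<le> real K * real h" by (metis of_nat_le_iff of_nat_mult)
      qed (use path_scale_pos[of "x \<in> A" h] in simp)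
      finally have "sum wt (path_class Ad x y) \<le> 4 * ((real K * real h) * ?M)" using hit by linarith
      also have "\<dots> \<le> path_bd K h * path_scale (x \<in> A) h"
      proof -
        \<comment> \<open>Origin of the recursion for \<open>path_bd\<close>: the factor
          \<open>4\<close> comes from the failed test, \<open>K * h\<close> bounds the choices of a
          blocking vertex and its position, and each half contributes a factor
          \<open>path_bd K n\<close>.\<close>
        have "4 * real K * real h * (path_bd K n)\<^sup>2 \<le> path_bd K h" using path_bd_ge1[of K n] by (simp add: n)
        then have "4 * real K * real h * (path_bd K n)\<^sup>2 * path_scale (x \<in> A) h \<le> path_bd K h * path_scale (x \<in> A) h"
          using path_scale_pos[of "x \<in> A" h] by (intro mult_right_mono) auto
        then show ?thesis by (simp add: mult_ac)
      qed
      finally have "sum wt (path_class Ad x y) \<le> path_bd K h * path_scale (x \<in> A) h" .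
      moreover have "sum wt (path_class (good_paths K h) x y) \<le> sum wt (path_class Ad x y)"
        using finpcl[OF AdW] n wt_nonneg by (intro sum_mono2) (auto simp: path_class_def Ad_def)
      ultimately show ?thesis by linarith
    qed
  qed
qed

end

section \<open>Subdivisions from saturated paths\<close>

context walk_graph
begin

text \<open>A copy of the subdivision described by its paths: \<open>\<phi>\<close> places the
  branch vertices, the first \<open>s\<close> of them on one side, and \<open>P (i, j, c)\<close> is
  the \<open>c\<close>-th path for the edge \<open>i j\<close>. Different paths share only branch
  vertices, and each path contains only its own two, so the paths are internally disjoint.\<close>

definition has_theta :: "nat \<Rightarrow> nat \<Rightarrow> nat \<Rightarrow> nat \<Rightarrow> bool" where
  "has_theta s t r L \<longleftrightarrow> (\<exists>(\<phi> :: nat \<Rightarrow> 'a) (P :: nat \<times> nat \<times> nat \<Rightarrow> 'a list).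
     inj_on \<phi> {..<s + t} \<and> \<phi> ` {..<s + t} \<subseteq> V \<and>
     (\<forall>i<s. \<forall>j\<in>{s..<s + t}. \<forall>c<r. walk (P (i, j, c)) \<and> distinct (P (i, j, c)) \<and>
        length (P (i, j, c)) = Suc L \<and> hd (P (i, j, c)) = \<phi> i \<and> last (P (i, j, c)) = \<phi> j \<and>
        set (P (i, j, c)) \<inter> \<phi> ` {..<s + t} \<subseteq> {\<phi> i, \<phi> j}) \<and>
     (\<forall>x\<in>{..<s} \<times> {s..<s + t} \<times> {..<r}. \<forall>y\<in>{..<s} \<times> {s..<s + t} \<times> {..<r}.
        x \<noteq> y \<longrightarrow> set (P x) \<inter> set (P y) \<subseteq> \<phi> ` {..<s + t}))"

text \<open>\<open>M\<close> bounds the number of all vertices ever in use, so the same linking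
  hypothesis serves every step of the greedy choice.\<close>

lemma has_thetaI_greedy:
  assumes inj: "inj_on \<phi> {..<s + t}" and V: "\<phi> ` {..<s + t} \<subseteq> V"
    and M: "s + t + s * t * r * Suc L \<le> M"
    and link: "\<And>i j F. i < s \<Longrightarrow> j \<in> {s..<s + t} \<Longrightarrow> finite F \<Longrightarrow> card F \<le> M \<Longrightarrow> \<phi> i \<notin> F \<Longrightarrow> \<phi> j \<notin> F \<Longrightarrow>
      \<exists>P. walk P \<and> distinct P \<and> length P = Suc L \<and> hd P = \<phi> i \<and> last P = \<phi> j \<and> set P \<inter> F = {}"
  shows "has_theta s t r L"
proof -
  let ?I = "{..<s} \<times> {s..<s + t} \<times> {..<r}"
  let ?U = "\<phi> ` {..<s + t}"
  let ?good = "\<lambda>P x. walk (P x) \<and> distinct (P x) \<and> length (P x) = Suc L \<and> hd (P x) = \<phi> (fst x) \<and>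
    last (P x) = \<phi> (fst (snd x)) \<and> set (P x) \<inter> ?U \<subseteq> {\<phi> (fst x), \<phi> (fst (snd x))}"
  have finI: "finite ?I" by simp
  have "\<exists>P. (\<forall>x\<in>J. ?good P x) \<and> (\<forall>x\<in>J. \<forall>y\<in>J. x \<noteq> y \<longrightarrow> set (P x) \<inter> set (P y) \<subseteq> ?U)"
    if "J \<subseteq> ?I" for J
    using finite_subset[OF that finI] that
  proof (induction J rule: finite_induct)
    case empty
    then show ?case by simp
  next
    case (insert x J)
    then obtain P where P: "\<forall>x\<in>J. ?good P x" "\<forall>x\<in>J. \<forall>y\<in>J. x \<noteq> y \<longrightarrow> set (P x) \<inter> set (P y) \<subseteq> ?U" by auto
    obtain i j c where x: "x = (i, j, c)" "i < s" "j \<in> {s..<s + t}" "c < r"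
      using insert.prems by (cases x) auto
    define F where "F = (?U \<union> (\<Union>y\<in>J. set (P y))) - {\<phi> i, \<phi> j}"
    have "card F \<le> card (?U \<union> (\<Union>y\<in>J. set (P y)))"
      unfolding F_def using insert.hyps by (intro card_mono) auto
    also have "\<dots> \<le> card ?U + card (\<Union>y\<in>J. set (P y))" by (rule card_Un_le)
    also have "card ?U \<le> s + t" using card_image_le[of "{..<s + t}" \<phi>] by simp
    also have "card (\<Union>y\<in>J. set (P y)) \<le> (\<Sum>y\<in>J. card (set (P y)))"
      using insert.hyps by (intro card_UN_le)
    also have "\<dots> \<le> of_nat (card J) * Suc L"
    proof (intro sum_bounded_above)
      fix y assume "y \<in> J"
      then have "length (P y) = Suc L" using P by blast
      then show "card (set (P y)) \<le> Suc L" using card_length[of "P y"] by simp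
    qed
    also have "of_nat (card J) * Suc L \<le> (s * t * r) * Suc L"
    proof (intro mult_right_mono)
      have "card J \<le> card ?I" using insert.prems by (intro card_mono) auto
      then show "of_nat (card J) \<le> s * t * r" by (simp add: card_cartesian_product)
    qed simp
    finally have cF: "card F \<le> M" using M by simp
    have "finite F" unfolding F_def using insert.hyps by auto
    from link[OF x(2,3) this cF] obtain R where R: "walk R" "distinct R" "length R = Suc L"
      "hd R = \<phi> i" "last R = \<phi> j" "set R \<inter> F = {}" by (auto simp: F_def)
    have RU: "set R \<inter> ?U \<subseteq> {\<phi> i, \<phi> j}" using R(6) unfolding F_def by blast
    have ij: "{\<phi> i, \<phi> j} \<subseteq> ?U" using x by auto
    have RP: "set R \<inter> set (P y) \<subseteq> ?U" if "y \<in> J" for y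
      using R(6) that ij unfolding F_def by blast
    let ?P = "P(x := R)"
    have "\<forall>y\<in>insert x J. ?good ?P y" using P(1) R RU insert.hyps(2) x(1) by auto
    moreover have "\<forall>y\<in>insert x J. \<forall>z\<in>insert x J. y \<noteq> z \<longrightarrow> set (?P y) \<inter> set (?P z) \<subseteq> ?U"
    proof (intro ballI impI)
      fix y z assume yz: "y \<in> insert x J" "z \<in> insert x J" "y \<noteq> z"
      show "set (?P y) \<inter> set (?P z) \<subseteq> ?U"
      proof (cases "y = x")
        case True
        then show ?thesis using yz RP[of z] by simp
      next
        case y: False
        show ?thesis
        proof (cases "z = x")
          case True
          then show ?thesis using yz RP[of y] y by (simp add: Int_commute)
        next
          case False
          then show ?thesis using yz y P(2) by simp
        qed
      qed
    qed
    ultimately show ?case by blast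
  qed
  from this[OF subset_refl] obtain P where "\<forall>x\<in>?I. ?good P x"
    "\<forall>x\<in>?I. \<forall>y\<in>?I. x \<noteq> y \<longrightarrow> set (P x) \<inter> set (P y) \<subseteq> ?U" by blast
  then show ?thesis
    unfolding has_theta_def using inj V
    by (intro exI[of _ \<phi>] exI[of _ P]) auto
qed

text \<open>The weight of a walk of length at least two depends only on its interior. By averaging,
  some interior \<open>I\<close> has at least an \<open>\<epsilon>\<close> proportion of its
  extensions in \<open>X\<close>. The extensions of \<open>I\<close> correspond to the product of
  \<open>N (hd I)\<close> and \<open>N (last I)\<close>, and a rectangle in the dense relation found
  there gives the two sets.\<close>

lemma dense_walk_ends:
  assumes j: "j \<ge> 2" and X: "X \<subseteq> walks j" and big: "sum wt X \<ge> \<epsilon> * total" and tot: "total > 0"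
    and eps: "\<epsilon> > 0" and Q: "\<And>v. v \<in> V \<Longrightarrow> deg v \<ge> Q" and s: "s > 0"
    and q0: "\<epsilon> / 4 * real q0 \<ge> t" "q0 > 0" and Q1: "\<epsilon> / 2 * Q \<ge> q0" and Q2: "\<epsilon> / 4 * Q \<ge> s * 2 ^ q0"
  shows "\<exists>U U'. card U = s \<and> card U' = t \<and> (\<forall>u\<in>U. \<forall>v\<in>U'. \<exists>P\<in>X. hd P = u \<and> last P = v)"
proof -
  define \<kappa> where "\<kappa> P = butlast (tl P)" for P :: "'a list"
  define \<rho> where "\<rho> I = prod_list (map (\<lambda>v. 1 / deg v) I)" for I
  have finX: "finite X" using X finite_walks finite_subset by blast
  have wt: "wt P = \<rho> (\<kappa> P)" and \<kappa>_ne: "\<kappa> P \<noteq> []" and P_eq: "P = hd P # \<kappa> P @ [last P]"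
    and \<kappa>_walk: "walk (\<kappa> P)" if P: "P \<in> walks j" for P
  proof -
    have w: "walk P" "length P = Suc j" using P by (auto simp: walks_def)
    obtain x T where T: "P = x # T" using w by (cases P) auto
    have Tl: "length T = j" using w T by simp
    then have Tne: "T \<noteq> []" using j by auto
    have xV: "x \<in> V" using w T by (simp add: walk_def)
    show "wt P = \<rho> (\<kappa> P)" using wt_Cons[OF Tne xV] T by (simp add: q_def \<kappa>_def \<rho>_def)
    show ne: "\<kappa> P \<noteq> []" using Tl j T by (cases T rule: rev_cases) (auto simp: \<kappa>_def)
    show "P = hd P # \<kappa> P @ [last P]" using T Tne by (simp add: \<kappa>_def)
    have "walk T" using w T walk_Cons[OF Tne] by simp
    moreover have "T = butlast T @ [last T]" using Tne by simp
    ultimately show "walk (\<kappa> P)" using walk_snoc[of "butlast T" "last T"] ne T by (simp add: \<kappa>_def)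
  qed
  have \<rho>_pos: "\<rho> I > 0" if "walk I" for I
  proof -
    have "\<forall>v\<in>set I. deg v > 0" using deg_pos walk_set[OF that] by blast
    then show ?thesis unfolding \<rho>_def by (induction I) auto
  qed
  let ?C = "\<kappa> ` walks j"
  let ?X = "\<lambda>I. {P\<in>X. \<kappa> P = I}"
  let ?walks = "\<lambda>I. {P\<in>walks j. \<kappa> P = I}"
  have "\<exists>I\<in>?C. real (card (?X I)) \<ge> \<epsilon> * real (card (?walks I))"
  proof (rule ccontr)
    assume "\<not> ?thesis"
    then have less: "real (card (?X I)) < \<epsilon> * real (card (?walks I))" if "I \<in> ?C" for I using that by force
    have "walks j \<noteq> {}" using tot sum_wt_walks[of j] by auto
    have "sum wt X = (\<Sum>I\<in>?C. sum wt (?X I))"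
      using X finX finite_walks by (intro sum.group[symmetric]) auto
    also have "\<dots> = (\<Sum>I\<in>?C. real (card (?X I)) * \<rho> I)"
      using wt X by (intro sum.cong refl) (auto simp: subset_iff)
    also have "\<dots> < (\<Sum>I\<in>?C. \<epsilon> * real (card (?walks I)) * \<rho> I)"
    proof (intro sum_strict_mono)
      show "finite ?C" using finite_walks by simp
      show "?C \<noteq> {}" using \<open>walks j \<noteq> {}\<close> by simp
      fix I assume I: "I \<in> ?C"
      then have "\<rho> I > 0" using \<kappa>_walk \<rho>_pos by auto
      then show "real (card (?X I)) * \<rho> I < \<epsilon> * real (card (?walks I)) * \<rho> I" using less[OF I] by simp
    qed
    also have "\<dots> = \<epsilon> * (\<Sum>I\<in>?C. sum wt (?walks I))"
      using wt unfolding sum_distrib_left by (intro sum.cong refl) (auto simp: sum_distrib_left)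
    also have "(\<Sum>I\<in>?C. sum wt (?walks I)) = sum wt (walks j)"
      using finite_walks by (intro sum.group) auto
    finally show False using big sum_wt_walks[of j] by simp
  qed
  then obtain I where I: "I \<in> ?C" "real (card (?X I)) \<ge> \<epsilon> * real (card (?walks I))" by blast
  have Iw: "walk I" "I \<noteq> []" "length I = j - 1"
  proof -
    obtain P where P: "P \<in> walks j" "I = \<kappa> P" using I by blast
    then show "walk I" "I \<noteq> []" using \<kappa>_walk \<kappa>_ne by auto
    show "length I = j - 1" using P by (auto simp: \<kappa>_def walks_def)
  qed
  define R where "R = {(x, y). x # I @ [y] \<in> X}"
  let ?XX = "N (hd I)" and ?YY = "N (last I)"
  have mk: "x # I @ [y] \<in> walks j" if "x \<in> ?XX" "y \<in> ?YY" for x y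
  proof -
    have "walk (I @ [y])" using walk_snoc[OF Iw(2)] Iw(1) that by simp
    then have "walk (x # I @ [y])" using walk_Cons[of "I @ [y]" x] that Iw(2) by simp
    then show ?thesis using Iw(3) j by (simp add: walks_def)
  qed
  have R: "R \<subseteq> ?XX \<times> ?YY"
  proof clarify
    fix x y assume "(x, y) \<in> R"
    then have "walk (x # I @ [y])" using X by (auto simp: R_def walks_def)
    then have 1: "walk (I @ [y])" "x \<in> N (hd (I @ [y]))" using walk_Cons[of "I @ [y]" x] by auto
    then show "x \<in> ?XX \<and> y \<in> ?YY" using walk_snoc[OF Iw(2), of y] Iw(2) by simp
  qed
  have "card (?XX \<times> ?YY) \<le> card (?walks I)"
  proof (rule card_inj_on_le[of "\<lambda>(x, y). x # I @ [y]"])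
    show "inj_on (\<lambda>(x, y). x # I @ [y]) (?XX \<times> ?YY)" by (auto simp: inj_on_def)
    show "(\<lambda>(x, y). x # I @ [y]) ` (?XX \<times> ?YY) \<subseteq> ?walks I"
      using mk by (auto simp: \<kappa>_def butlast_append)
    show "finite (?walks I)" using finite_walks by simp
  qed
  then have "\<epsilon> * (real (card ?XX) * real (card ?YY)) \<le> \<epsilon> * real (card (?walks I))"
    using eps unfolding card_cartesian_product by (intro mult_left_mono) (simp_all flip: of_nat_mult)
  moreover have "card (?X I) \<le> card R"
  proof (rule card_inj_on_le[of "\<lambda>P. (hd P, last P)"])
    show "inj_on (\<lambda>P. (hd P, last P)) (?X I)"
      using P_eq X by (intro inj_onI) (metis (mono_tags, lifting) mem_Collect_eq prod.inject subsetD)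
    show "(\<lambda>P. (hd P, last P)) ` (?X I) \<subseteq> R"
    proof clarify
      fix P assume "P \<in> X" "I = \<kappa> P"
      then have "hd P # \<kappa> P @ [last P] \<in> X" using P_eq[of P] X by auto
      then show "(hd P, last P) \<in> R" using \<open>I = \<kappa> P\<close> by (simp add: R_def)
    qed
    show "finite R" using R finN finite_subset by blast
  qed
  ultimately have dens: "real (card R) \<ge> \<epsilon> * card ?XX * card ?YY" using I(2) by simp
  have hl: "hd I \<in> V" "last I \<in> V" using walk_hd_last[OF Iw(1)] by auto
  have "\<exists>X' Y'. X' \<subseteq> ?XX \<and> Y' \<subseteq> ?YY \<and> card X' = s \<and> card Y' = t \<and> X' \<times> Y' \<subseteq> R"
  proof (rule dense_relation_contains_rectangle[OF finN finN R dens eps s q0])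
    have "\<epsilon> / 2 * Q \<le> \<epsilon> / 2 * deg (last I)" using eps Q hl by (intro mult_left_mono) auto
    then show "real q0 \<le> \<epsilon> / 2 * real (card ?YY)" using Q1 by (simp add: deg_def)
    have "\<epsilon> / 4 * Q \<le> \<epsilon> / 4 * deg (hd I)" using eps Q hl by (intro mult_left_mono) auto
    then show "real (s * 2 ^ q0) \<le> \<epsilon> / 4 * real (card ?XX)" using Q2 by (simp add: deg_def)
  qed
  then obtain U U' where "card U = s" "card U' = t" "U \<times> U' \<subseteq> R" by blast
  moreover have "\<exists>P\<in>X. hd P = u \<and> last P = v" if "(u, v) \<in> R" for u v
    using that unfolding R_def by (intro bexI[of _ "u # I @ [v]"]) auto
  ultimately show ?thesis by (intro exI[of _ U] exI[of _ U']) blast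
qed

text \<open>After pruning, the paths of length \<open>h = n + 1\<close> can be lengthened by any
  even amount that the budget allows, with both ends fixed. If \<open>h\<close> is even this reaches
  \<open>L\<close>. If \<open>h\<close> is odd, the branch vertices are the ends of the paths
  without their last vertex: for \<open>v\<close> the last vertex of such a shortened path, choose a
  fresh neighbour \<open>x\<close> of \<open>v\<close> as end, lengthen up to \<open>L - 1\<close>
  while avoiding \<open>v\<close>, and close with the edge from \<open>x\<close> to
  \<open>v\<close>. The bound on \<open>K\<close> counts all vertices of the configuration, one more
  for \<open>v\<close>, and two for each lengthening.\<close>

lemma saturated_paths_imp_has_theta:
  assumes big: "sum wt (saturated_paths K n) \<ge> \<epsilon> * total" and tot: "total > 0" and n: "1 \<le> n" "Suc n \<le> L"
    and L: "even L" and eps: "\<epsilon> > 0" and Q: "\<And>v. v \<in> V \<Longrightarrow> deg v \<ge> Q" and s: "s > 0" and t: "t > 0"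
    and K: "s + t + s * t * r * Suc L + 1 + 2 * L \<le> K"
    and QK: "\<epsilon> / 8 * Q > real (K + 2)"
    and q0: "\<epsilon> / 16 * real q0 \<ge> t" "q0 > 0" and Q1: "\<epsilon> / 8 * Q \<ge> q0" and Q2: "\<epsilon> / 16 * Q \<ge> s * 2 ^ q0"
  shows "has_theta s t r L"
proof -
  define h where "h = Suc n"
  define Ad where "Ad = adm_paths (good_paths K n) n"
  define E0 where "E0 = saturated_paths K n"
  have AdW: "Ad \<subseteq> walks h" by (auto simp: Ad_def adm_paths_def h_def)
  have E0A: "E0 \<subseteq> Ad" by (auto simp: E0_def saturated_paths_def Ad_def)
  have E0W: "E0 \<subseteq> walks h" using E0A AdW by blast
  \<comment> \<open>A path becomes a spider centred at its start with legs of lengths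
    \<open>0\<close> and \<open>h\<close>. The trivial leg records the start among the ends, so that
    the ends of the spider are the two ends of the path.\<close>
  define \<sigma> where "\<sigma> P = [[hd P], P]" for P :: "'a list"
  define lg where "lg i = (if i = 0 then 0 else h)" for i :: nat
  have inj: "inj \<sigma>" by (auto simp: inj_def \<sigma>_def)
  have wP: "walk P" "length P = Suc h" "P \<noteq> []" "distinct P" if "P \<in> E0" for P
    using that E0W E0A by (auto simp: walks_def walk_ne Ad_def adm_paths_def)
  have \<sigma>_SP: "\<sigma> P \<in> spiders V 2 lg" if "P \<in> walks h" for P
  proof -
    have "walk P" "length P = Suc h" using that by (auto simp: walks_def)
    moreover have "hd P \<in> V" using walk_hd_last calculation by blast
    ultimately show ?thesis
      by (auto simp: spiders_iff \<sigma>_def centre_def lg_def walk_single less_2_cases_iff)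
  qed
  have \<sigma>_sw: "sw (\<sigma> P) = wt P" for P by (simp add: sw_def \<sigma>_def centre_def wt_def)
  have \<sigma>_vl: "vlist (\<sigma> P) = P" if "P \<noteq> []" for P using that by (simp add: vlist_def \<sigma>_def centre_def)
  have \<sigma>_ml: "map last (\<sigma> P) = [hd P, last P]" for P by (simp add: \<sigma>_def)
  define E where "E = \<sigma> ` E0"
  have sum\<sigma>: "sum sw (\<sigma> ` X) = sum wt X" for X
    using inj by (subst sum.reindex) (auto simp: \<sigma>_sw inj_def inj_on_def)
  have ESP: "E \<subseteq> spiders V 2 lg" unfolding E_def using E0W \<sigma>_SP by blast
  have sat: "4 * sum sw {S'\<in>E. map last S' = map last S \<and> set (vlist S') \<inter> Y \<noteq> {}}
        \<le> sum sw {S'\<in>E. map last S' = map last S}"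
    if SY: "S \<in> E" "finite Y" "card Y \<le> K" "Y \<inter> set (map last S) = {}" for S Y
  proof -
    obtain P where P: "P \<in> E0" "S = \<sigma> P" using SY by (auto simp: E_def)
    have ps: "path_saturated K Ad (hd P) (last P)" using P by (simp add: E0_def saturated_paths_def Ad_def)
    \<comment> \<open>Saturation depends only on the ends, so \<open>E0\<close> contains the class
      of each of its pairs entirely, and the quarter bound carries over to
      \<open>E0\<close>.\<close>
    have cls: "{P'\<in>E0. hd P' = hd P \<and> last P' = last P} = path_class Ad (hd P) (last P)"
      using ps E0A unfolding path_class_def E0_def saturated_paths_def Ad_def by auto
    have img: "{S'\<in>\<sigma> ` E0. R S'} = \<sigma> ` {P'\<in>E0. R (\<sigma> P')}" for R by auto
    have 1: "{S'\<in>E. map last S' = map last S} = \<sigma> ` path_class Ad (hd P) (last P)"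
      unfolding cls[symmetric] E_def img P(2) \<sigma>_ml by simp
    have 2: "{S'\<in>E. map last S' = map last S \<and> set (vlist S') \<inter> Y \<noteq> {}} =
        \<sigma> ` {P'\<in>path_class Ad (hd P) (last P). set P' \<inter> Y \<noteq> {}}"
      unfolding cls[symmetric] E_def img P(2) \<sigma>_ml using wP(3) \<sigma>_vl
      by (intro arg_cong[of _ _ "image \<sigma>"]) auto
    have "hd P \<notin> Y" "last P \<notin> Y" using SY(4) by (auto simp: P \<sigma>_ml)
    then show ?thesis unfolding 1 2 sum\<sigma> using ps SY(2,3) by (simp add: path_saturated_def)
  qed
  have big': "sum sw E \<ge> \<epsilon> * (\<Sum>v\<in>V. deg v)" using big by (simp add: E_def sum\<sigma> E0_def total_def)
  have QK': "\<epsilon> / real (4 * 2) * Q > real (K + 2)" using QK by simp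
  obtain E' where E': "E' \<subseteq> E" "sum sw E' \<ge> \<epsilon> / 4 * (\<Sum>v\<in>V. deg v)"
    and alt: "\<And>S i. S \<in> E' \<Longrightarrow> i < 2 \<Longrightarrow> lg i \<ge> 1 \<Longrightarrow> card {x. S[i := butlast (S ! i) @ [x]] \<in> E'} > K + 2"
    and avoid: "\<And>S F. S \<in> E' \<Longrightarrow> finite F \<Longrightarrow> card F \<le> K \<Longrightarrow> F \<inter> set (map last S) = {} \<Longrightarrow>
      \<exists>S'\<in>E'. map last S' = map last S \<and> set (vlist S') \<inter> F = {}"
    by (rule prune_spiders[of 2 V E lg K \<epsilon> Q, OF zero_less_numeral order_refl ESP sat eps big' Q QK']) blast+
  define E1 where "E1 = {P. \<sigma> P \<in> E'}"
  have E1: "E1 \<subseteq> E0" unfolding E1_def using E'(1) inj by (auto simp: E_def inj_def)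
  have E'\<sigma>: "E' = \<sigma> ` E1" using E'(1) by (auto simp: E1_def E_def)
  have E1big: "sum wt E1 \<ge> \<epsilon> / 4 * total" using E'(2) by (simp add: E'\<sigma> sum\<sigma> total_def)
  have pen: "last (butlast P) \<noteq> hd P" "last (butlast P) \<noteq> last P" if "P \<in> E0" for P
  proof -
    have l: "length P \<ge> 3" using wP(2)[OF that] n by (simp add: h_def)
    then have "butlast P \<noteq> []" by (cases P) auto
    then have "last (butlast P) = P ! (length P - 2)"
      using l by (simp add: last_conv_nth nth_butlast numeral_2_eq_2)
    moreover have "hd P = P ! 0" "last P = P ! (length P - 1)"
      using wP(3)[OF that] by (auto simp: hd_conv_nth last_conv_nth)
    moreover have "P ! (length P - 2) \<noteq> P ! 0" "P ! (length P - 2) \<noteq> P ! (length P - 1)"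
    proof -
      have *: "length P - 2 < length P" "0 < length P" "length P - 1 < length P"
        "length P - 2 \<noteq> 0" "length P - 2 \<noteq> length P - 1" using l by linarith+
      show "P ! (length P - 2) \<noteq> P ! 0" "P ! (length P - 2) \<noteq> P ! (length P - 1)"
        using nth_eq_iff_index_eq[OF wP(4)[OF that] *(1,2)] nth_eq_iff_index_eq[OF wP(4)[OF that] *(1,3)] *(4,5)
        by blast+
    qed
    ultimately show "last (butlast P) \<noteq> hd P" "last (butlast P) \<noteq> last P" by auto
  qed
  have long: "\<exists>P'. walk P' \<and> distinct P' \<and> length P' = Suc (h + 2 * g) \<and> hd P' = hd P \<and> last P' = last P \<and> set P' \<inter> F = {}"
    if P: "P \<in> E1" and F: "finite F" "card F + 2 * g \<le> K" "hd P \<notin> F" "last P \<notin> F" for P F g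
  proof -
    define gg where "gg i = (if i = 0 then 0 else g)" for i :: nat
    have "\<exists>T\<in>spiders V 2 (\<lambda>i. lg i + 2 * gg i). distinct (vlist T) \<and> map last T = map last (\<sigma> P) \<and> set (vlist T) \<inter> F = {}"
    proof (rule lengthen_spider[where E = E' and lg = lg and K = K, OF _ _ _ alt avoid])
      show "E' \<subseteq> spiders V 2 lg" using E'(1) ESP by blast
      show "distinct (vlist S)" if "S \<in> E'" for S using that E1 wP \<sigma>_vl by (auto simp: E'\<sigma> subset_iff)
      show "last (butlast (S ! i)) \<notin> set (map last S)" if Si: "S \<in> E'" "i < 2" "lg i \<ge> 1" for S i
      proof -
        obtain P where "P \<in> E0" "S = \<sigma> P" using Si(1) E1 by (auto simp: E'\<sigma>)
        moreover have "i = 1" using Si by (cases i) (auto simp: lg_def)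
        ultimately show ?thesis using pen[of P] by (auto simp: \<sigma>_def)
      qed
      show "\<sigma> P \<in> E'" using P by (simp add: E1_def)
      show "gg i = 0" if "lg i = 0" for i using that by (auto simp: lg_def gg_def h_def split: if_splits)
      have "(\<Sum>i<2. gg i) = g" by (simp add: gg_def numeral_2_eq_2)
      then show "card F + 2 * (\<Sum>i<2. gg i) \<le> K" using F by simp
      show "F \<inter> set (map last (\<sigma> P)) = {}" using F by (auto simp: \<sigma>_ml)
    qed (use F in auto)
    then obtain T where T: "T \<in> spiders V 2 (\<lambda>i. lg i + 2 * gg i)" "distinct (vlist T)"
      "map last T = [hd P, last P]" "set (vlist T) \<inter> F = {}" by (auto simp: \<sigma>_ml)
    have T2: "length T = 2" "walk (T ! 1)" "hd (T ! 1) = centre T" "length (T ! 1) = Suc (h + 2 * g)"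
      "length (T ! 0) = 1" "hd (T ! 0) = centre T"
      using T(1) by (auto simp: spiders_iff lg_def gg_def)
    have "last (T ! 0) = map last T ! 0" "last (T ! 1) = map last T ! 1" using T2 by auto
    then have "last (T ! 0) = hd P" "last (T ! 1) = last P" by (auto simp: T(3))
    moreover have "last (T ! 0) = hd (T ! 0)" using T2(5) by (cases "T ! 0") auto
    ultimately have "hd (T ! 1) = hd P" "last (T ! 1) = last P" using T2 by auto
    moreover have "distinct (T ! 1)" using distinct_leg[OF T(1,2), of 1] by simp
    moreover have "set (T ! 1) \<inter> F = {}" using set_leg_subset_vlist[OF T(1), of 1] T(4) by auto
    ultimately show ?thesis using T2 by blast
  qed
  \<comment> \<open>For odd \<open>h\<close> the penultimate vertex takes the place of the end, so
    that the length \<open>j\<close> is even in both cases.\<close>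
  define X where "X = (if even h then E1 else butlast ` E1)"
  define j where "j = (if even h then h else n)"
  have j2: "j \<ge> 2" using n by (auto simp: j_def h_def elim!: oddE evenE)
  have XW: "X \<subseteq> walks j"
  proof (cases "even h")
    case True
    then show ?thesis using E1 E0W by (auto simp: X_def j_def)
  next
    case False
    have "butlast P \<in> walks n" if "P \<in> E1" for P
    proof -
      have "walk (take (Suc n) P)" "length P = Suc (Suc n)"
        using that E1 wP[of P] by (auto simp: h_def intro!: walk_take)
      then show ?thesis by (auto simp: walks_def butlast_conv_take)
    qed
    then show ?thesis using False by (auto simp: X_def j_def)
  qed
  have Xbig: "sum wt X \<ge> \<epsilon> / 4 * total"
  proof (cases "even h")
    case True
    then show ?thesis using E1big by (simp add: X_def)
  next
    case False
    then have Xe: "X = butlast ` E1" and Xn: "X \<subseteq> walks n" using XW by (auto simp: X_def j_def)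
    from Xn have "sum wt {P\<in>walks (Suc n). butlast P \<in> X} = sum wt X" by (intro sum_wt_butlast)
    moreover have "sum wt E1 \<le> sum wt {P\<in>walks (Suc n). butlast P \<in> X}"
      using finite_walks wt_nonneg E1 E0W Xe by (intro sum_mono2) (auto simp: h_def)
    ultimately show ?thesis using E1big by simp
  qed
  have "\<exists>U U'. card U = s \<and> card U' = t \<and> (\<forall>u\<in>U. \<forall>v\<in>U'. \<exists>P\<in>X. hd P = u \<and> last P = v)"
  proof (rule dense_walk_ends[where Q = Q and ?q0.0 = q0, OF j2 XW Xbig tot _ _ s])
    \<comment> \<open>The density is the \<open>\<epsilon> / 4\<close> left by pruning; this
      explains the factors \<open>\<epsilon> / 16\<close> and \<open>\<epsilon> / 8\<close> in the
      hypotheses \<open>q0\<close>, \<open>Q1\<close> and \<open>Q2\<close>.\<close>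
    show "\<epsilon> / 4 > 0" using eps by simp
    show "\<epsilon> / 4 / 4 * real q0 \<ge> t" "q0 > 0" using q0 by simp_all
    show "\<epsilon> / 4 / 2 * Q \<ge> real q0" using Q1 by simp
    show "\<epsilon> / 4 / 4 * Q \<ge> real (s * 2 ^ q0)" using Q2 by simp
  qed (rule Q)
  then obtain U U' where U: "card U = s" "card U' = t" "\<forall>u\<in>U. \<forall>v\<in>U'. \<exists>P\<in>X. hd P = u \<and> last P = v" by blast
  define M where "M = s + t + s * t * r * Suc L"
  have KM: "M + 1 + 2 * L \<le> K" using K by (simp only: M_def)
  have link: "\<exists>P'. walk P' \<and> distinct P' \<and> length P' = Suc L \<and> hd P' = hd P \<and> last P' = last P \<and> set P' \<inter> F = {}"
    if P: "P \<in> X" and F: "finite F" "card F \<le> M" "hd P \<notin> F" "last P \<notin> F" for P F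
  proof (cases "even h")
    case True
    obtain g where g: "L = h + 2 * g"
      using True L n(2) by (metis dvd_def even_add h_def le_Suc_ex)
    have "card F + 2 * g \<le> K" using F(2) KM g by linarith
    moreover have "P \<in> E1" using P True by (simp add: X_def)
    ultimately show ?thesis using long[of P F g] F g by simp
  next
    case False
    then obtain P0 where P0: "P0 \<in> E1" "P = butlast P0" using P by (auto simp: X_def)
    have wP0: "walk P0" "length P0 = Suc h" using P0(1) E1 wP by auto
    have Pne: "P \<noteq> []" using P0 wP0 n by (cases P0) (auto simp: h_def)
    \<comment> \<open>Parity makes \<open>h\<close> strictly smaller than \<open>L\<close>, which
      leaves room for the closing edge.\<close>
    have "h \<noteq> L" using False L by auto
    then have "even (L - Suc h)" "Suc h \<le> L" using False L n by (auto simp: h_def)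
    then obtain g where g: "L = Suc h + 2 * g" by (metis dvd_def le_Suc_ex add_diff_cancel_left')
    define v where "v = last P"
    let ?A = "{x. (\<sigma> P0)[1 := butlast (\<sigma> P0 ! 1) @ [x]] \<in> E'}"
    have "card ?A > K + 2" using P0(1) by (intro alt) (auto simp: E1_def lg_def h_def)
    moreover have "card (insert v F) \<le> K + 2"
      using F(1,2) KM by (simp add: card_insert_if)
    ultimately have "\<not> ?A \<subseteq> insert v F" using card_mono[of "insert v F" ?A] F(1) by fastforce
    then obtain x where x: "x \<in> ?A" "x \<notin> insert v F" by blast
    define P2 where "P2 = P @ [x]"
    have "hd P0 = hd P" using P0(2) Pne by (cases P0) auto
    then have "(\<sigma> P0)[1 := butlast (\<sigma> P0 ! 1) @ [x]] = \<sigma> P2"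
      using Pne by (simp add: \<sigma>_def P2_def P0(2))
    then have P2: "P2 \<in> E1" using x by (simp add: E1_def)
    then have P20: "P2 \<in> E0" using E1 by blast
    have "walk (P @ [x])" using wP(1)[OF P20] by (simp add: P2_def)
    then have xv: "x \<in> N v" using walk_snoc[OF Pne] by (simp add: v_def)
    have hv: "hd P2 \<noteq> v" using pen(1)[OF P20] by (simp add: P2_def v_def)
    have e2: "hd P2 = hd P" "last P2 = x" using Pne by (auto simp: P2_def)
    have "card (insert v F) \<le> Suc (card F)" using F(1) by (simp add: card_insert_if)
    moreover have "2 * g \<le> L" using g by simp
    ultimately have "card (insert v F) + 2 * g \<le> K" using F(2) KM by linarith
    then obtain P' where P': "walk P'" "distinct P'" "length P' = Suc (h + 2 * g)" "hd P' = hd P"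
      "last P' = x" "set P' \<inter> insert v F = {}"
      using long[OF P2, of "insert v F" g] F hv x e2 by auto
    have P'ne: "P' \<noteq> []" using P' walk_ne by blast
    have "walk (P' @ [v])" using walk_snoc[OF P'ne] P' N_sym[OF xv] by simp
    moreover have "distinct (P' @ [v])" using P' by auto
    moreover have "length (P' @ [v]) = Suc L" using P' g by simp
    moreover have "hd (P' @ [v]) = hd P" using P' P'ne by simp
    moreover have "last (P' @ [v]) = last P" by (simp add: v_def)
    moreover have "set (P' @ [v]) \<inter> F = {}" using P' F(4) by (auto simp: v_def)
    ultimately show ?thesis by blast
  qed
  have ends: "hd P \<in> V" "last P \<in> V" "hd P \<noteq> last P" if "P \<in> X" for P
  proof -
    have "walk P" "length P = Suc j" using that XW by (auto simp: walks_def)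
    then show "hd P \<in> V" "last P \<in> V" using walk_hd_last by auto
    have "distinct P" using that E1 wP(4) by (auto simp: X_def distinct_butlast split: if_splits)
    then show "hd P \<noteq> last P" using \<open>length P = Suc j\<close> j2
      by (cases P) (auto split: if_splits)
  qed
  have ne: "U \<noteq> {}" "U' \<noteq> {}" and fin: "finite U" "finite U'"
    using U s t by (auto intro: card_ge_0_finite)
  have pair: "u \<in> V \<and> v \<in> V \<and> u \<noteq> v" if uv: "u \<in> U" "v \<in> U'" for u v
  proof -
    obtain P where "P \<in> X" "hd P = u" "last P = v" using U(3) uv by blast
    then show ?thesis using ends[of P] by auto
  qed
  then have disj: "U \<inter> U' = {}" by blast
  have sub: "U \<subseteq> V" "U' \<subseteq> V" using pair ne by blast+
  obtain f where f: "bij_betw f {..<s} U" using ex_bij_betw_nat_finite[OF fin(1)] U by (auto simp: atLeast0LessThan)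
  obtain f' where f': "bij_betw f' {..<t} U'" using ex_bij_betw_nat_finite[OF fin(2)] U by (auto simp: atLeast0LessThan)
  define \<phi> where "\<phi> i = (if i < s then f i else f' (i - s))" for i
  have inU: "\<phi> i \<in> U" if "i < s" for i using that f by (auto simp: \<phi>_def bij_betw_def)
  have inU': "\<phi> i \<in> U'" if "i \<in> {s..<s + t}" for i using that f' by (auto simp: \<phi>_def bij_betw_def)
  have inj\<phi>: "inj_on \<phi> {..<s + t}"
  proof (rule inj_onI)
    fix a b assume ab: "a \<in> {..<s + t}" "b \<in> {..<s + t}" "\<phi> a = \<phi> b"
    consider "a < s" "b < s" | "a \<ge> s" "b \<ge> s" | "a < s" "b \<ge> s" | "a \<ge> s" "b < s" by linarith
    then show "a = b"
    proof cases
      case 1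
      then show ?thesis using ab f by (auto simp: \<phi>_def bij_betw_def dest: inj_onD)
    next
      case 2
      then have "f' (a - s) = f' (b - s)" "a - s \<in> {..<t}" "b - s \<in> {..<t}" using ab by (auto simp: \<phi>_def)
      then have "a - s = b - s" using f' by (auto simp: bij_betw_def dest: inj_onD)
      then show ?thesis using 2 by simp
    next
      case 3
      then show ?thesis using inU[of a] inU'[of b] ab disj by auto
    next
      case 4
      then show ?thesis using inU[of b] inU'[of a] ab disj by auto
    qed
  qed
  show ?thesis
  proof (rule has_thetaI_greedy[OF inj\<phi>, where M = M])
    show "\<phi> ` {..<s + t} \<subseteq> V"
    proof
      fix x assume "x \<in> \<phi> ` {..<s + t}"
      then obtain i where "x = \<phi> i" "i < s + t" by auto
      then show "x \<in> V" using inU[of i] inU'[of i] sub by (cases "i < s") auto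
    qed
    show "s + t + s * t * r * Suc L \<le> M" by (simp add: M_def)
    fix i j F assume ij: "i < s" "j \<in> {s..<s + t}" "finite F" "card F \<le> M" "\<phi> i \<notin> F" "\<phi> j \<notin> F"
    then have "\<phi> i \<in> U" "\<phi> j \<in> U'" using inU inU' by auto
    then obtain P where "P \<in> X" "hd P = \<phi> i" "last P = \<phi> j" using U(3) by blast
    then show "\<exists>P. walk P \<and> distinct P \<and> length P = Suc L \<and> hd P = \<phi> i \<and> last P = \<phi> j \<and> set P \<inter> F = {}"
      using link[of P F] ij by simp
  qed
qed

end

section \<open>Good spiders\<close>

lemma prod_list_nth: "prod_list (map f xs) = (\<Prod>i<length xs. f (xs ! i) :: real)"
  by (induction xs rule: rev_induct) (auto simp: nth_append)

lemma sum_update: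
  fixes lg :: "nat \<Rightarrow> nat"
  assumes "i < s"
  shows "(\<Sum>j<s. (lg(i := p)) j) + lg i = (\<Sum>j<s. lg j) + p"
proof -
  have "(\<Sum>j<s. lg j) = lg i + (\<Sum>j\<in>{..<s}-{i}. lg j)" using assms by (intro sum.remove) auto
  moreover have "(\<Sum>j<s. (lg(i := p)) j) = (lg(i := p)) i + (\<Sum>j\<in>{..<s}-{i}. (lg(i := p)) j)"
    using assms by (intro sum.remove) auto
  moreover have "(\<Sum>j\<in>{..<s}-{i}. (lg(i := p)) j) = (\<Sum>j\<in>{..<s}-{i}. lg j)" by (intro sum.cong) auto
  ultimately show ?thesis by simp
qed

text \<open>The analogue of \<open>path_bd\<close>. A blocking vertex is either the centre, whence
  \<open>path_bd K L ^ s\<close>, or one of at most \<open>s * L\<close> interior positions on legs,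
  where the spider is cut into a shorter spider and a path.\<close>

primrec spider_bd :: "nat \<Rightarrow> nat \<Rightarrow> nat \<Rightarrow> nat \<Rightarrow> real" where
  "spider_bd K L s 0 = path_bd K L ^ s"
| "spider_bd K L s (Suc n) = spider_bd K L s n + 4 * real K * (path_bd K L ^ s + real s * real L * (spider_bd K L s n * path_bd K L))"

lemma spider_bd_mono1: "0 \<le> spider_bd K L s n \<and> spider_bd K L s n \<le> spider_bd K L s (Suc n)"
  by (induction n) (auto intro!: add_nonneg_nonneg mult_nonneg_nonneg simp: path_bd_nonneg)

lemma spider_bd_mono: "m \<le> n \<Longrightarrow> spider_bd K L s m \<le> spider_bd K L s n"
proof (induction n)
  case (Suc n)
  then show ?case using spider_bd_mono1[of K L s n] by (cases "m = Suc n") (auto simp del: spider_bd.simps)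
qed simp

context bip_graph
begin

definition spider_class :: "'a list list set \<Rightarrow> 'a list \<Rightarrow> 'a list list set" where
  "spider_class X xs = {S\<in>X. map last S = xs}"

definition spider_saturated :: "nat \<Rightarrow> 'a list list set \<Rightarrow> 'a list \<Rightarrow> bool" where
  "spider_saturated K X xs \<longleftrightarrow> (\<forall>Y. finite Y \<and> card Y \<le> K \<and> Y \<inter> set xs = {} \<longrightarrow>
     4 * sum sw {S\<in>spider_class X xs. set (vlist S) \<inter> Y \<noteq> {}} \<le> sum sw (spider_class X xs))"

text \<open>Saturation is only tested if at most one leg is a single edge: otherwise
  two of the branch vertices found later could both be the centre.\<close>

definition testable_shape :: "nat \<Rightarrow> (nat \<Rightarrow> nat) \<Rightarrow> bool" where
  "testable_shape s lg \<longleftrightarrow> (\<forall>i<s. 1 \<le> lg i) \<and> (\<forall>i<s. \<forall>j<s. lg i = 1 \<and> lg j = 1 \<longrightarrow> i = j)"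

text \<open>The last condition takes care of the shapes on which saturation is not tested: two legs
  that are single edges form a path of length two across the centre, and if this path is good its
  weight can be controlled.\<close>

definition adm_spiders :: "nat \<Rightarrow> nat \<Rightarrow> ((nat \<Rightarrow> nat) \<Rightarrow> 'a list list set) \<Rightarrow> (nat \<Rightarrow> nat) \<Rightarrow> 'a list list set" where
  "adm_spiders K s X lg = {S\<in>spiders A s lg. distinct (vlist S) \<and> (\<forall>i<s. S ! i \<in> good_paths K (lg i)) \<and>
     (\<forall>i<s. lg i \<ge> 1 \<longrightarrow> S[i := butlast (S ! i)] \<in> X (lg(i := lg i - 1))) \<and>
     (\<forall>i<s. \<forall>j<s. i \<noteq> j \<and> lg i = 1 \<and> lg j = 1 \<longrightarrow> [last (S ! i), centre S, last (S ! j)] \<in> good_paths K 2)}"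

text \<open>The number is meant to be the sum of the leg lengths. With the shape as an argument of
  the value, the previous level is available for every way of shortening one leg.\<close>

primrec good_spiders :: "nat \<Rightarrow> nat \<Rightarrow> nat \<Rightarrow> (nat \<Rightarrow> nat) \<Rightarrow> 'a list list set" where
  "good_spiders K s 0 = spiders A s"
| "good_spiders K s (Suc n) = (\<lambda>lg. {S\<in>adm_spiders K s (good_spiders K s n) lg.
     testable_shape s lg \<longrightarrow> \<not> spider_saturated K (adm_spiders K s (good_spiders K s n) lg) (map last S)})"

definition saturated_spiders :: "nat \<Rightarrow> nat \<Rightarrow> nat \<Rightarrow> (nat \<Rightarrow> nat) \<Rightarrow> 'a list list set" where
  "saturated_spiders K s n lg = {S\<in>adm_spiders K s (good_spiders K s n) lg. spider_saturated K (adm_spiders K s (good_spiders K s n) lg) (map last S)}"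

lemma finA: "finite A" using A_sub finV finite_subset by blast

lemma good_spiders_spiders: "good_spiders K s n lg \<subseteq> spiders A s lg"
  by (cases n) (auto simp: adm_spiders_def)

lemma good_spiders_distinct:
  assumes "s > 0" "S \<in> good_spiders K s n lg" "(\<Sum>i<s. lg i) = n"
  shows "distinct (vlist S)"
proof (cases n)
  case 0
  then have l: "lg i = 0" if "i < s" for i using assms that by simp
  have "tl (S ! i) = []" if "i < s" for i
  proof -
    have "length (S ! i) = 1" using assms(1,2) 0 l[OF that] that by (auto simp: spiders_iff)
    then show ?thesis by (cases "S ! i") auto
  qed
  moreover have "length S = s" using assms 0 by (auto simp: spiders_def)
  ultimately have "\<forall>P\<in>set S. tl P = []" by (metis in_set_conv_nth)
  then have "concat (map tl S) = []" by (induction S) auto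
  then show ?thesis unfolding vlist_def by (metis distinct_singleton)
next
  case (Suc m)
  then show ?thesis using assms by (auto simp: adm_spiders_def)
qed

text \<open>The leg is cut one vertex at a time. The level sinks by the number of removed vertices
  and so stays equal to the sum of the leg lengths.\<close>

lemma good_spiders_truncate:
  assumes s: "s > 0" and i: "i < s"
  shows "S \<in> good_spiders K s n lg \<Longrightarrow> (\<Sum>j<s. lg j) = n \<Longrightarrow> p \<le> lg i \<Longrightarrow>
    S[i := take (Suc p) (S ! i)] \<in> good_spiders K s (n - (lg i - p)) (lg(i := p))"
proof (induction "lg i - p" arbitrary: S n lg)
  case 0
  then have "p = lg i" by simp
  moreover have "S \<in> spiders A s lg" using 0(2) good_spiders_spiders by blast
  then have "length (S ! i) = Suc (lg i)" using s i by (auto simp: spiders_iff)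
  ultimately show ?case using 0 by simp
next
  case (Suc m)
  have Ssp: "S \<in> spiders A s lg" using Suc.prems good_spiders_spiders by blast
  have lgi: "lg i \<ge> 1" using Suc by linarith
  have le: "lg i \<le> n" using member_le_sum[of i "{..<s}" lg] i Suc.prems(2) by simp
  then obtain n' where n: "n = Suc n'" using lgi by (cases n) auto
  let ?S = "S[i := butlast (S ! i)]" and ?l = "lg(i := lg i - 1)"
  have 1: "?S \<in> good_spiders K s n' ?l" using Suc.prems(1) i lgi by (auto simp: n adm_spiders_def)
  have 2: "(\<Sum>j<s. ?l j) = n'" using sum_update[OF i, of lg "lg i - 1"] Suc.prems(2) n lgi by linarith
  have "m = ?l i - p" "p \<le> ?l i" using Suc by simp_all
  from Suc.hyps(1)[OF this(1) 1 2 this(2)]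
  have "?S[i := take (Suc p) (?S ! i)] \<in> good_spiders K s (n' - (lg i - 1 - p)) (lg(i := p))"
    by (simp only: fun_upd_upd fun_upd_same)
  moreover have "length S = s" "length (S ! i) = Suc (lg i)" using Ssp s i by (auto simp: spiders_iff)
  then have "?S[i := take (Suc p) (?S ! i)] = S[i := take (Suc p) (S ! i)]"
    using i Suc.hyps(2) by (simp add: butlast_conv_take min_def)
  moreover have "n' - (lg i - 1 - p) = n - (lg i - p)" using n Suc.hyps(2) le by linarith
  ultimately show ?case by simp
qed

text \<open>A bound for the weight of one spider. For centre \<open>v\<close> the weight is
  \<open>deg v * (\<Prod>i<s. wt (S ! i) / deg v)\<close>, in which \<open>deg v\<close> has
  exponent \<open>1 - s\<close>; for \<open>s > 0\<close> it may be replaced by the lower bound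
  \<open>d\<close>.\<close>

definition spider_scale :: "nat \<Rightarrow> (nat \<Rightarrow> nat) \<Rightarrow> real" where
  "spider_scale s lg = d * (\<Prod>i<s. path_scale True (lg i) / d)"

lemma spider_scale_pos: "spider_scale s lg > 0"
  unfolding spider_scale_def using d_pos path_scale_pos by (intro mult_pos_pos prod_pos) auto

text \<open>If disjointness of the legs is forgotten, the legs for a given centre and given ends can
  be chosen independently, and the sum factorises.\<close>

lemma sum_sw_centre:
  assumes s: "s > 0" and v: "v \<in> A" and X: "X \<subseteq> spiders A s lg"
    and legs: "\<And>S i. S \<in> X \<Longrightarrow> i < s \<Longrightarrow> S ! i \<in> good_paths K (lg i)"
  shows "sum sw {S\<in>spider_class X xs. centre S = v} \<le> deg v * (\<Prod>i<s. sum wt (path_class (good_paths K (lg i)) v (xs ! i)) / deg v)"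
proof -
  have dv: "deg v > 0" using v A_sub deg_pos by blast
  define C where "C i = path_class (good_paths K (lg i)) v (xs ! i)" for i
  let ?Y = "{S\<in>spider_class X xs. centre S = v}"
  let ?r = "\<lambda>S. restrict (\<lambda>i. S ! i) {..<s}"
  have finC: "finite (C i)" for i
  proof -
    have "C i \<subseteq> walks (lg i)" using good_paths_walks by (auto simp: C_def path_class_def)
    then show ?thesis using finite_walks finite_subset by blast
  qed
  have Y: "length S = s" "S \<in> spiders A s lg" "centre S = v" "map last S = xs" if "S \<in> ?Y" for S
    using that X by (auto simp: spider_class_def spiders_def)
  have inj: "inj_on ?r ?Y"
  proof (rule inj_onI)
    fix S S' assume *: "S \<in> ?Y" "S' \<in> ?Y" "?r S = ?r S'"
    then have "S ! i = S' ! i" if "i < s" for i using that by (metis lessThan_iff restrict_apply')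
    then show "S = S'" using Y(1) * by (intro nth_equalityI) auto
  qed
  have img: "?r ` ?Y \<subseteq> PiE {..<s} C"
  proof clarify
    fix S assume S: "S \<in> spider_class X xs" "v = centre S"
    then have S': "S \<in> ?Y" by simp
    have "S ! i \<in> C i" if "i < s" for i
    proof -
      have "S ! i \<in> good_paths K (lg i)" using legs S that by (auto simp: spider_class_def)
      moreover have "hd (S ! i) = v" using Y[OF S'] s that by (auto simp: spiders_iff)
      moreover have "last (S ! i) = xs ! i" using Y[OF S'] that by (metis nth_map)
      ultimately show ?thesis by (simp add: C_def path_class_def)
    qed
    then show "?r S \<in> PiE {..<s} C" by auto
  qed
  have "sum sw ?Y = (\<Sum>S\<in>?Y. deg v * (\<Prod>i<s. wt (?r S i) / deg v))"
  proof (intro sum.cong refl)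
    fix S assume S: "S \<in> ?Y"
    have "prod_list (map q S) = (\<Prod>i<s. q (S ! i))" using prod_list_nth[of q S] Y(1)[OF S] by simp
    also have "\<dots> = (\<Prod>i<s. wt (?r S i) / deg v)"
    proof (intro prod.cong refl)
      fix i assume "i \<in> {..<s}"
      then have "hd (S ! i) = v" using Y[OF S] s by (auto simp: spiders_iff)
      then show "q (S ! i) = wt (?r S i) / deg v" using dv \<open>i \<in> {..<s}\<close> by (simp add: wt_def)
    qed
    finally show "sw S = deg v * (\<Prod>i<s. wt (?r S i) / deg v)" using Y(3)[OF S] by (simp add: sw_def)
  qed
  also have "\<dots> = (\<Sum>g\<in>?r ` ?Y. deg v * (\<Prod>i<s. wt (g i) / deg v))"
    by (subst sum.reindex[OF inj]) simp
  also have "\<dots> \<le> (\<Sum>g\<in>PiE {..<s} C. deg v * (\<Prod>i<s. wt (g i) / deg v))"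
    using img finC deg_nonneg wt_nonneg
    by (intro sum_mono2 finite_PiE) (auto intro!: mult_nonneg_nonneg prod_nonneg)
  also have "\<dots> = deg v * (\<Sum>g\<in>PiE {..<s} C. (\<Prod>i<s. wt (g i) / deg v))"
    by (simp add: sum_distrib_left)
  also have "(\<Sum>g\<in>PiE {..<s} C. (\<Prod>i<s. wt (g i) / deg v)) = (\<Prod>i<s. \<Sum>P\<in>C i. wt P / deg v)"
    using finC by (intro prod_sum_PiE[symmetric]) auto
  finally show ?thesis by (simp add: C_def sum_divide_distrib)
qed

lemma sum_sw_centre_le:
  assumes s: "s > 0" and v: "v \<in> A" and X: "X \<subseteq> spiders A s lg"
    and legs: "\<And>S i. S \<in> X \<Longrightarrow> i < s \<Longrightarrow> S ! i \<in> good_paths K (lg i)"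
    and lg: "\<And>i. i < s \<Longrightarrow> 1 \<le> lg i \<and> lg i \<le> L"
  shows "sum sw {S\<in>spider_class X xs. centre S = v} \<le> path_bd K L ^ s * spider_scale s lg"
proof -
  have dv: "deg v > 0" "deg v \<ge> d" using v A_sub deg_pos deg_A by blast+
  let ?c = "\<lambda>i. path_bd K L * path_scale True (lg i)"
  have c: "sum wt (path_class (good_paths K (lg i)) v (xs ! i)) \<le> ?c i" if "i < s" for i
  proof -
    have "sum wt (path_class (good_paths K (lg i)) v (xs ! i)) \<le> path_bd K (lg i) * path_scale (v \<in> A) (lg i)"
      using lg[OF that] by (intro good_paths_weight_bound) auto
    also have "\<dots> \<le> ?c i" using v lg[OF that] path_bd_mono[of "lg i" L K] path_scale_pos[of True "lg i"] by simp
    finally show ?thesis .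
  qed
  have c0: "?c i \<ge> 0" for i using mult_nonneg_nonneg[OF path_bd_nonneg less_imp_le[OF path_scale_pos]] .
  have sp: "(\<Prod>i<s. f i) = f 0 * (\<Prod>i\<in>{..<s}-{0}. f i)" for f :: "nat \<Rightarrow> real"
    using s by (intro prod.remove) auto
  have "sum sw {S\<in>spider_class X xs. centre S = v} \<le> deg v * (\<Prod>i<s. sum wt (path_class (good_paths K (lg i)) v (xs ! i)) / deg v)"
    by (rule sum_sw_centre[OF s v X legs])
  also have "\<dots> \<le> deg v * (\<Prod>i<s. ?c i / deg v)"
    using c dv by (intro mult_left_mono prod_mono) (auto intro!: divide_right_mono sum_nonneg divide_nonneg_nonneg simp: wt_nonneg)
  \<comment> \<open>One factor \<open>1 / deg v\<close> cancels against \<open>deg v\<close> first;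
    what is left decreases in \<open>deg v\<close>, so that only the lower bound \<open>d\<close> is
    called for.\<close>
  also have "\<dots> = ?c 0 * (\<Prod>i\<in>{..<s}-{0}. ?c i / deg v)" unfolding sp using dv by simp
  also have "\<dots> \<le> ?c 0 * (\<Prod>i\<in>{..<s}-{0}. ?c i / d)"
    using c0 dv d_pos by (intro mult_left_mono prod_mono) (auto intro!: divide_left_mono)
  also have "\<dots> = d * (\<Prod>i<s. ?c i / d)" unfolding sp using d_pos by simp
  also have "\<dots> = path_bd K L ^ s * spider_scale s lg"
  proof -
    have "(\<Prod>i<s. ?c i / d) = (\<Prod>i<s. path_bd K L * (path_scale True (lg i) / d))" by simp
    also have "\<dots> = path_bd K L ^ s * (\<Prod>i<s. path_scale True (lg i) / d)" by (simp only: prod.distrib prod_constant card_lessThan)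
    finally show ?thesis by (simp add: spider_scale_def)
  qed
  finally show ?thesis .
qed

text \<open>Here all centres are allowed at once, and no blocking set is involved. The centre
  \<open>v\<close> is a common neighbour of two of the ends, and the two single edges contribute
  exactly the weight \<open>1 / deg v\<close> of the path of length two through \<open>v\<close>.
  These paths are good, so their weights sum to at most a constant over \<open>d\<close>; the other
  legs are bounded as for a fixed centre.\<close>

lemma sum_sw_two_short_legs:
  assumes ij: "i < s" "j < s" "i \<noteq> j" "lg i = 1" "lg j = 1" and X: "X \<subseteq> spiders A s lg"
    and legs: "\<And>S i. S \<in> X \<Longrightarrow> i < s \<Longrightarrow> S ! i \<in> good_paths K (lg i)"
    and mid: "\<And>S. S \<in> X \<Longrightarrow> [last (S ! i), centre S, last (S ! j)] \<in> good_paths K 2"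
    and lg: "\<And>i. i < s \<Longrightarrow> 1 \<le> lg i \<and> lg i \<le> L" and L: "L \<ge> 2"
  shows "sum sw (spider_class X xs) \<le> path_bd K L ^ s * spider_scale s lg"
proof -
  have s: "s > 0" using ij by simp
  define F where "F = path_bd K L"
  have F1: "F \<ge> 1" using path_bd_ge1 by (simp add: F_def)
  define C where "C = {v\<in>A. [xs ! i, v, xs ! j] \<in> good_paths K 2}"
  have finC: "finite C" using finA by (simp add: C_def)
  let ?O = "{..<s} - {i} - {j}"
  let ?R = "\<Prod>l\<in>?O. F * path_scale True (lg l) / d"
  have R0: "?R \<ge> 0" using F1 d_pos path_scale_pos by (intro prod_nonneg) (auto intro!: less_imp_le)
  have finX: "finite X" using X finite_spiders[OF finA] finite_subset by blast
  have sp: "(\<Prod>l<s. f l) = f i * (f j * (\<Prod>l\<in>?O. f l))" for f :: "nat \<Rightarrow> real"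
  proof -
    have "(\<Prod>l<s. f l) = f i * (\<Prod>l\<in>{..<s}-{i}. f l)" using ij by (intro prod.remove) auto
    moreover have "(\<Prod>l\<in>{..<s}-{i}. f l) = f j * (\<Prod>l\<in>?O. f l)" using ij by (intro prod.remove) auto
    ultimately show ?thesis by simp
  qed
  have "spider_class X xs \<subseteq> (\<Union>v\<in>C. {S\<in>spider_class X xs. centre S = v})"
  proof
    fix S assume S: "S \<in> spider_class X xs"
    then have "S \<in> X" "map last S = xs" "length S = s" "centre S \<in> A" using X s by (auto simp: spider_class_def spiders_iff subset_iff)
    then have "centre S \<in> C" using mid[of S] ij by (auto simp: C_def)
    then show "S \<in> (\<Union>v\<in>C. {S\<in>spider_class X xs. centre S = v})" using S by blast
  qed
  then have "sum sw (spider_class X xs) \<le> (\<Sum>v\<in>C. sum sw {S\<in>spider_class X xs. centre S = v})"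
    using finC finX by (intro sum_over_union_le) (auto simp: spider_class_def sw_nonneg)
  also have "\<dots> \<le> (\<Sum>v\<in>C. wt [xs ! i, v, xs ! j] * ?R)"
  proof (intro sum_mono)
    fix v assume v: "v \<in> C"
    then have vA: "v \<in> A" by (simp add: C_def)
    have dv: "deg v > 0" "deg v \<ge> d" using vA A_sub deg_pos deg_A by blast+
    let ?f = "\<lambda>l. sum wt (path_class (good_paths K (lg l)) v (xs ! l)) / deg v"
    have f0: "?f l \<ge> 0" for l using dv by (auto intro!: divide_nonneg_nonneg sum_nonneg simp: wt_nonneg)
    have pr0: "(\<Prod>l\<in>?O. ?f l) \<ge> 0" using f0 by (intro prod_nonneg) blast
    then have fp: "?f j * (\<Prod>l\<in>?O. ?f l) \<ge> 0" using f0 by (intro mult_nonneg_nonneg)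
    have one: "sum wt (path_class (good_paths K 1) v x) \<le> 1" for x
    proof -
      have "path_class (good_paths K 1) v x \<subseteq> {[v, x]}"
        using good_paths_walks[of K 1] by (auto simp: path_class_def walks_def length_Suc_conv)
      then have "sum wt (path_class (good_paths K 1) v x) \<le> sum wt {[v, x]}"
        by (intro sum_mono2) (auto simp: wt_nonneg)
      also have "\<dots> = 1" using dv by (simp add: wt_def q_def)
      finally show ?thesis .
    qed
    have "walk [xs ! i, v, xs ! j]" using v good_paths_walks[of K 2] by (auto simp: C_def walks_def)
    then have xV: "xs ! i \<in> V" by (simp add: walk_def)
    have wtv: "wt [xs ! i, v, xs ! j] = 1 / deg v" using wt_Cons[of "[v, xs ! j]", OF _ xV] by (simp add: q_def)
    have "sum sw {S\<in>spider_class X xs. centre S = v} \<le> deg v * (\<Prod>l<s. ?f l)"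
      by (rule sum_sw_centre[OF s vA X legs])
    also have "\<dots> = deg v * (?f i * (?f j * (\<Prod>l\<in>?O. ?f l)))" unfolding sp[of ?f] ..
    also have "\<dots> \<le> deg v * (1 / deg v * (1 / deg v * ?R))"
    proof (intro mult_left_mono mult_mono)
      show "?f i \<le> 1 / deg v" "?f j \<le> 1 / deg v" using one ij dv by (auto intro!: divide_right_mono)
      show "(\<Prod>l\<in>?O. ?f l) \<le> ?R"
      proof (intro prod_mono conjI f0)
        fix l assume "l \<in> ?O"
        then have l: "1 \<le> lg l" "lg l \<le> L" using lg by auto
        have "sum wt (path_class (good_paths K (lg l)) v (xs ! l)) \<le> path_bd K (lg l) * path_scale (v \<in> A) (lg l)"
          using l by (intro good_paths_weight_bound) auto
        also have "\<dots> \<le> F * path_scale True (lg l)" using vA l path_bd_mono[of "lg l" L K] path_scale_pos[of True "lg l"] by (simp add: F_def)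
        finally show "?f l \<le> F * path_scale True (lg l) / d"
          using dv d_pos F1 path_scale_pos[of True "lg l"] by (intro frac_le) auto
      qed
    qed (use dv R0 f0 fp pr0 in auto)
    also have "\<dots> = wt [xs ! i, v, xs ! j] * ?R" using dv wtv by simp
    finally show "sum sw {S\<in>spider_class X xs. centre S = v} \<le> wt [xs ! i, v, xs ! j] * ?R" .
  qed
  also have "\<dots> = (\<Sum>v\<in>C. wt [xs ! i, v, xs ! j]) * ?R" by (simp add: sum_distrib_right)
  also have "\<dots> \<le> (F / d) * ?R"
  proof (intro mult_right_mono R0)
    show "(\<Sum>v\<in>C. wt [xs ! i, v, xs ! j]) \<le> F / d"
    proof (cases "C = {}")
      case True
      then show ?thesis using F1 d_pos by simp
    next
      case False
      then obtain v where v: "v \<in> C" by blast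
      then have w: "walk [xs ! i, v, xs ! j]" using good_paths_walks[of K 2] by (auto simp: C_def walks_def)
      then have "xs ! i \<in> N v" using walk_Cons[of "[v, xs ! j]" "xs ! i"] by simp
      then have nA: "xs ! i \<notin> A" using v N_A by (auto simp: C_def)
      have "(\<Sum>v\<in>C. wt [xs ! i, v, xs ! j]) = sum wt ((\<lambda>v. [xs ! i, v, xs ! j]) ` C)"
        by (subst sum.reindex) (auto simp: inj_on_def)
      also have "\<dots> \<le> sum wt (path_class (good_paths K 2) (xs ! i) (xs ! j))"
      proof (intro sum_mono2)
        have "path_class (good_paths K 2) (xs ! i) (xs ! j) \<subseteq> walks 2" using good_paths_walks by (auto simp: path_class_def)
        then show "finite (path_class (good_paths K 2) (xs ! i) (xs ! j))" using finite_walks finite_subset by blast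
      qed (auto simp: C_def path_class_def wt_nonneg)
      also have "\<dots> \<le> path_bd K 2 * path_scale (xs ! i \<in> A) 2" by (intro good_paths_weight_bound) auto
      also have "path_scale (xs ! i \<in> A) 2 = 1 / d" using nA by (simp add: path_scale_def side_deg_def atLeastLessThan_singleton numeral_2_eq_2)
      also have "path_bd K 2 * (1 / d) \<le> F / d" using d_pos path_bd_mono[OF L, of K] by (simp add: F_def divide_right_mono)
      finally show ?thesis .
    qed
  qed
  also have "\<dots> \<le> F ^ s * spider_scale s lg"
  proof -
    let ?R' = "\<Prod>l\<in>?O. path_scale True (lg l) / d"
    have R'0: "?R' \<ge> 0" using d_pos path_scale_pos by (intro prod_nonneg) (auto intro!: less_imp_le)
    have c: "card ?O = s - 2" using ij by (simp add: card_Diff_singleton)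
    have "?R = (\<Prod>l\<in>?O. F * (path_scale True (lg l) / d))" by simp
    also have "\<dots> = F ^ (s - 2) * ?R'" by (simp only: prod.distrib prod_constant c)
    finally have Req: "?R = F ^ (s - 2) * ?R'" .
    have "s - 1 = Suc (s - 2)" using ij by linarith
    then have "F ^ (s - 1) = F * F ^ (s - 2)" by (simp only: power_Suc)
    then have "F / d * ?R = F ^ (s - 1) * (?R' / d)" unfolding Req by simp
    moreover have "spider_scale s lg = ?R' / d"
      unfolding spider_scale_def sp using ij d_pos by (simp add: path_scale_def)
    moreover have "F ^ (s - 1) \<le> F ^ s" using F1 by (intro power_increasing) auto
    ultimately show ?thesis using R'0 d_pos by (auto intro!: mult_right_mono divide_right_mono)
  qed
  finally show ?thesis by (simp add: F_def)
qed

text \<open>Cut leg \<open>i\<close> at position \<open>p\<close>: the spider with the shortened leg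
  is good and ends in \<open>z\<close> there, the rest of the leg is a good path, and weights
  multiply up to \<open>1 / deg z\<close>. The factor lost in \<open>spider_scale\<close> is
  restored by \<open>path_scale_split\<close>.\<close>

lemma sum_sw_through:
  assumes s: "s > 0" and i: "i < s" and p: "1 \<le> p" "p < lg i" and lgL: "lg i \<le> L"
    and n: "(\<Sum>j<s. lg j) = Suc n"
    and IH: "sum sw (spider_class (good_spiders K s (Suc n - (lg i - p)) (lg(i := p))) (xs[i := z])) \<le> b * spider_scale s (lg(i := p))"
    and b: "b \<ge> 0"
  shows "sum sw {S\<in>spider_class (adm_spiders K s (good_spiders K s n) lg) xs. S ! i ! p = z} \<le> b * path_bd K L * spider_scale s lg"
proof (cases "{S\<in>spider_class (adm_spiders K s (good_spiders K s n) lg) xs. S ! i ! p = z} = {}")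
  case True
  show ?thesis unfolding True using b path_bd_nonneg spider_scale_pos[of s lg] by (auto intro!: mult_nonneg_nonneg less_imp_le)
next
  case False
  let ?Ad = "adm_spiders K s (good_spiders K s n) lg"
  let ?Y = "{S\<in>spider_class ?Ad xs. S ! i ! p = z}"
  have Y: "S \<in> spiders A s lg" "length S = s" "centre S \<in> A" "walk (S ! i)" "length (S ! i) = Suc (lg i)"
    "hd (S ! i) = centre S" "S ! i ! p = z" "map last S = xs" "S ! i \<in> good_paths K (lg i)" if "S \<in> ?Y" for S
    using that s i by (auto simp: spider_class_def adm_spiders_def spiders_iff)
  obtain S1 where S1: "S1 \<in> ?Y" using False by blast
  have zA: "(z \<in> A) = (True = even p)"
    using side_nth[OF Y(4)[OF S1], of p] Y(3,5,6,7)[OF S1] p by auto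
  have zV: "z \<in> V" using walk_set[OF Y(4)[OF S1]] Y(5,7)[OF S1] p nth_mem[of p "S1 ! i"] by auto
  have dz: "deg z \<ge> side_deg True p" using deg_side[OF zV] zA by (auto simp: side_deg_def)
  define G1 where "G1 = spider_class (good_spiders K s (Suc n - (lg i - p)) (lg(i := p))) (xs[i := z])"
  define G2 where "G2 = path_class (good_paths K (lg i - p)) z (xs ! i)"
  let ?f = "\<lambda>S. (S[i := take (Suc p) (S ! i)], drop p (S ! i))"
  have "G1 \<subseteq> spiders A s (lg(i := p))" "G2 \<subseteq> walks (lg i - p)"
    using good_spiders_spiders[of K s "Suc n - (lg i - p)" "lg(i := p)"] good_paths_walks[of K "lg i - p"]
    unfolding G1_def G2_def spider_class_def path_class_def by blast+
  then have fin: "finite G1" "finite G2" using finite_spiders[OF finA] finite_walks finite_subset by blast+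
  have sub: "?f ` ?Y \<subseteq> G1 \<times> G2"
  proof
    fix y assume "y \<in> ?f ` ?Y"
    then obtain S where S: "S \<in> ?Y" "y = ?f S" by blast
    note YS = Y[OF S(1)]
    have SA: "S \<in> ?Ad" using S by (simp add: spider_class_def)
    let ?S = "S[i := butlast (S ! i)]" and ?l = "lg(i := lg i - 1)"
    have 1: "?S \<in> good_spiders K s n ?l" using SA i p by (auto simp: adm_spiders_def)
    have 2: "(\<Sum>j<s. ?l j) = n" using sum_update[OF i, of lg "lg i - 1"] n p by linarith
    have "?S[i := take (Suc p) (?S ! i)] \<in> good_spiders K s (n - (?l i - p)) (?l(i := p))"
      using p by (intro good_spiders_truncate[OF s i 1 2]) auto
    moreover have "?S[i := take (Suc p) (?S ! i)] = S[i := take (Suc p) (S ! i)]"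
      using YS i p by (simp add: butlast_conv_take min_def)
    moreover have "n - (?l i - p) = Suc n - (lg i - p)"
    proof -
      have "lg i \<le> Suc n" using member_le_sum[of i "{..<s}" lg] i n by simp
      then show ?thesis using p by simp
    qed
    ultimately have "S[i := take (Suc p) (S ! i)] \<in> good_spiders K s (Suc n - (lg i - p)) (lg(i := p))" by simp
    moreover have "map last (S[i := take (Suc p) (S ! i)]) = xs[i := z]"
      using YS p by (simp add: map_update take_Suc_conv_app_nth)
    ultimately have "fst y \<in> G1" using S(2) by (simp add: G1_def spider_class_def)
    moreover have "drop p (S ! i) \<in> good_paths K (lg i - p)"
      using good_paths_drop[of "S ! i" K "lg i - p" p] YS(9) p by simp
    then have "drop p (S ! i) \<in> G2"
      using YS p i by (auto simp: G2_def path_class_def hd_drop_conv_nth)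
    ultimately show "y \<in> G1 \<times> G2" using S(2) by simp
  qed
  have inj: "inj_on ?f ?Y"
  proof (rule inj_onI)
    fix S S' assume *: "S \<in> ?Y" "S' \<in> ?Y" "?f S = ?f S'"
    have e: "S[i := take (Suc p) (S ! i)] = S'[i := take (Suc p) (S' ! i)]" "drop p (S ! i) = drop p (S' ! i)"
      using *(3) by auto
    have "take (Suc p) (S ! i) = take (Suc p) (S' ! i)"
      using arg_cong[OF e(1), of "\<lambda>T. T ! i"] Y(2)[OF *(1)] Y(2)[OF *(2)] i by simp
    then have "take p (take (Suc p) (S ! i)) = take p (take (Suc p) (S' ! i))" by simp
    then have "take p (S ! i) = take p (S' ! i)" by (simp add: min_def)
    then have "S ! i = S' ! i" using e(2) by (metis append_take_drop_id)
    moreover have "S = (S[i := take (Suc p) (S ! i)])[i := S ! i]"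
      "S' = (S'[i := take (Suc p) (S' ! i)])[i := S' ! i]" by simp_all
    ultimately show "S = S'" using e(1) by metis
  qed
  have "sum sw ?Y = (\<Sum>S\<in>?Y. sw (fst (?f S)) * wt (snd (?f S)) / deg z)"
  proof (intro sum.cong refl)
    fix S assume "S \<in> ?Y"
    note YS = Y[OF this]
    let ?T = "S[i := take (Suc p) (S ! i)]"
    have hT: "hd (take (Suc p) (S ! i)) = centre S" using YS by simp
    have cT: "centre ?T = centre S" using centre_update[of i S, OF _ hT] YS i by simp
    have Ti: "?T ! i = take (Suc p) (S ! i)" using YS i by simp
    have "q (S ! i) = q (?T ! i) * q (drop p (S ! i))" unfolding Ti using YS p by (intro q_split) auto
    then have "sw (?T[i := S ! i]) = sw ?T * q (drop p (S ! i))"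
      using YS i cT by (intro sw_update) auto
    moreover have "wt (drop p (S ! i)) = deg z * q (drop p (S ! i))"
      using YS p by (simp add: wt_def hd_drop_conv_nth)
    moreover have "deg z > 0" using zV deg_pos by blast
    ultimately show "sw S = sw (fst (?f S)) * wt (snd (?f S)) / deg z" by simp
  qed
  also have "\<dots> = (\<Sum>y\<in>?f ` ?Y. sw (fst y) * wt (snd y) / deg z)"
    using inj by (subst sum.reindex) auto
  also have "\<dots> \<le> (\<Sum>y\<in>G1 \<times> G2. sw (fst y) * wt (snd y) / deg z)"
    using fin sub by (intro sum_mono2) (auto simp: wt_nonneg sw_nonneg deg_nonneg)
  also have "\<dots> = sum sw G1 * sum wt G2 / deg z"
    by (simp add: sum_product sum.cartesian_product case_prod_unfold sum_divide_distrib)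
  also have "\<dots> \<le> (b * spider_scale s (lg(i := p))) * (path_bd K L * path_scale (z \<in> A) (lg i - p)) / side_deg True p"
  proof (intro frac_le mult_mono)
    show "sum sw G1 \<le> b * spider_scale s (lg(i := p))" using IH by (simp add: G1_def)
    have "sum wt G2 \<le> path_bd K (lg i - p) * path_scale (z \<in> A) (lg i - p)"
      unfolding G2_def using p by (intro good_paths_weight_bound) auto
    also have "\<dots> \<le> path_bd K L * path_scale (z \<in> A) (lg i - p)"
      using lgL path_scale_pos by (intro mult_right_mono path_bd_mono) (auto intro!: less_imp_le)
    finally show "sum wt G2 \<le> path_bd K L * path_scale (z \<in> A) (lg i - p)" .
  qed (use dz side_deg_pos path_scale_pos spider_scale_pos b in \<open>auto simp: wt_nonneg less_imp_le path_bd_nonneg intro!: sum_nonneg mult_nonneg_nonneg\<close>)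
  also have "\<dots> = b * path_bd K L * (spider_scale s (lg(i := p)) * (1 / side_deg True p) * path_scale (True = even p) (lg i - p))"
    using zA by simp
  also have "spider_scale s (lg(i := p)) * (1 / side_deg True p) * path_scale (True = even p) (lg i - p) = spider_scale s lg"
  proof -
    have sp: "(\<Prod>l<s. f l) = f i * (\<Prod>l\<in>{..<s}-{i}. f l)" for f :: "nat \<Rightarrow> real"
      using i by (intro prod.remove) auto
    have "(\<Prod>l\<in>{..<s}-{i}. path_scale True ((lg(i := p)) l) / d) = (\<Prod>l\<in>{..<s}-{i}. path_scale True (lg l) / d)"
      by (intro prod.cong) auto
    then show ?thesis unfolding spider_scale_def sp using path_scale_split[OF p, of True] by simp
  qed
  finally show ?thesis .
qed

text \<open>If two legs are single edges, the bound is direct. Otherwise a nonempty class has ends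
  that are not saturated, and some \<open>Y\<close> with at most \<open>K\<close> vertices meets
  more than a quarter of the weight. As \<open>Y\<close> contains no end, it meets a spider in the
  centre or in the interior of a leg; both contributions are bounded, the latter by
  induction.\<close>

lemma good_spiders_weight_bound:
  assumes s: "s > 0" and L: "L \<ge> 2"
  shows "(\<Sum>i<s. lg i) = n \<Longrightarrow> (\<And>i. i < s \<Longrightarrow> 1 \<le> lg i \<and> lg i \<le> L) \<Longrightarrow>
    sum sw (spider_class (good_spiders K s n lg) xs) \<le> spider_bd K L s n * spider_scale s lg"
proof (induction n arbitrary: lg xs rule: less_induct)
  case (less n)
  have rhs: "spider_bd K L s n * spider_scale s lg \<ge> 0"
    using spider_bd_mono1[of K L s n] spider_scale_pos[of s lg] by (auto intro!: mult_nonneg_nonneg less_imp_le)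
  have "n \<noteq> 0"
  proof
    assume "n = 0"
    then have "lg 0 = 0" using less.prems(1) s by simp
    then show False using less.prems(2)[OF s] by simp
  qed
  then obtain m where m: "n = Suc m" by (cases n) auto
  show ?case
  proof (cases "spider_class (good_spiders K s n lg) xs = {}")
    case True
    show ?thesis unfolding True using rhs by simp
  next
    case False
    define Ad where "Ad = adm_spiders K s (good_spiders K s m) lg"
    have AdSP: "Ad \<subseteq> spiders A s lg" by (auto simp: Ad_def adm_spiders_def)
    have finAd: "finite Ad" using AdSP finite_spiders[OF finA] finite_subset by blast
    have legs: "S ! i \<in> good_paths K (lg i)" if "S \<in> Ad" "i < s" for S i using that by (auto simp: Ad_def adm_spiders_def)
    have mono: "sum sw (spider_class (good_spiders K s n lg) xs) \<le> sum sw (spider_class Ad xs)"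
      using finAd sw_nonneg by (intro sum_mono2) (auto simp: spider_class_def Ad_def m)
    have base: "path_bd K L ^ s * spider_scale s lg \<le> spider_bd K L s n * spider_scale s lg"
      using spider_bd_mono[of 0 n K L s] spider_scale_pos[of s lg] by (intro mult_right_mono) auto
    show ?thesis
    proof (cases "testable_shape s lg")
      case testable_shape: False
      then obtain i j where ij: "i < s" "j < s" "i \<noteq> j" "lg i = 1" "lg j = 1"
        using less.prems(2) by (auto simp: testable_shape_def)
      have "sum sw (spider_class Ad xs) \<le> path_bd K L ^ s * spider_scale s lg"
      proof (rule sum_sw_two_short_legs[OF ij AdSP legs _ less.prems(2) L])
        show "[last (S ! i), centre S, last (S ! j)] \<in> good_paths K 2" if "S \<in> Ad" for S
          using that ij by (auto simp: Ad_def adm_spiders_def)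
      qed
      then show ?thesis using mono base by linarith
    next
      case testable_shape: True
      from False obtain S0 where "S0 \<in> good_spiders K s n lg" "map last S0 = xs" by (auto simp: spider_class_def)
      then have "\<not> spider_saturated K Ad xs" using testable_shape by (auto simp: m Ad_def)
      then obtain Y where Y: "finite Y" "card Y \<le> K" "Y \<inter> set xs = {}"
        and hit: "4 * sum sw {S\<in>spider_class Ad xs. set (vlist S) \<inter> Y \<noteq> {}} > sum sw (spider_class Ad xs)"
        by (auto simp: spider_saturated_def not_le)
      let ?I = "Y \<times> {..<s} \<times> {1..<L}"
      let ?c = "\<lambda>y. {S\<in>spider_class Ad xs. centre S = y}"
      let ?l = "\<lambda>(y, i, p). {S\<in>spider_class Ad xs. p < lg i \<and> S ! i ! p = y}"
      have sub: "{S\<in>spider_class Ad xs. set (vlist S) \<inter> Y \<noteq> {}} \<subseteq> (\<Union>y\<in>Y. ?c y) \<union> (\<Union>x\<in>?I. ?l x)"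
      proof
        fix S assume "S \<in> {S\<in>spider_class Ad xs. set (vlist S) \<inter> Y \<noteq> {}}"
        then obtain y where S: "S \<in> spider_class Ad xs" and y: "y \<in> set (vlist S)" "y \<in> Y" by blast
        have SS: "S \<in> spiders A s lg" "map last S = xs" "length S = s" using S AdSP s by (auto simp: spider_class_def spiders_iff subset_iff)
        show "S \<in> (\<Union>y\<in>Y. ?c y) \<union> (\<Union>x\<in>?I. ?l x)"
        proof (cases "y = centre S")
          case True
          then show ?thesis using S y by auto
        next
          case False
          then obtain P where "P \<in> set S" "y \<in> set (tl P)" using y by (auto simp: vlist_def)
          then obtain i where i: "i < s" "y \<in> set (tl (S ! i))" using SS by (metis in_set_conv_nth)
          have li: "length (S ! i) = Suc (lg i)" using SS i s by (auto simp: spiders_iff)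
          obtain p' where p': "p' < length (tl (S ! i))" "y = tl (S ! i) ! p'"
            using i by (metis in_set_conv_nth)
          then have p: "Suc p' < Suc (lg i)" "y = S ! i ! Suc p'" using li by (auto simp: nth_tl)
          \<comment> \<open>A blocking vertex is not an end, so the leg is met at an interior
            position and can be cut into two nontrivial parts.\<close>
          have "Suc p' \<noteq> lg i"
          proof
            assume e: "Suc p' = lg i"
            have "S ! i \<noteq> []" using li by auto
            then have "last (S ! i) = S ! i ! lg i" using li by (simp add: last_conv_nth)
            then have "y = last (S ! i)" using e p by simp
            also have "\<dots> = xs ! i" using SS i by (metis nth_map)
            also have "xs ! i \<in> set xs" using SS i by (metis length_map nth_mem)
            finally show False using y Y by auto
          qed
          then have "Suc p' < lg i" using p by simp
          then show ?thesis using S y i p less.prems(2)[OF i(1)]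
            by (intro UnI2 UN_I[of "(y, i, Suc p')"]) auto
        qed
      qed
      have cb: "sum sw (?c y) \<le> path_bd K L ^ s * spider_scale s lg" for y
      proof (cases "y \<in> A")
        case True
        show ?thesis by (rule sum_sw_centre_le[OF s True AdSP legs less.prems(2)])
      next
        case False
        have "?c y = {}" using False AdSP s by (auto simp: spider_class_def spiders_iff)
        then show ?thesis using spider_scale_pos[of s lg] path_bd_nonneg by (auto intro!: mult_nonneg_nonneg less_imp_le simp del: Collect_empty_eq)
      qed
      have lb: "sum sw (?l x) \<le> spider_bd K L s m * path_bd K L * spider_scale s lg" if xI: "x \<in> ?I" for x
      proof -
        obtain y i p where x: "x = (y, i, p)" "i < s" "1 \<le> p" using xI by (cases x) auto
        show ?thesis
        proof (cases "p < lg i")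
          case True
          let ?lg = "lg(i := p)" and ?m = "Suc m - (lg i - p)"
          have "lg i \<le> Suc m" using member_le_sum[of i "{..<s}" lg] x(2) less.prems(1) m by simp
          then have mm: "(\<Sum>j<s. ?lg j) = ?m" using sum_update[OF x(2), of lg p] less.prems(1) m True by linarith
          have "sum sw (spider_class (good_spiders K s ?m ?lg) (xs[i := y])) \<le> spider_bd K L s ?m * spider_scale s ?lg"
          proof (rule less.IH[OF _ mm])
            show "?m < n" using True m by linarith
            show "1 \<le> ?lg j \<and> ?lg j \<le> L" if "j < s" for j
              using less.prems(2)[OF that] x(3) True less.prems(2)[OF x(2)] by auto
          qed
          also have "\<dots> \<le> spider_bd K L s m * spider_scale s ?lg"
            using True spider_scale_pos[of s ?lg] by (intro mult_right_mono spider_bd_mono) auto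
          finally have "sum sw {S\<in>spider_class (adm_spiders K s (good_spiders K s m) lg) xs. S ! i ! p = y} \<le> spider_bd K L s m * path_bd K L * spider_scale s lg"
            using x True less.prems m spider_bd_mono1[of K L s m] by (intro sum_sw_through[OF s]) auto
          then show ?thesis using x True by (simp add: Ad_def)
        next
          case False
          then show ?thesis using x spider_scale_pos[of s lg] path_bd_nonneg spider_bd_mono1[of K L s m]
            by (auto intro!: mult_nonneg_nonneg less_imp_le)
        qed
      qed
      have finC: "finite (spider_class Ad xs)" using finAd by (simp add: spider_class_def)
      have "sum sw {S\<in>spider_class Ad xs. set (vlist S) \<inter> Y \<noteq> {}} \<le> sum sw ((\<Union>y\<in>Y. ?c y) \<union> (\<Union>x\<in>?I. ?l x))"
        using sub finC Y by (intro sum_mono2) (auto simp: sw_nonneg)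
      also have "\<dots> \<le> sum sw (\<Union>y\<in>Y. ?c y) + sum sw (\<Union>x\<in>?I. ?l x)"
      proof -
        have f: "finite (\<Union>y\<in>Y. ?c y)" "finite (\<Union>x\<in>?I. ?l x)" using finC Y by auto
        have "sum sw ((\<Union>y\<in>Y. ?c y) \<inter> (\<Union>x\<in>?I. ?l x)) \<ge> 0" using sw_nonneg by (intro sum_nonneg)
        then show ?thesis using sum_Un[OF f, of sw] by linarith
      qed
      finally have hs: "sum sw {S\<in>spider_class Ad xs. set (vlist S) \<inter> Y \<noteq> {}} \<le> sum sw (\<Union>y\<in>Y. ?c y) + sum sw (\<Union>x\<in>?I. ?l x)" .
      have "sum sw (\<Union>y\<in>Y. ?c y) \<le> (\<Sum>y\<in>Y. sum sw (?c y))"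
        using finC Y by (intro sum_over_union_le) (auto simp: sw_nonneg)
      also have "\<dots> \<le> real (card Y) * (path_bd K L ^ s * spider_scale s lg)" using cb by (intro sum_bounded_above)
      also have "\<dots> \<le> real K * (path_bd K L ^ s * spider_scale s lg)"
        using Y mult_nonneg_nonneg[OF zero_le_power[OF path_bd_nonneg] less_imp_le[OF spider_scale_pos]] by (intro mult_right_mono) auto
      finally have h1: "sum sw (\<Union>y\<in>Y. ?c y) \<le> real K * (path_bd K L ^ s * spider_scale s lg)" .
      have nn: "0 \<le> spider_bd K L s m * path_bd K L * spider_scale s lg"
        using spider_bd_mono1[of K L s m] by (intro mult_nonneg_nonneg path_bd_nonneg less_imp_le[OF spider_scale_pos]) blast
      have "sum sw (\<Union>x\<in>?I. ?l x) \<le> (\<Sum>x\<in>?I. sum sw (?l x))"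
        using finC Y by (intro sum_over_union_le) (auto simp: sw_nonneg)
      also have "\<dots> \<le> real (card ?I) * (spider_bd K L s m * path_bd K L * spider_scale s lg)"
        using lb by (intro sum_bounded_above)
      also have "\<dots> \<le> (real K * real s * real L) * (spider_bd K L s m * path_bd K L * spider_scale s lg)"
      proof (intro mult_right_mono nn)
        have "card ?I \<le> K * (s * L)" unfolding card_cartesian_product using Y by (intro mult_mono) auto
        then have "real (card ?I) \<le> real (K * (s * L))" by (simp only: of_nat_le_iff)
        then show "real (card ?I) \<le> real K * real s * real L" by (simp add: mult.assoc)
      qed
      finally have h2: "sum sw (\<Union>x\<in>?I. ?l x) \<le> (real K * real s * real L) * (spider_bd K L s m * path_bd K L * spider_scale s lg)" .
      have comb: "a \<le> 4 * (x + y)" if "a < 4 * b" "b \<le> c + e" "c \<le> x" "e \<le> y" for a b c e x y :: real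
      proof -
        have "b \<le> x + y" using that by linarith
        then have "4 * b \<le> 4 * (x + y)" by (rule mult_left_mono) simp
        then show ?thesis using that(1) by (rule order_trans[OF less_imp_le, rotated])
      qed
      have "sum sw (spider_class Ad xs) \<le> 4 * (real K * (path_bd K L ^ s * spider_scale s lg)
          + (real K * real s * real L) * (spider_bd K L s m * path_bd K L * spider_scale s lg))" by (rule comb[OF hit hs h1 h2])
      also have "\<dots> = (4 * real K * (path_bd K L ^ s + real s * real L * (spider_bd K L s m * path_bd K L))) * spider_scale s lg"
        by (simp add: algebra_simps)
      also have "\<dots> \<le> spider_bd K L s n * spider_scale s lg"
        using spider_scale_pos[of s lg] spider_bd_mono1[of K L s m] by (intro mult_right_mono) (auto simp: m)
      finally show ?thesis using mono by linarith
    qed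
  qed
qed

section \<open>Mass of the spiders that are not good\<close>

lemma spiders_truncate:
  assumes s: "s > 0" and S: "S \<in> spiders Z s lg" and le: "\<And>i. i < s \<Longrightarrow> lg' i \<le> lg i"
  shows "map (\<lambda>i. take (Suc (lg' i)) (S ! i)) [0..<s] \<in> spiders Z s lg'" (is "?T \<in> _")
proof -
  have l: "walk (S ! i)" "hd (S ! i) = centre S" "length (S ! i) = Suc (lg i)" if "i < s" for i
    using S s that by (auto simp: spiders_iff)
  have T: "?T ! i = take (Suc (lg' i)) (S ! i)" if "i < s" for i using that by simp
  have "centre S \<in> Z" using S s by (auto simp: spiders_iff)
  moreover have "walk (?T ! i) \<and> hd (?T ! i) = centre S \<and> length (?T ! i) = Suc (lg' i)" if "i < s" for i
    unfolding T[OF that] using l[OF that] le[OF that] by (auto intro: walk_take)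
  ultimately show ?thesis unfolding spiders_def by (intro CollectI conjI bexI[of _ "centre S"]) auto
qed

lemma sw_short_legs:
  assumes s: "s > 0" and S: "S \<in> spiders Z s lg" and I: "I \<subseteq> {..<s}" and 0: "\<And>i. i < s \<Longrightarrow> i \<notin> I \<Longrightarrow> lg i = 0"
  shows "sw S = deg (centre S) * (\<Prod>i\<in>I. q (S ! i))"
proof -
  have "prod_list (map q S) = (\<Prod>i<s. q (S ! i))" using prod_list_nth[of q S] S by (simp add: spiders_def)
  also have "\<dots> = (\<Prod>i\<in>I. q (S ! i))"
  proof (intro prod.mono_neutral_right)
    show "\<forall>i\<in>{..<s} - I. q (S ! i) = 1"
    proof
      fix i assume i: "i \<in> {..<s} - I"
      then have "length (S ! i) = 1" using S s 0[of i] by (auto simp: spiders_iff)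
      then show "q (S ! i) = 1" by (cases "S ! i") auto
    qed
  qed (use I in auto)
  finally show ?thesis by (simp add: sw_def)
qed

lemma zero_leg:
  assumes "s > 0" "S \<in> spiders Z s lg" "i < s" "lg i = 0"
  shows "S ! i = [centre S]"
proof -
  have "length (S ! i) = 1" "hd (S ! i) = centre S" using assms by (auto simp: spiders_iff)
  then show ?thesis by (cases "S ! i") auto
qed

text \<open>When the other legs are summed out, a spider reduces to the single walk
  \<open>S ! i\<close> from a centre in \<open>A\<close>, with its weight \<open>wt\<close>.\<close>

lemma mass_bad_leg:
  assumes s: "s > 0" and i: "i < s"
  shows "sum sw {S\<in>spiders A s lg. S ! i \<notin> good_paths K (lg i)} \<le> sum wt (walks (lg i) - good_paths K (lg i))"
proof -
  define lg' where "lg' j = (if j = i then lg i else 0)" for j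
  let ?t = "\<lambda>S. map (\<lambda>j. take (Suc (lg' j)) (S ! j)) [0..<s]"
  let ?X = "{S\<in>spiders A s lg'. S ! i \<notin> good_paths K (lg i)}"
  have le: "lg' j \<le> lg j" for j by (simp add: lg'_def)
  have "{S\<in>spiders A s lg. S ! i \<notin> good_paths K (lg i)} \<subseteq> {S\<in>spiders A s lg. ?t S \<in> ?X}"
  proof
    fix S assume S: "S \<in> {S\<in>spiders A s lg. S ! i \<notin> good_paths K (lg i)}"
    then have "length (S ! i) = Suc (lg i)" using s i by (auto simp: spiders_iff)
    then have "?t S ! i = S ! i" using i by (simp add: lg'_def)
    then show "S \<in> {S\<in>spiders A s lg. ?t S \<in> ?X}" using S spiders_truncate[OF s, of S A lg lg'] le by auto
  qed
  then have "sum sw {S\<in>spiders A s lg. S ! i \<notin> good_paths K (lg i)} \<le> sum sw {S\<in>spiders A s lg. ?t S \<in> ?X}"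
    using finite_spiders[OF finA] sw_nonneg by (intro sum_mono2) auto
  also have "\<dots> = sum sw ?X" using le by (intro sum_sw_truncate[OF s A_sub]) auto
  also have "\<dots> = (\<Sum>S\<in>?X. wt (S ! i))"
  proof (intro sum.cong refl)
    fix S assume "S \<in> ?X"
    then have S: "S \<in> spiders A s lg'" by simp
    have "sw S = deg (centre S) * (\<Prod>j\<in>{i}. q (S ! j))"
      by (rule sw_short_legs[OF s S]) (use i in \<open>auto simp: lg'_def\<close>)
    moreover have "hd (S ! i) = centre S" using S s i by (auto simp: spiders_iff)
    ultimately show "sw S = wt (S ! i)" by (simp add: wt_def)
  qed
  also have "\<dots> = sum wt ((\<lambda>S. S ! i) ` ?X)"
  proof (subst sum.reindex)
    show "inj_on (\<lambda>S. S ! i) ?X"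
    proof (rule inj_onI)
      fix S S' assume *: "S \<in> ?X" "S' \<in> ?X" "S ! i = S' ! i"
      then have S: "S \<in> spiders A s lg'" "S' \<in> spiders A s lg'" by auto
      have "centre S = hd (S ! i)" "centre S' = hd (S' ! i)" using S s i by (auto simp: spiders_iff)
      then have c: "centre S = centre S'" using *(3) by simp
      have "S ! j = S' ! j" if "j < s" for j
        using zero_leg[OF s S(1) that] zero_leg[OF s S(2) that] c *(3) by (cases "j = i") (auto simp: lg'_def)
      then show "S = S'" using S by (intro nth_equalityI) (auto simp: spiders_def)
    qed
  qed simp
  also have "\<dots> \<le> sum wt (walks (lg i) - good_paths K (lg i))"
    using finite_walks wt_nonneg s i by (intro sum_mono2) (auto simp: walks_def spiders_iff lg'_def)
  finally show ?thesis .
qed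

text \<open>When the other legs are summed out, the two edges at the centre form a walk of length
  two with the centre in the middle; both weights equal the reciprocal of the degree of the
  centre.\<close>

lemma mass_bad_pair:
  assumes ij: "i < s" "j < s" "i \<noteq> j" "lg i = 1" "lg j = 1"
  shows "sum sw {S\<in>spiders A s lg. [last (S ! i), centre S, last (S ! j)] \<notin> good_paths K 2} \<le> sum wt (walks 2 - good_paths K 2)"
proof -
  have s: "s > 0" using ij by simp
  define lg' where "lg' l = (if l = i \<or> l = j then Suc 0 else 0)" for l
  let ?t = "\<lambda>S. map (\<lambda>j. take (Suc (lg' j)) (S ! j)) [0..<s]"
  let ?\<phi> = "\<lambda>S. [last (S ! i), centre S, last (S ! j)]"
  let ?X = "{S\<in>spiders A s lg'. ?\<phi> S \<notin> good_paths K 2}"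
  have le: "lg' l \<le> lg l" for l using ij by (simp add: lg'_def)
  have "{S\<in>spiders A s lg. ?\<phi> S \<notin> good_paths K 2} \<subseteq> {S\<in>spiders A s lg. ?t S \<in> ?X}"
  proof
    fix S assume S: "S \<in> {S\<in>spiders A s lg. ?\<phi> S \<notin> good_paths K 2}"
    then have "length (S ! i) = 2" "length (S ! j) = 2" "hd (S ! i) = centre S" using s ij by (auto simp: spiders_iff)
    then have *: "?t S ! i = S ! i" "?t S ! j = S ! j" "hd (?t S ! i) = centre S" using ij by (simp_all add: lg'_def)
    have T: "?t S \<in> spiders A s lg'" using S spiders_truncate[OF s, of S A lg lg'] le by blast
    then have "hd (?t S ! i) = centre (?t S)" using ij s by (auto simp: spiders_iff)
    then have "?\<phi> (?t S) = ?\<phi> S" using * by simp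
    then have "?t S \<in> ?X" using S T by (simp del: map_eq_conv)
    then show "S \<in> {S\<in>spiders A s lg. ?t S \<in> ?X}" using S by blast
  qed
  then have "sum sw {S\<in>spiders A s lg. ?\<phi> S \<notin> good_paths K 2} \<le> sum sw {S\<in>spiders A s lg. ?t S \<in> ?X}"
    using finite_spiders[OF finA] sw_nonneg by (intro sum_mono2) auto
  also have "\<dots> = sum sw ?X" using le by (intro sum_sw_truncate[OF s A_sub]) auto
  also have "\<dots> = (\<Sum>S\<in>?X. wt (?\<phi> S))"
  proof (intro sum.cong refl)
    fix S assume "S \<in> ?X"
    then have S: "S \<in> spiders A s lg'" by simp
    have l: "length (S ! i) = 2" "length (S ! j) = 2" "hd (S ! i) = centre S" "hd (S ! j) = centre S"
      "walk (S ! i)" "centre S \<in> A"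
      using S s ij by (auto simp: spiders_iff lg'_def)
    have dv: "deg (centre S) > 0" using l A_sub deg_pos by blast
    have e: "S ! i = [centre S, last (S ! i)]" "S ! j = [centre S, last (S ! j)]"
      using l by (auto simp: length_Suc_conv numeral_2_eq_2)
    have qe: "q [x, y] = 1 / deg x" for x y by (simp add: q_def)
    have "sw S = deg (centre S) * (\<Prod>l\<in>{i, j}. q (S ! l))"
      by (rule sw_short_legs[OF s S]) (use ij in \<open>auto simp: lg'_def\<close>)
    also have "\<dots> = deg (centre S) * (q (S ! i) * q (S ! j))" using ij by simp
    also have "\<dots> = 1 / deg (centre S)" using e qe dv by (metis nonzero_mult_div_cancel_left times_divide_eq_right mult.commute mult_1 less_irrefl)
    finally have "sw S = 1 / deg (centre S)" .
    moreover have "last (S ! i) \<in> V" using walk_hd_last[OF l(5)] by simp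
    then have "wt (?\<phi> S) = 1 / deg (centre S)" using wt_Cons[of "[centre S, last (S ! j)]"] qe by simp
    ultimately show "sw S = wt (?\<phi> S)" by simp
  qed
  also have "\<dots> = sum wt (?\<phi> ` ?X)"
  proof (subst sum.reindex)
    show "inj_on ?\<phi> ?X"
    proof (rule inj_onI)
      fix S S' assume *: "S \<in> ?X" "S' \<in> ?X" "?\<phi> S = ?\<phi> S'"
      then have S: "S \<in> spiders A s lg'" "S' \<in> spiders A s lg'" by auto
      have e: "R ! l = [centre R, last (R ! l)]" if R: "R \<in> spiders A s lg'" and l: "l = i \<or> l = j" for R l
      proof -
        have "length (R ! l) = 2" "hd (R ! l) = centre R" using R l ij s by (auto simp: spiders_iff lg'_def)
        then show ?thesis by (auto simp: length_Suc_conv numeral_2_eq_2)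
      qed
      have "S ! l = S' ! l" if "l < s" for l
      proof (cases "l = i \<or> l = j")
        case True
        then show ?thesis using e[OF S(1) True] e[OF S(2) True] *(3) by auto
      next
        case False
        then show ?thesis using zero_leg[OF s S(1) that] zero_leg[OF s S(2) that] *(3) by (simp add: lg'_def)
      qed
      then show "S = S'" using S by (intro nth_equalityI) (auto simp: spiders_def)
    qed
  qed simp
  also have "\<dots> \<le> sum wt (walks 2 - good_paths K 2)"
  proof (intro sum_mono2)
    show "?\<phi> ` ?X \<subseteq> walks 2 - good_paths K 2"
    proof (rule image_subsetI)
      fix S assume "S \<in> ?X"
      then have S: "S \<in> spiders A s lg'" and ng: "?\<phi> S \<notin> good_paths K 2" by auto
      have l: "length (S ! i) = 2" "length (S ! j) = 2" "hd (S ! i) = centre S" "hd (S ! j) = centre S"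
        "walk (S ! i)" "walk (S ! j)" using S s ij by (auto simp: spiders_iff lg'_def)
      have e: "S ! i = [centre S, last (S ! i)]" "S ! j = [centre S, last (S ! j)]"
        using l by (auto simp: length_Suc_conv numeral_2_eq_2)
      have "last (S ! i) \<in> N (centre S)" using walk_snoc[of "[centre S]" "last (S ! i)"] l(5) e(1) by simp
      moreover have "walk [centre S, last (S ! j)]" using l(6) by (simp flip: e(2))
      ultimately have "walk (?\<phi> S)" using walk_Cons[of "[centre S, last (S ! j)]" "last (S ! i)"] by simp
      then show "?\<phi> S \<in> walks 2 - good_paths K 2" using ng by (simp add: walks_def)
    qed
  qed (auto simp: finite_walks wt_nonneg)
  finally show ?thesis .
qed

lemma card_vlist:
  assumes s: "s > 0" and S: "S \<in> spiders Z s lg" and lg: "\<And>i. i < s \<Longrightarrow> lg i \<le> L"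
  shows "card (set (vlist S)) \<le> Suc (s * L)"
proof -
  have len: "length S = s" using S by (simp add: spiders_def)
  have "set (vlist S) \<subseteq> insert (centre S) (\<Union>i<s. set (tl (S ! i)))"
  proof
    fix y assume y: "y \<in> set (vlist S)"
    show "y \<in> insert (centre S) (\<Union>i<s. set (tl (S ! i)))"
    proof (cases "y = centre S")
      case False
      then obtain P where "P \<in> set S" "y \<in> set (tl P)" using y by (auto simp: vlist_def)
      then show ?thesis using len by (auto simp: in_set_conv_nth[of P S])
    qed simp
  qed
  then have "card (set (vlist S)) \<le> card (insert (centre S) (\<Union>i<s. set (tl (S ! i))))"
    by (intro card_mono) auto
  also have "\<dots> \<le> Suc (card (\<Union>i<s. set (tl (S ! i))))" by (rule card_insert_le_m1) simp_all
  also have "card (\<Union>i<s. set (tl (S ! i))) \<le> (\<Sum>i<s. card (set (tl (S ! i))))" by (intro card_UN_le) simp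
  also have "\<dots> \<le> of_nat (card {..<s}) * L"
  proof (intro sum_bounded_above)
    fix i assume "i \<in> {..<s}"
    then have "length (tl (S ! i)) = lg i" "lg i \<le> L" using S s lg by (auto simp: spiders_iff)
    then show "card (set (tl (S ! i))) \<le> L" using card_length[of "tl (S ! i)"] by simp
  qed
  finally show ?thesis by simp
qed

text \<open>There are five reasons for failure: some spider with a leg shortened by one vertex is
  not good, some leg is not a good path, two single-edge legs form a bad path, a vertex repeats, or
  the ends are saturated. The first costs at most \<open>s\<close> times the bound of the previous
  level. The others cost at most \<open>s\<close>, \<open>s * s\<close> times
  \<open>\<gamma>\<close> and \<open>\<epsilon>\<close> twice. Since
  \<open>s * b + 1 \<le> (s + 1) * b\<close> for \<open>b \<ge> 1\<close>, the growth factor per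
  level is \<open>s + 1\<close>.\<close>

lemma mass_good_spiders:
  fixes \<epsilon> \<gamma> :: real
  assumes s: "s > 0" and Q: "\<And>v. v \<in> V \<Longrightarrow> deg v \<ge> Q" and Qe: "real (Suc (s * L)) \<le> \<epsilon> * Q" "Q > 0" "\<epsilon> \<ge> 0"
    and path: "\<And>h. h \<le> L \<Longrightarrow> sum wt (walks h - good_paths K h) \<le> \<gamma> * (\<Sum>v\<in>A. deg v)" and L: "L \<ge> 2"
    and sat: "\<And>m lg. (\<Sum>i<s. lg i) = Suc m \<Longrightarrow> (\<And>i. i < s \<Longrightarrow> lg i \<le> L) \<Longrightarrow> testable_shape s lg \<Longrightarrow>
      sum sw (saturated_spiders K s m lg) \<le> \<epsilon> * (\<Sum>v\<in>A. deg v)"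
  shows "(\<Sum>i<s. lg i) = n \<Longrightarrow> (\<And>i. i < s \<Longrightarrow> lg i \<le> L) \<Longrightarrow>
    sum sw (spiders A s lg - good_spiders K s n lg) \<le> (real s * \<gamma> + real (s * s) * \<gamma> + 2 * \<epsilon>) * real ((s + 1) ^ n) * (\<Sum>v\<in>A. deg v)"
proof (induction n arbitrary: lg)
  case 0
  define TA where "TA = (\<Sum>v\<in>A. deg v)"
  have "TA \<ge> 0" unfolding TA_def by (intro sum_nonneg) (simp add: deg_nonneg)
  moreover have "\<gamma> * TA \<ge> 0" using path[of 0] sum_nonneg[of "walks 0 - good_paths K 0" wt] wt_nonneg by (simp add: TA_def)
  ultimately have "(real s * \<gamma> + real (s * s) * \<gamma> + 2 * \<epsilon>) * TA \<ge> 0"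
    using Qe by (simp add: distrib_right mult.assoc)
  then show ?case by (simp add: TA_def)
next
  case (Suc n)
  define TA where "TA = (\<Sum>v\<in>A. deg v)"
  define \<zeta> where "\<zeta> = real s * \<gamma> + real (s * s) * \<gamma> + 2 * \<epsilon>"
  have TA0: "TA \<ge> 0" unfolding TA_def by (intro sum_nonneg) (simp add: deg_nonneg)
  have \<gamma>0: "\<gamma> * TA \<ge> 0" using path[of 0] sum_nonneg[of "walks 0 - good_paths K 0" wt] wt_nonneg by (simp add: TA_def)
  have \<zeta>0: "\<zeta> * TA \<ge> 0" using \<gamma>0 TA0 Qe by (simp add: \<zeta>_def distrib_right mult.assoc)
  have finSP: "finite (spiders A s l)" for l using finite_spiders[OF finA] .
  have "\<exists>i<s. lg i \<ge> 1"
  proof (rule ccontr)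
    assume "\<not> ?thesis"
    then have "lg i = 0" if "i < s" for i using that by (metis One_nat_def Suc_leI neq0_conv)
    then have "(\<Sum>i<s. lg i) = 0" by simp
    then show False using Suc.prems(1) by simp
  qed
  \<comment> \<open>One nontrivial leg is enough to detect repetitions: if the spider with this leg
    shortened has distinct vertices, only the last vertex of the leg can repeat.\<close>
  then obtain i0 where i0: "i0 < s" "lg i0 \<ge> 1" by blast
  let ?lb = "\<lambda>i. lg(i := lg i - 1)"
  let ?b = "\<lambda>S i. S[i := butlast (S ! i)]"
  let ?C1 = "\<lambda>i. {S\<in>spiders A s lg. ?b S i \<in> spiders A s (?lb i) - good_spiders K s n (?lb i)}"
  let ?C2 = "\<lambda>i. {S\<in>spiders A s lg. S ! i \<notin> good_paths K (lg i)}"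
  let ?C3 = "\<lambda>p. {S\<in>spiders A s lg. [last (S ! fst p), centre S, last (S ! snd p)] \<notin> good_paths K 2}"
  let ?C4 = "{S\<in>spiders A s lg. ?b S i0 \<in> good_spiders K s n (?lb i0) \<and> last (S ! i0) \<in> set (vlist (?b S i0))}"
  let ?C5 = "if testable_shape s lg then saturated_spiders K s n lg else {}"
  let ?I1 = "{i. i < s \<and> lg i \<ge> 1}"
  let ?I3 = "{p\<in>{..<s} \<times> {..<s}. fst p \<noteq> snd p \<and> lg (fst p) = 1 \<and> lg (snd p) = 1}"
  have lb: "(?lb i)(i := Suc (?lb i i)) = lg" "(\<Sum>j<s. ?lb i j) = n" if "i < s" "lg i \<ge> 1" for i
  proof -
    show "(?lb i)(i := Suc (?lb i i)) = lg" using that by auto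
    show "(\<Sum>j<s. ?lb i j) = n" using sum_update[OF that(1), of lg "lg i - 1"] Suc.prems(1) that by linarith
  qed
  have bSP: "?b S i \<in> spiders A s (?lb i)" if "S \<in> spiders A s lg" "i < s" "lg i \<ge> 1" for S i
    using that by (intro spiders_butlast[OF s]) auto
  have cover: "spiders A s lg - good_spiders K s (Suc n) lg \<subseteq>
      ((\<Union>i\<in>?I1. ?C1 i) \<union> (\<Union>i<s. ?C2 i)) \<union> ((\<Union>p\<in>?I3. ?C3 p) \<union> (?C4 \<union> ?C5))"
  proof
    fix S assume S: "S \<in> spiders A s lg - good_spiders K s (Suc n) lg"
    show "S \<in> ((\<Union>i\<in>?I1. ?C1 i) \<union> (\<Union>i<s. ?C2 i)) \<union> ((\<Union>p\<in>?I3. ?C3 p) \<union> (?C4 \<union> ?C5))"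
    proof (rule ccontr)
      assume no: "\<not> ?thesis"
      have 1: "?b S i \<in> good_spiders K s n (?lb i)" if "i < s" "lg i \<ge> 1" for i
        using no S bSP[of S i] that by auto
      have 2: "S ! i \<in> good_paths K (lg i)" if "i < s" for i using no S that by auto
      have 3: "[last (S ! i), centre S, last (S ! j)] \<in> good_paths K 2"
        if "i < s" "j < s" "i \<noteq> j" "lg i = 1" "lg j = 1" for i j
      proof (rule ccontr)
        assume "\<not> ?thesis"
        then have "S \<in> ?C3 (i, j)" using S by simp
        moreover have "(i, j) \<in> ?I3" using that by simp
        ultimately show False using no by blast
      qed
      have 4: "last (S ! i0) \<notin> set (vlist (?b S i0))" using no S 1[OF i0] by auto
      have len: "length S = s" "length (S ! i0) = Suc (lg i0)" "hd (S ! i0) = centre S"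
        using S s i0 by (auto simp: spiders_iff)
      have bl: "butlast (S ! i0) \<noteq> []" "S ! i0 \<noteq> []" using len i0 by (cases "S ! i0"; auto)+
      have hb: "hd (butlast (S ! i0)) = centre S" using bl len by (cases "S ! i0") auto
      have db: "distinct (vlist (?b S i0))" using good_spiders_distinct[OF s 1[OF i0] lb(2)[OF i0]] .
      have "mset (vlist ((?b S i0)[i0 := S ! i0])) + mset (tl (?b S i0 ! i0)) =
          mset (vlist (?b S i0)) + mset (tl (S ! i0))"
        using len i0 hb by (intro mset_vlist_update) (auto simp: centre_update)
      moreover have "tl (S ! i0) = tl (butlast (S ! i0)) @ [last (S ! i0)]"
        using bl by (metis append_butlast_last_id tl_append2)
      ultimately have "mset (vlist S) = mset (vlist (?b S i0) @ [last (S ! i0)])" using len i0 by simp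
      then have "distinct (vlist S) \<longleftrightarrow> distinct (vlist (?b S i0) @ [last (S ! i0)])"
        by (rule mset_eq_imp_distinct_iff)
      then have dS: "distinct (vlist S)" using db 4 by simp
      have "S \<in> adm_spiders K s (good_spiders K s n) lg" using S dS 1 2 3 by (auto simp: adm_spiders_def)
      moreover have "S \<notin> ?C5" using no by blast
      ultimately have "S \<in> good_spiders K s (Suc n) lg" by (auto simp: saturated_spiders_def split: if_splits)
      then show False using S by blast
    qed
  qed
  have fins: "finite (\<Union>i\<in>?I1. ?C1 i)" "finite (\<Union>i<s. ?C2 i)" "finite (\<Union>p\<in>?I3. ?C3 p)" "finite ?C4" "finite ?C5"
    using finSP by (auto simp: saturated_spiders_def adm_spiders_def)
  have un: "sum sw (X \<union> Y) \<le> sum sw X + sum sw Y" if "finite X" "finite Y" for X Y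
  proof -
    have "sum sw (X \<inter> Y) \<ge> 0" using sw_nonneg by (intro sum_nonneg)
    then show ?thesis using sum_Un[OF that, of sw] by linarith
  qed
  have m1: "sum sw (\<Union>i\<in>?I1. ?C1 i) \<le> real s * (\<zeta> * real ((s + 1) ^ n) * TA)"
  proof -
    have nn: "\<zeta> * real ((s + 1) ^ n) * TA \<ge> 0" 
    proof -
      have "0 \<le> (\<zeta> * TA) * real ((s + 1) ^ n)" by (rule mult_nonneg_nonneg[OF \<zeta>0]) simp
      then show ?thesis by (simp add: mult_ac)
    qed
    have "sum sw (\<Union>i\<in>?I1. ?C1 i) \<le> (\<Sum>i\<in>?I1. sum sw (?C1 i))"
      using finSP by (intro sum_over_union_le) (auto simp: sw_nonneg)
    also have "\<dots> \<le> real (card ?I1) * (\<zeta> * real ((s + 1) ^ n) * TA)"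
    proof (intro sum_bounded_above)
      fix i assume i: "i \<in> ?I1"
      then have i': "i < s" "lg i \<ge> 1" by auto
      have "sum sw {S\<in>spiders A s ((?lb i)(i := Suc (?lb i i))). ?b S i \<in> spiders A s (?lb i) - good_spiders K s n (?lb i)} =
          sum sw (spiders A s (?lb i) - good_spiders K s n (?lb i))"
        using i' by (intro sum_sw_butlast[OF s A_sub]) auto
      then have "sum sw (?C1 i) = sum sw (spiders A s (?lb i) - good_spiders K s n (?lb i))" unfolding lb(1)[OF i'] .
      also have "\<dots> \<le> (real s * \<gamma> + real (s * s) * \<gamma> + 2 * \<epsilon>) * real ((s + 1) ^ n) * (\<Sum>v\<in>A. deg v)"
      proof -
        have le: "?lb i j \<le> L" if "j < s" for j using Suc.prems(2)[OF that] by auto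
        show ?thesis using Suc.IH[of "?lb i", OF lb(2)[OF i'] le] .
      qed
      finally show "sum sw (?C1 i) \<le> \<zeta> * real ((s + 1) ^ n) * TA" by (simp only: \<zeta>_def TA_def)
    qed
    also have "\<dots> \<le> real s * (\<zeta> * real ((s + 1) ^ n) * TA)"
    proof (intro mult_right_mono nn)
      have "card ?I1 \<le> card {..<s}" by (intro card_mono) auto
      then show "real (card ?I1) \<le> real s" by simp
    qed
    finally show ?thesis .
  qed
  have m2: "sum sw (\<Union>i<s. ?C2 i) \<le> real s * (\<gamma> * TA)"
  proof -
    have "sum sw (\<Union>i<s. ?C2 i) \<le> (\<Sum>i<s. sum sw (?C2 i))"
      using finSP by (intro sum_over_union_le) (auto simp: sw_nonneg)
    also have "\<dots> \<le> real (card {..<s}) * (\<gamma> * TA)"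
    proof (intro sum_bounded_above)
      fix i assume "i \<in> {..<s}"
      then show "sum sw (?C2 i) \<le> \<gamma> * TA"
        using mass_bad_leg[OF s, of i lg K] path[of "lg i"] Suc.prems(2)[of i] by (simp add: TA_def)
    qed
    finally show ?thesis by simp
  qed
  have m3: "sum sw (\<Union>p\<in>?I3. ?C3 p) \<le> real (s * s) * (\<gamma> * TA)"
  proof -
    have fI: "finite ?I3" by simp
    have "sum sw (\<Union>p\<in>?I3. ?C3 p) \<le> (\<Sum>p\<in>?I3. sum sw (?C3 p))"
      using finSP fI by (intro sum_over_union_le) (auto simp: sw_nonneg)
    also have "\<dots> \<le> real (card ?I3) * (\<gamma> * TA)"
    proof (intro sum_bounded_above)
      fix p assume "p \<in> ?I3"
      then have "fst p < s" "snd p < s" "fst p \<noteq> snd p" "lg (fst p) = 1" "lg (snd p) = 1" by auto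
      from mass_bad_pair[OF this, of K] show "sum sw (?C3 p) \<le> \<gamma> * TA"
        using path[OF L] unfolding TA_def by (rule order_trans)
    qed
    also have "\<dots> \<le> real (s * s) * (\<gamma> * TA)"
    proof (intro mult_right_mono \<gamma>0)
      have "card ?I3 \<le> card ({..<s} \<times> {..<s})" by (intro card_mono) auto
      then have "card ?I3 \<le> s * s" by (simp add: card_cartesian_product)
      then show "real (card ?I3) \<le> real (s * s)" by (simp only: of_nat_le_iff)
    qed
    finally show ?thesis .
  qed
  have m4: "sum sw ?C4 \<le> \<epsilon> * TA"
  proof -
    let ?X = "good_spiders K s n (?lb i0)"
    let ?R = "\<lambda>S. last (S ! i0) \<in> set (vlist (?b S i0))"
    have XSP: "?X \<subseteq> spiders A s (?lb i0)" by (rule good_spiders_spiders)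
    have "sum sw {S\<in>spiders A s ((?lb i0)(i0 := Suc (?lb i0 i0))). ?b S i0 \<in> ?X \<and> ?R S} =
        (\<Sum>S\<in>?X. sw S * real (card {x\<in>N (last (S ! i0)). ?R (S[i0 := S ! i0 @ [x]])}) / deg (last (S ! i0)))"
      by (rule sum_sw_snoc[OF s A_sub XSP i0(1)])
    then have "sum sw ?C4 = (\<Sum>S\<in>?X. sw S * real (card {x\<in>N (last (S ! i0)). ?R (S[i0 := S ! i0 @ [x]])}) / deg (last (S ! i0)))"
      unfolding lb(1)[OF i0] .
    also have "\<dots> \<le> (\<Sum>S\<in>?X. sw S * \<epsilon>)"
    proof (intro sum_mono)
      fix S assume "S \<in> ?X"
      then have S: "S \<in> spiders A s (?lb i0)" using XSP by blast
      then have Sl: "length S = s" "walk (S ! i0)" using s i0 by (auto simp: spiders_iff)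
      have dg: "deg (last (S ! i0)) \<ge> Q" using Q walk_hd_last Sl by blast
      have "{x\<in>N (last (S ! i0)). ?R (S[i0 := S ! i0 @ [x]])} \<subseteq> set (vlist S)" using Sl i0 by auto
      then have "card {x\<in>N (last (S ! i0)). ?R (S[i0 := S ! i0 @ [x]])} \<le> card (set (vlist S))"
        by (intro card_mono) auto
      also have "\<dots> \<le> Suc (s * L)"
      proof (rule card_vlist[OF s S])
        show "?lb i0 j \<le> L" if "j < s" for j using Suc.prems(2)[OF that] by auto
      qed
      finally have "real (card {x\<in>N (last (S ! i0)). ?R (S[i0 := S ! i0 @ [x]])}) \<le> real (Suc (s * L))"
        by (simp only: of_nat_le_iff)
      also have "\<dots> \<le> \<epsilon> * deg (last (S ! i0))" using Qe dg by (meson mult_left_mono order_trans)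
      finally have "sw S * (real (card {x\<in>N (last (S ! i0)). ?R (S[i0 := S ! i0 @ [x]])}) / deg (last (S ! i0))) \<le> sw S * \<epsilon>"
        using dg Qe by (intro mult_left_mono sw_nonneg) (auto simp: divide_simps)
      then show "sw S * real (card {x\<in>N (last (S ! i0)). ?R (S[i0 := S ! i0 @ [x]])}) / deg (last (S ! i0)) \<le> sw S * \<epsilon>"
        by simp
    qed
    also have "\<dots> = \<epsilon> * sum sw ?X" by (simp add: sum_distrib_left mult.commute)
    also have "\<dots> \<le> \<epsilon> * TA"
      unfolding TA_def sum_sw_spiders[OF s A_sub, symmetric, of "?lb i0"]
      using Qe XSP finSP sw_nonneg by (intro mult_left_mono sum_mono2) auto
    finally show ?thesis .
  qed
  have m5: "sum sw ?C5 \<le> \<epsilon> * TA"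
    using sat[OF Suc.prems(1,2)] Qe TA0 by (auto simp: TA_def)
  have "sum sw (spiders A s lg - good_spiders K s (Suc n) lg) \<le>
      sum sw (((\<Union>i\<in>?I1. ?C1 i) \<union> (\<Union>i<s. ?C2 i)) \<union> ((\<Union>p\<in>?I3. ?C3 p) \<union> (?C4 \<union> ?C5)))"
    using cover fins sw_nonneg by (intro sum_mono2 finite_UnI)
  also have "\<dots> \<le> (sum sw (\<Union>i\<in>?I1. ?C1 i) + sum sw (\<Union>i<s. ?C2 i)) + (sum sw (\<Union>p\<in>?I3. ?C3 p) + (sum sw ?C4 + sum sw ?C5))"
    by (intro order_trans[OF un] add_mono un fins finite_UnI order_refl)
  also have "\<dots> \<le> (real s * (\<zeta> * real ((s + 1) ^ n) * TA) + real s * (\<gamma> * TA)) + (real (s * s) * (\<gamma> * TA) + (\<epsilon> * TA + \<epsilon> * TA))"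
    by (intro add_mono m1 m2 m3 m4 m5)
  also have "\<dots> = real s * (\<zeta> * real ((s + 1) ^ n) * TA) + \<zeta> * TA" by (simp add: \<zeta>_def algebra_simps)
  also have "\<dots> \<le> real s * (\<zeta> * real ((s + 1) ^ n) * TA) + \<zeta> * real ((s + 1) ^ n) * TA"
  proof -
    have "(1::real) \<le> real ((s + 1) ^ n)" by simp
    then have "\<zeta> * TA * 1 \<le> \<zeta> * TA * real ((s + 1) ^ n)" using \<zeta>0 by (intro mult_left_mono)
    then show ?thesis by (simp add: mult_ac)
  qed
  also have "\<dots> = \<zeta> * real ((s + 1) ^ Suc n) * TA" by (simp add: algebra_simps)
  finally show ?case by (simp only: \<zeta>_def TA_def)
qed

end

section \<open>Subdivisions from saturated spiders\<close>

lemma concat_if: "concat (map (\<lambda>i. if p i then [u i] else []) xs) = map u (filter p xs)"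
  by (induction xs) auto

lemma mset_concat_append:
  "mset (concat (map (\<lambda>i. f i @ g i) xs)) = mset (concat (map f xs)) + mset (concat (map g xs))"
  by (induction xs) auto

context bip_graph
begin

text \<open>The \<open>s\<close> branch vertices of one side are fixed beforehand as common ends,
  and each of \<open>t\<close> greedily chosen spiders contributes its centre as a branch vertex of
  the other side. A spider has one leg to each end, hence one path for each edge. Since
  \<open>L \<ge> 1\<close>, every end lies in the proper part of a leg, which keeps the centres away
  from the ends.\<close>

lemma has_thetaI_spiders:
  assumes s: "s > 0" and L: "L \<ge> 1" and uV: "u ` {..<s} \<subseteq> V" and t: "t > 0" and M: "t * Suc (s * L) \<le> M"
    and link: "\<And>F. finite F \<Longrightarrow> card F \<le> M \<Longrightarrow> F \<inter> u ` {..<s} = {} \<Longrightarrow>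
      \<exists>T\<in>spiders A s (\<lambda>_. L). distinct (vlist T) \<and> (\<forall>i<s. last (T ! i) = u i) \<and> set (vlist T) \<inter> F = {}"
  shows "has_theta s t 1 L"
proof -
  let ?U = "u ` {..<s}"
  let ?good = "\<lambda>T. T \<in> spiders A s (\<lambda>_. L) \<and> distinct (vlist T) \<and> (\<forall>i<s. last (T ! i) = u i)"
  have "t' \<le> t \<Longrightarrow> \<exists>Ts. (\<forall>a<t'. ?good (Ts a)) \<and>
      (\<forall>a<t'. \<forall>b<t'. a \<noteq> b \<longrightarrow> set (vlist (Ts a)) \<inter> set (vlist (Ts b)) \<subseteq> ?U)" for t'
  proof (induction t')
    case 0
    then show ?case by simp
  next
    case (Suc t')
    then obtain Ts where Ts: "\<forall>a<t'. ?good (Ts a)"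
      "\<forall>a<t'. \<forall>b<t'. a \<noteq> b \<longrightarrow> set (vlist (Ts a)) \<inter> set (vlist (Ts b)) \<subseteq> ?U" by auto
    define F where "F = (\<Union>a<t'. set (vlist (Ts a))) - ?U"
    have "card F \<le> card (\<Union>a<t'. set (vlist (Ts a)))" unfolding F_def by (intro card_mono) auto
    also have "\<dots> \<le> (\<Sum>a<t'. card (set (vlist (Ts a))))" by (intro card_UN_le) simp
    also have "\<dots> \<le> of_nat (card {..<t'}) * Suc (s * L)"
      using Ts(1) card_vlist[OF s] by (intro sum_bounded_above) (metis lessThan_iff order_refl)
    also have "\<dots> \<le> t * Suc (s * L)" using Suc.prems by (simp add: mult_le_mono del: mult_Suc_right)
    finally have "card F \<le> M" using M by simp
    moreover have "finite F" "F \<inter> ?U = {}" by (auto simp: F_def)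
    ultimately obtain T where T: "?good T" "set (vlist T) \<inter> F = {}" using link[of F] by auto
    have TU: "set (vlist T) \<inter> set (vlist (Ts a)) \<subseteq> ?U" if "a < t'" for a
      using T(2) that unfolding F_def by blast
    let ?Ts = "Ts(t' := T)"
    have "\<forall>a<Suc t'. ?good (?Ts a)" using Ts(1) T(1) by (simp add: less_Suc_eq)
    moreover have "\<forall>a<Suc t'. \<forall>b<Suc t'. a \<noteq> b \<longrightarrow> set (vlist (?Ts a)) \<inter> set (vlist (?Ts b)) \<subseteq> ?U"
    proof (intro allI impI)
      fix a b assume ab: "a < Suc t'" "b < Suc t'" "a \<noteq> b"
      consider "a = t'" "b < t'" | "b = t'" "a < t'" | "a < t'" "b < t'" using ab by linarith
      then show "set (vlist (?Ts a)) \<inter> set (vlist (?Ts b)) \<subseteq> ?U"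
      proof cases
        case 1
        then show ?thesis using TU[of b] by simp
      next
        case 2
        then show ?thesis using TU[of a] by (simp add: Int_commute)
      next
        case 3
        then show ?thesis using Ts(2) ab(3) by simp
      qed
    qed
    ultimately show ?case by blast
  qed
  from this[OF order_refl] obtain Ts where Ts0: "\<forall>a<t. ?good (Ts a)"
    "\<forall>a<t. \<forall>b<t. a \<noteq> b \<longrightarrow> set (vlist (Ts a)) \<inter> set (vlist (Ts b)) \<subseteq> ?U" by blast
  have Ts: "\<And>a. a < t \<Longrightarrow> ?good (Ts a)"
    "\<And>a b. a < t \<Longrightarrow> b < t \<Longrightarrow> a \<noteq> b \<Longrightarrow> set (vlist (Ts a)) \<inter> set (vlist (Ts b)) \<subseteq> ?U"
    using Ts0 by simp_all
  have leg: "walk (Ts a ! i)" "hd (Ts a ! i) = centre (Ts a)" "length (Ts a ! i) = Suc L" "last (Ts a ! i) = u i"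
    "distinct (Ts a ! i)" "set (Ts a ! i) \<subseteq> set (vlist (Ts a))" "u i \<in> set (tl (Ts a ! i))" "Ts a ! i \<noteq> []"
    if "a < t" "i < s" for a i
  proof -
    have T: "Ts a \<in> spiders A s (\<lambda>_. L)" "distinct (vlist (Ts a))" "last (Ts a ! i) = u i" using Ts(1) that by auto
    show l: "walk (Ts a ! i)" "hd (Ts a ! i) = centre (Ts a)" "length (Ts a ! i) = Suc L" "last (Ts a ! i) = u i"
      using T s that by (auto simp: spiders_iff)
    show "distinct (Ts a ! i)" using distinct_leg[OF T(1,2) that(2)] .
    show "set (Ts a ! i) \<subseteq> set (vlist (Ts a))" using set_leg_subset_vlist[OF T(1) that(2)] .
    show ne: "Ts a ! i \<noteq> []" using l by auto
    have "tl (Ts a ! i) \<noteq> []" using l(3) L by (cases "Ts a ! i") auto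
    then have "last (tl (Ts a ! i)) = u i" using l(4) by (simp add: last_tl)
    then show "u i \<in> set (tl (Ts a ! i))" using \<open>tl (Ts a ! i) \<noteq> []\<close> last_in_set by metis
  qed
  have ctrU: "centre (Ts a) \<notin> ?U" if a: "a < t" for a
  proof
    assume "centre (Ts a) \<in> ?U"
    then obtain i where i: "i < s" "centre (Ts a) = u i" by auto
    have "Ts a ! i \<in> set (Ts a)" using Ts(1)[OF a] i by (auto simp: spiders_def)
    then have "u i \<in> set (concat (map tl (Ts a)))" using leg(7)[OF a i(1)] by auto
    then show False using Ts(1)[OF a] i(2) by (auto simp: vlist_def)
  qed
  have ctrin: "centre (Ts a) \<in> set (vlist (Ts a))" for a by (simp add: vlist_def)
  have meet: "set (Ts a ! i) \<inter> set (Ts a ! j) \<subseteq> {centre (Ts a)}" if "a < t" "i < s" "j < s" "i \<noteq> j" for a i j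
  proof
    fix y assume y: "y \<in> set (Ts a ! i) \<inter> set (Ts a ! j)"
    have T: "Ts a \<in> spiders A s (\<lambda>_. L)" "distinct (vlist (Ts a))" using Ts(1) that by auto
    have "y \<notin> set (tl (Ts a ! i))" using distinct_legs[OF T that(2,3,4), of y] y by auto
    then have "y = hd (Ts a ! i)" using y leg(8)[OF that(1,2)] by (cases "Ts a ! i") auto
    then show "y \<in> {centre (Ts a)}" using leg(2)[OF that(1,2)] by simp
  qed
  have uonly: "i' = i" if a: "a < t" "i < s" "i' < s" "u i' \<in> set (Ts a ! i)" for a i i'
  proof (rule ccontr)
    assume "i' \<noteq> i"
    have T: "Ts a \<in> spiders A s (\<lambda>_. L)" "distinct (vlist (Ts a))" using Ts(1) a by auto
    show False using distinct_legs[OF T a(3,2) \<open>i' \<noteq> i\<close> leg(7)[OF a(1,3)]] a(4) by simp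
  qed
  define \<phi> where "\<phi> i = (if i < s then u i else centre (Ts (i - s)))" for i
  \<comment> \<open>Legs run from the centre to the common ends, whereas the paths of
    \<open>has_theta\<close> start on the side of size \<open>s\<close>; hence the reversal.\<close>
  define P where "P x = rev (Ts (fst (snd x) - s) ! fst x)" for x :: "nat \<times> nat \<times> nat"
  have U\<phi>: "?U \<subseteq> \<phi> ` {..<s + t}" by (auto simp: \<phi>_def)
  have inj\<phi>: "inj_on \<phi> {..<s + t}"
  proof (rule inj_onI)
    fix a b assume ab: "a \<in> {..<s + t}" "b \<in> {..<s + t}" "\<phi> a = \<phi> b"
    consider "a < s" "b < s" | "a \<ge> s" "b \<ge> s" | "a < s" "b \<ge> s" | "a \<ge> s" "b < s" by linarith
    then show "a = b"
    proof cases
      case 1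
      then have "u a \<in> set (Ts 0 ! b)" using ab(3) leg(4,8)[OF t 1(2)] by (metis \<phi>_def last_in_set)
      then show ?thesis using uonly[OF t 1(2,1)] by simp
    next
      case 2
      show ?thesis
      proof (rule ccontr)
        assume "a \<noteq> b"
        then have ne: "a - s \<noteq> b - s" "a - s < t" "b - s < t" using 2 ab by auto
        have "centre (Ts (a - s)) = centre (Ts (b - s))" using ab(3) 2 by (simp add: \<phi>_def)
        then have "centre (Ts (a - s)) \<in> set (vlist (Ts (a - s))) \<inter> set (vlist (Ts (b - s)))"
          using ctrin by (metis IntI)
        then show False using Ts(2)[OF ne(2,3,1)] ctrU[OF ne(2)] by blast
      qed
    next
      case 3
      then have "u a = centre (Ts (b - s))" "b - s < t" using ab by (auto simp: \<phi>_def)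
      moreover have "u a \<in> ?U" using 3 by simp
      ultimately show ?thesis using ctrU[of "b - s"] by metis
    next
      case 4
      then have "u b = centre (Ts (a - s))" "a - s < t" using ab by (auto simp: \<phi>_def)
      moreover have "u b \<in> ?U" using 4 by simp
      ultimately show ?thesis using ctrU[of "a - s"] by metis
    qed
  qed
  have \<phi>V: "\<phi> ` {..<s + t} \<subseteq> V"
  proof
    fix x assume "x \<in> \<phi> ` {..<s + t}"
    then obtain i where i: "x = \<phi> i" "i < s + t" by auto
    show "x \<in> V"
    proof (cases "i < s")
      case True
      then show ?thesis using i uV by (auto simp: \<phi>_def)
    next
      case False
      then have "Ts (i - s) \<in> spiders A s (\<lambda>_. L)" using i Ts(1)[of "i - s"] by simp
      then have "centre (Ts (i - s)) \<in> A" using s by (auto simp: spiders_iff)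
      then show ?thesis using i False A_sub by (auto simp: \<phi>_def)
    qed
  qed
  have paths: "walk (P (i, j, c)) \<and> distinct (P (i, j, c)) \<and> length (P (i, j, c)) = Suc L \<and>
      hd (P (i, j, c)) = \<phi> i \<and> last (P (i, j, c)) = \<phi> j \<and> set (P (i, j, c)) \<inter> \<phi> ` {..<s + t} \<subseteq> {\<phi> i, \<phi> j}"
    if ij: "i < s" "j \<in> {s..<s + t}" for i j c
  proof -
    have jt: "j - s < t" using ij by auto
    note l = leg[OF jt ij(1)]
    have "set (Ts (j - s) ! i) \<inter> \<phi> ` {..<s + t} \<subseteq> {\<phi> i, \<phi> j}"
    proof
      fix y assume "y \<in> set (Ts (j - s) ! i) \<inter> \<phi> ` {..<s + t}"
      then obtain b where y: "y \<in> set (Ts (j - s) ! i)" "b < s + t" "y = \<phi> b" by auto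
      show "y \<in> {\<phi> i, \<phi> j}"
      proof (cases "b < s")
        case True
        then have "u b \<in> set (Ts (j - s) ! i)" using y by (simp add: \<phi>_def)
        then show ?thesis using uonly[OF jt ij(1) True] y(3) by simp
      next
        case False
        then have bt: "b - s < t" "y = centre (Ts (b - s))" using y by (auto simp: \<phi>_def)
        have "b - s = j - s"
        proof (rule ccontr)
          assume ne: "b - s \<noteq> j - s"
          have "y \<in> set (vlist (Ts (b - s))) \<inter> set (vlist (Ts (j - s)))" using bt ctrin y(1) l(6) by auto
          then show False using Ts(2)[OF bt(1) jt ne] ctrU[OF bt(1)] bt(2) by blast
        qed
        then have "b = j" using False ij by auto
        then show ?thesis using y(3) by simp
      qed
    qed
    then show ?thesis using l ij by (auto simp: P_def \<phi>_def walk_rev hd_rev last_rev)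
  qed
  have disj: "set (P x) \<inter> set (P y) \<subseteq> \<phi> ` {..<s + t}"
    if x: "x \<in> {..<s} \<times> {s..<s + t} \<times> {..<1}" and y: "y \<in> {..<s} \<times> {s..<s + t} \<times> {..<1}" and ne: "x \<noteq> y" for x y
  proof -
    obtain i j where x': "x = (i, j, 0)" "i < s" "j \<in> {s..<s + t}" using x by (cases x) auto
    obtain i' j' where y': "y = (i', j', 0)" "i' < s" "j' \<in> {s..<s + t}" using y by (cases y) auto
    have jt: "j - s < t" "j' - s < t" using x' y' by auto
    show ?thesis
    proof (cases "j = j'")
      case True
      then have "i \<noteq> i'" using ne x' y' by auto
      then have "set (P x) \<inter> set (P y) \<subseteq> {centre (Ts (j - s))}"
        using meet[OF jt(1) x'(2) y'(2)] x' y' True by (simp add: P_def)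
      moreover have "centre (Ts (j - s)) = \<phi> j" using x' by (auto simp: \<phi>_def)
      ultimately show ?thesis using x' by auto
    next
      case False
      then have "j - s \<noteq> j' - s" using x' y' by auto
      from Ts(2)[OF jt this] have "set (P x) \<inter> set (P y) \<subseteq> ?U"
        using leg(6)[OF jt(1) x'(2)] leg(6)[OF jt(2) y'(2)] x' y' by (auto simp: P_def)
      then show ?thesis using U\<phi> by blast
    qed
  qed
  show ?thesis unfolding has_theta_def
  proof (rule exI[of _ \<phi>], rule exI[of _ P], intro conjI)
    show "\<forall>i<s. \<forall>j\<in>{s..<s + t}. \<forall>c<1. walk (P (i, j, c)) \<and> distinct (P (i, j, c)) \<and>
        length (P (i, j, c)) = Suc L \<and> hd (P (i, j, c)) = \<phi> i \<and> last (P (i, j, c)) = \<phi> j \<and>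
        set (P (i, j, c)) \<inter> \<phi> ` {..<s + t} \<subseteq> {\<phi> i, \<phi> j}"
      by (intro allI ballI impI paths)
    show "\<forall>x\<in>{..<s} \<times> {s..<s + t} \<times> {..<1}. \<forall>y\<in>{..<s} \<times> {s..<s + t} \<times> {..<1}.
        x \<noteq> y \<longrightarrow> set (P x) \<inter> set (P y) \<subseteq> \<phi> ` {..<s + t}"
      by (intro ballI impI disj)
  qed (rule inj\<phi>, rule \<phi>V)
qed

text \<open>One surviving spider \<open>S0\<close> determines the common ends: the end of leg
  \<open>i\<close> if \<open>L - lg i\<close> is even, and its penultimate vertex if it is odd.
  Given \<open>F\<close>, the odd legs receive fresh ends, all legs are lengthened by even amounts
  while the chosen penultimate vertices are avoided, and these vertices are finally appended to the
  odd legs, which then have length \<open>L\<close> as well.\<close>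

lemma saturated_spiders_imp_has_theta:
  assumes s: "s > 0" and t: "t > 0" and testable_shape: "testable_shape s lg" and lgL: "\<And>i. i < s \<Longrightarrow> lg i \<le> L" and L: "even L"
    and big: "sum sw (saturated_spiders K s n lg) \<ge> \<epsilon> * (\<Sum>v\<in>A. deg v)" and TA: "(\<Sum>v\<in>A. deg v) > 0"
    and eps: "\<epsilon> > 0" and Q: "\<And>v. v \<in> V \<Longrightarrow> deg v \<ge> Q"
    and K: "t * Suc (s * L) + s + 2 * (s * L) \<le> K" and QK: "\<epsilon> / real (4 * s) * Q > real (K + s)"
  shows "has_theta s t 1 L"
proof -
  define Ad where "Ad = adm_spiders K s (good_spiders K s n) lg"
  define E where "E = saturated_spiders K s n lg"
  have lg1: "lg i \<ge> 1" if "i < s" for i using testable_shape that by (simp add: testable_shape_def)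
  have L1: "L \<ge> 1" using lg1[OF s] lgL[OF s] by simp
  have EA: "E \<subseteq> Ad" by (auto simp: E_def Ad_def saturated_spiders_def)
  have ESP: "E \<subseteq> spiders A s lg" using EA by (auto simp: Ad_def adm_spiders_def)
  have sat: "4 * sum sw {S'\<in>E. map last S' = map last S \<and> set (vlist S') \<inter> Y \<noteq> {}}
        \<le> sum sw {S'\<in>E. map last S' = map last S}"
    if SY: "S \<in> E" "finite Y" "card Y \<le> K" "Y \<inter> set (map last S) = {}" for S Y
  proof -
    have ss: "spider_saturated K Ad (map last S)" using SY by (simp add: E_def saturated_spiders_def Ad_def)
    have cls: "{S'\<in>E. map last S' = map last S} = spider_class Ad (map last S)"
      using ss EA unfolding spider_class_def E_def saturated_spiders_def Ad_def by auto
    have "{S'\<in>E. map last S' = map last S \<and> set (vlist S') \<inter> Y \<noteq> {}} =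
        {S'\<in>spider_class Ad (map last S). set (vlist S') \<inter> Y \<noteq> {}}" unfolding cls[symmetric] by auto
    then show ?thesis unfolding cls using ss SY(2-4) unfolding spider_saturated_def by simp
  qed
  have big': "sum sw E \<ge> \<epsilon> * (\<Sum>v\<in>A. deg v)" using big by (simp add: E_def)
  obtain E' where E': "E' \<subseteq> E" "sum sw E' \<ge> \<epsilon> / 4 * (\<Sum>v\<in>A. deg v)"
    and alt: "\<And>S i. S \<in> E' \<Longrightarrow> i < s \<Longrightarrow> lg i \<ge> 1 \<Longrightarrow> card {x. S[i := butlast (S ! i) @ [x]] \<in> E'} > K + s"
    and avoid: "\<And>S F. S \<in> E' \<Longrightarrow> finite F \<Longrightarrow> card F \<le> K \<Longrightarrow> F \<inter> set (map last S) = {} \<Longrightarrow>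
      \<exists>S'\<in>E'. map last S' = map last S \<and> set (vlist S') \<inter> F = {}"
    by (rule prune_spiders[of s A E lg K \<epsilon> Q, OF s A_sub ESP sat eps big' Q QK]) blast+
  have E'SP: "E' \<subseteq> spiders A s lg" using E'(1) ESP by blast
  have nd: "distinct (vlist S)" if "S \<in> E'" for S using that E'(1) EA by (auto simp: Ad_def adm_spiders_def)
  have leg: "length S = s" "walk (S ! i)" "hd (S ! i) = centre S" "length (S ! i) = Suc (lg i)"
    "butlast (S ! i) \<noteq> []" "S ! i \<noteq> []" "butlast (S ! i) @ [last (S ! i)] = S ! i"
    if S: "S \<in> E'" and i: "i < s" for S i
  proof -
    have SS: "S \<in> spiders A s lg" using S E'SP by blast
    then show l: "length S = s" "walk (S ! i)" "hd (S ! i) = centre S" "length (S ! i) = Suc (lg i)"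
      using s i by (auto simp: spiders_iff)
    show "butlast (S ! i) \<noteq> []" "S ! i \<noteq> []" using l(4) lg1[OF i] by (cases "S ! i"; auto)+
    then show "butlast (S ! i) @ [last (S ! i)] = S ! i" by simp
  qed
  have last_tl_in: "last (S ! i) \<in> set (tl (S ! i))" if "S \<in> E'" "i < s" for S i
    using leg(4-6)[OF that] lg1[OF that(2)] by (cases "S ! i") (auto split: if_splits)
  have pen_in: "last (butlast (S ! i)) \<in> set (S ! i)" if "S \<in> E'" "i < s" for S i
    using leg(5)[OF that] by (meson in_set_butlastD last_in_set)
  have pen_tl: "last (butlast (S ! i)) \<in> set (tl (S ! i))" if a: "S \<in> E'" "i < s" "lg i \<noteq> 1" for S i
  proof -
    obtain b T where T: "S ! i = b # T" using leg(6)[OF a(1,2)] by (cases "S ! i") auto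
    then have "length T = lg i" using leg(4)[OF a(1,2)] by simp
    then have "T \<noteq> []" "butlast T \<noteq> []" using lg1[OF a(2)] a(3) by (cases T; auto)+
    then show ?thesis using T by (auto dest: in_set_butlastD last_in_set)
  qed
  have pen: "last (butlast (S ! i)) \<notin> set (map last S)" if S: "S \<in> E'" and i: "i < s" for S i
  proof
    assume "last (butlast (S ! i)) \<in> set (map last S)"
    then obtain j where j: "j < s" "last (butlast (S ! i)) = last (S ! j)"
      using leg(1)[OF S i] by (auto simp: in_set_conv_nth)
    have SS: "S \<in> spiders A s lg" using S E'SP by blast
    show False
    proof (cases "j = i")
      case True
      have "distinct (butlast (S ! i) @ [last (S ! i)])"
        using distinct_leg[OF SS nd[OF S] i] leg(7)[OF S i] by simp
      then show False using j True leg(5)[OF S i] by (metis disjoint_insert(2) distinct_append last_in_set list.simps(15))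
    next
      case False
      then show False using distinct_legs[OF SS nd[OF S] j(1) i False last_tl_in[OF S j(1)]] pen_in[OF S i] j(2) by simp
    qed
  qed
  have "E' \<noteq> {}"
  proof
    assume "E' = {}"
    moreover have "\<epsilon> / 4 * (\<Sum>v\<in>A. deg v) > 0" using eps TA by simp
    ultimately show False using E'(2) by simp
  qed
  then obtain S0 where S0: "S0 \<in> E'" by blast
  have S0SP: "S0 \<in> spiders A s lg" using S0 E'SP by blast
  define od where "od i = odd (L - lg i)" for i
  define u where "u i = (if od i then last (butlast (S0 ! i)) else last (S0 ! i))" for i
  have u_in: "u i \<in> set (S0 ! i)" if "i < s" for i
    using pen_in[OF S0 that] leg(6)[OF S0 that] by (simp add: u_def)
  have u_tl: "u i \<in> set (tl (S0 ! i))" if "i < s" "lg i \<noteq> 1" for i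
    using pen_tl[OF S0 that] last_tl_in[OF S0 that(1)] by (simp add: u_def)
  have uinj: "inj_on u {..<s}"
  proof (rule inj_onI, rule ccontr)
    fix i j assume ij: "i \<in> {..<s}" "j \<in> {..<s}" "u i = u j" "i \<noteq> j"
    then have ij': "i < s" "j < s" by auto
    \<comment> \<open>The penultimate vertex of a single edge is the centre. By
      \<open>testable_shape\<close> this happens on at most one leg, and a chosen vertex on any
      other leg lies off the centre.\<close>
    have "lg i \<noteq> 1 \<or> lg j \<noteq> 1" using testable_shape ij by (auto simp: testable_shape_def)
    then show False
    proof
      assume "lg i \<noteq> 1"
      then show False using distinct_legs[OF S0SP nd[OF S0] ij' ij(4) u_tl[OF ij'(1)]] u_in[OF ij'(2)] ij(3) by simp
    next
      assume "lg j \<noteq> 1"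
      then show False using distinct_legs[OF S0SP nd[OF S0] ij'(2,1) _ u_tl[OF ij'(2)]] u_in[OF ij'(1)] ij(3,4) by simp
    qed
  qed
  have uV: "u ` {..<s} \<subseteq> V" using u_in leg(2)[OF S0] walk_set by fastforce
  define M where "M = t * Suc (s * L)"
  have KM: "M + s + 2 * (s * L) \<le> K" using K by (simp only: M_def)
  let ?U = "u ` {..<s}"
  have cU: "card ?U \<le> s" using card_image_le[of "{..<s}" u] by simp
  show ?thesis
  proof (rule has_thetaI_spiders[OF s L1 uV t, where M = M])
    show "t * Suc (s * L) \<le> M" by (simp add: M_def)
    fix F :: "'a set" assume F: "finite F" "card F \<le> M" "F \<inter> ?U = {}"
    \<comment> \<open>The odd legs are treated one after the other. Their old ends may lie in
      \<open>F\<close>, which is required to avoid only the chosen vertices, so they are exchanged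
      for ends outside \<open>F\<close> and \<open>?U\<close>.\<close>
    have "j \<le> s \<Longrightarrow> \<exists>S'\<in>E'. \<forall>i<s. (if i < j \<and> od i
        then butlast (S' ! i) = butlast (S0 ! i) \<and> last (S' ! i) \<notin> F \<union> ?U else S' ! i = S0 ! i)" for j
    proof (induction j)
      case 0
      then show ?case using S0 by auto
    next
      case (Suc j)
      then obtain S1 where S1: "S1 \<in> E'" "\<forall>i<s. (if i < j \<and> od i
        then butlast (S1 ! i) = butlast (S0 ! i) \<and> last (S1 ! i) \<notin> F \<union> ?U else S1 ! i = S0 ! i)" by auto
      have js: "j < s" using Suc.prems by simp
      show ?case
      proof (cases "od j")
        case False
        then show ?thesis using S1 by (intro bexI[of _ S1]) (auto simp: less_Suc_eq)
      next
        case True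
        let ?A = "{x. S1[j := butlast (S1 ! j) @ [x]] \<in> E'}"
        have "card (F \<union> ?U) \<le> card F + card ?U" by (rule card_Un_le)
        then have "card (F \<union> ?U) \<le> K + s" using F(2) cU KM by linarith
        then have "\<not> ?A \<subseteq> F \<union> ?U"
          using alt[OF S1(1) js lg1[OF js]] card_mono[of "F \<union> ?U" ?A] F(1) by fastforce
        then obtain x where x: "x \<in> ?A" "x \<notin> F \<union> ?U" by blast
        have S1j: "S1 ! j = S0 ! j" using S1(2) js by simp
        have "length S1 = s" using leg(1)[OF S1(1) js] .
        then have upd: "S1[j := butlast (S1 ! j) @ [x]] ! i = (if i = j then butlast (S0 ! j) @ [x] else S1 ! i)"
          if "i < s" for i using that js S1j by simp
        show ?thesis
        proof (intro bexI[of _ "S1[j := butlast (S1 ! j) @ [x]]"] allI impI)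
          fix i assume i: "i < s"
          show "if i < Suc j \<and> od i then butlast (S1[j := butlast (S1 ! j) @ [x]] ! i) = butlast (S0 ! i) \<and>
              last (S1[j := butlast (S1 ! j) @ [x]] ! i) \<notin> F \<union> ?U
            else S1[j := butlast (S1 ! j) @ [x]] ! i = S0 ! i"
            unfolding upd[OF i] using S1(2)[rule_format, OF i] x(2) True
            by (cases "i = j") (auto simp: less_Suc_eq split: if_splits)
        qed (use x in simp)
      qed
    qed
    from this[of s] obtain S1 where S1: "S1 \<in> E'" and S1i: "\<And>i. i < s \<Longrightarrow> (if od i
        then butlast (S1 ! i) = butlast (S0 ! i) \<and> last (S1 ! i) \<notin> F \<union> ?U else S1 ! i = S0 ! i)" by auto
    \<comment> \<open>The vertices to be appended to the odd legs have to remain free during the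
      lengthening.\<close>
    define F2 where "F2 = F \<union> u ` {i. i < s \<and> od i}"
    define g where "g i = (L - lg i) div 2" for i
    have gs: "(\<Sum>i<s. g i) \<le> s * L"
    proof -
      have "(\<Sum>i<s. g i) \<le> of_nat (card {..<s}) * L" by (intro sum_bounded_above) (simp add: g_def)
      then show ?thesis by simp
    qed
    have cF2: "card F2 + 2 * (\<Sum>i<s. g i) \<le> K"
    proof -
      have "card F2 \<le> card F + card (u ` {i. i < s \<and> od i})" unfolding F2_def by (rule card_Un_le)
      moreover have "card (u ` {i. i < s \<and> od i}) \<le> card ?U" by (intro card_mono) auto
      ultimately show ?thesis using F(2) cU KM gs by linarith
    qed
    have F2d: "F2 \<inter> set (map last S1) = {}"
    proof -
      have "last (S1 ! i) \<notin> F2" if i: "i < s" for i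
      proof (cases "od i")
        case True
        then show ?thesis using S1i[OF i] by (auto simp: F2_def)
      next
        case False
        then have e: "last (S1 ! i) = u i" using S1i[OF i] by (simp add: u_def)
        have "u i \<notin> F" using F(3) i by auto
        moreover have "u i \<notin> u ` {i. i < s \<and> od i}" using uinj False i by (auto dest: inj_onD)
        ultimately show ?thesis using e by (simp add: F2_def)
      qed
      then show ?thesis using leg(1)[OF S1 s] by (auto simp: in_set_conv_nth)
    qed
    have "\<exists>T\<in>spiders A s (\<lambda>i. lg i + 2 * g i). distinct (vlist T) \<and> map last T = map last S1 \<and> set (vlist T) \<inter> F2 = {}"
    proof (rule lengthen_spider[where E = E' and lg = lg and K = K, OF s E'SP nd alt avoid pen S1])
      show "finite F2" using F(1) by (simp add: F2_def)
      show "g i = 0" if "i < s" "lg i = 0" for i using lg1[OF that(1)] that(2) by simp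
    qed (use cF2 F2d in auto)
    then obtain T where T: "T \<in> spiders A s (\<lambda>i. lg i + 2 * g i)" "distinct (vlist T)"
      "map last T = map last S1" "set (vlist T) \<inter> F2 = {}" by blast
    have Tl: "length T = s" "walk (T ! i)" "hd (T ! i) = centre T" "length (T ! i) = Suc (lg i + 2 * g i)"
      "T ! i \<noteq> []" "last (T ! i) = last (S1 ! i)" if "i < s" for i
    proof -
      show 1: "length T = s" "walk (T ! i)" "hd (T ! i) = centre T" "length (T ! i) = Suc (lg i + 2 * g i)"
        using T(1) s that by (auto simp: spiders_iff)
      then show "T ! i \<noteq> []" by auto
      show "last (T ! i) = last (S1 ! i)"
        using arg_cong[OF T(3), of "\<lambda>xs. xs ! i"] 1(1) leg(1)[OF S1 s] that by simp
    qed
    define w where "w i = (if od i then [u i] else [])" for i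
    define T' where "T' = map (\<lambda>i. T ! i @ w i) [0..<s]"
    have T'i: "T' ! i = T ! i @ w i" if "i < s" for i using that by (simp add: T'_def)
    have cT': "centre T' = centre T"
    proof -
      have "centre T' = hd (T' ! 0)" using s by (simp add: centre_def T'_def hd_map)
      then show ?thesis using T'i[OF s] Tl(3,5)[OF s] by simp
    qed
    have walks: "walk (T' ! i) \<and> hd (T' ! i) = centre T \<and> length (T' ! i) = Suc L \<and> last (T' ! i) = u i" if i: "i < s" for i
    proof (cases "od i")
      case True
      \<comment> \<open>Only the end of the leg was exchanged, so \<open>u i\<close> is still its
        penultimate vertex and adjacent to the new end.\<close>
      have "butlast (S1 ! i) = butlast (S0 ! i)" using S1i[OF i] True by simp
      then have "walk (butlast (S0 ! i) @ [last (S1 ! i)])" using leg(2,7)[OF S1 i] by simp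
      then have "last (S1 ! i) \<in> N (u i)"
        using walk_snoc[OF leg(5)[OF S0 i]] True by (simp add: u_def)
      then have "walk (T ! i @ [u i])" using walk_snoc[OF Tl(5)[OF i]] Tl(2,6)[OF i] N_sym by simp
      moreover have "lg i + 2 * g i + 1 = L"
        using True lgL[OF i] unfolding g_def od_def by presburger
      ultimately show ?thesis using Tl[OF i] True by (simp add: T'i[OF i] w_def)
    next
      case False
      have "lg i + 2 * g i = L" using False lgL[OF i] unfolding g_def od_def by presburger
      then show ?thesis using Tl[OF i] False S1i[OF i] by (simp add: T'i[OF i] w_def u_def)
    qed
    have T'SP: "T' \<in> spiders A s (\<lambda>_. L)"
      using walks T(1) s unfolding spiders_iff[OF s] cT' by (simp add: T'_def spiders_iff)
    have mT': "mset (vlist T') = mset (vlist T @ map u (filter od [0..<s]))"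
    proof -
      have "map tl T' = map (\<lambda>i. tl (T ! i) @ w i) [0..<s]"
        using Tl(5) by (auto simp: T'_def)
      moreover have "map tl T = map (\<lambda>i. tl (T ! i)) [0..<s]"
        using Tl(1)[OF s] by (intro nth_equalityI) auto
      ultimately have "mset (concat (map tl T')) = mset (concat (map tl T)) + mset (concat (map w [0..<s]))"
        by (simp only: mset_concat_append)
      moreover have "concat (map w [0..<s]) = map u (filter od [0..<s])" unfolding w_def by (rule concat_if)
      ultimately show ?thesis by (simp add: vlist_def cT')
    qed
    have "distinct (map u (filter od [0..<s]))"
      using uinj by (auto simp: distinct_map intro: inj_on_subset)
    moreover have "set (map u (filter od [0..<s])) = u ` {i. i < s \<and> od i}" by auto
    moreover have "set (vlist T) \<inter> u ` {i. i < s \<and> od i} = {}" "set (vlist T) \<inter> F = {}" using T(4) by (auto simp: F2_def)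
    ultimately have 1: "distinct (vlist T @ map u (filter od [0..<s]))"
      and 2: "set (vlist T @ map u (filter od [0..<s])) \<inter> F = {}"
      using T(2) F(3) by auto
    have "distinct (vlist T')" using 1 mset_eq_imp_distinct_iff[OF mT'] by simp
    moreover have "set (vlist T') \<inter> F = {}" using 2 mset_eq_setD[OF mT'] by simp
    ultimately show "\<exists>T\<in>spiders A s (\<lambda>_. L). distinct (vlist T) \<and> (\<forall>i<s. last (T ! i) = u i) \<and> set (vlist T) \<inter> F = {}"
      using T'SP walks by blast
  qed
qed

end

section \<open>Counting the ends\<close>

context walk_graph
begin

text \<open>Saturated paths of mass \<open>\<epsilon> * total\<close> at any one length would
  already produce the subdivision, so the assumption on saturation in \<open>mass_good_paths\<close>
  holds at all lengths up to \<open>L\<close>.\<close>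

lemma mass_good_paths_of_no_theta:
  assumes no: "\<not> has_theta s t r L" and L: "even L" and st: "s > 0" "t > 0" and tot: "total > 0"
    and eps: "\<epsilon> > 0" and Q: "\<And>v. v \<in> V \<Longrightarrow> deg v \<ge> Q" and K: "s + t + s * t * r * Suc L + 1 + 2 * L \<le> K"
    and q0: "\<epsilon> / 16 * real q0 \<ge> t" "q0 > 0"
    and Qlarge: "\<epsilon> / 16 * Q \<ge> real (Suc L + K + 3 + q0 + s * 2 ^ q0)" and h: "h \<le> L"
  shows "sum wt (walks h - good_paths K h) \<le> 2 ^ Suc L * \<epsilon> * total"
proof -
  have eQ: "\<epsilon> / 16 * Q \<ge> 0" using Qlarge by (meson of_nat_0_le_iff order_trans)
  have Qpos: "Q > 0"
  proof -
    have "0 < real (Suc L + K + 3 + q0 + s * 2 ^ q0)" unfolding of_nat_0_less_iff by simp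
    then have "0 < \<epsilon> / 16 * Q" using Qlarge by linarith
    then show ?thesis using eps by (simp add: zero_less_mult_iff)
  qed
  have parts: "\<epsilon> / 16 * Q \<ge> real (Suc L)" "\<epsilon> / 16 * Q \<ge> real (K + 3)" "\<epsilon> / 16 * Q \<ge> real q0" "\<epsilon> / 16 * Q \<ge> real (s * 2 ^ q0)"
    using Qlarge by (smt (verit) of_nat_add of_nat_0_le_iff)+
  have "sum wt (walks h - good_paths K h) \<le> (2 ^ Suc h - 2) * \<epsilon> * total"
  proof (rule mass_good_paths[of Q L \<epsilon> K h])
    show "real (Suc L) \<le> \<epsilon> * Q" using parts(1) eQ by simp
    show "sum wt (saturated_paths K n) \<le> \<epsilon> * total" if "1 \<le> n" "n < L" for n
    proof (rule ccontr)
      assume "\<not> ?thesis"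
      then have big: "sum wt (saturated_paths K n) \<ge> \<epsilon> * total" by simp
      have "has_theta s t r L"
      proof (rule saturated_paths_imp_has_theta[OF big tot that(1) _ L eps Q st K _ q0])
        show "Suc n \<le> L" using that by simp
        show "real (K + 2) < \<epsilon> / 8 * Q" using parts(2) eQ by simp
        show "real q0 \<le> \<epsilon> / 8 * Q" using parts(3) eQ by simp
        show "real (s * 2 ^ q0) \<le> \<epsilon> / 16 * Q" using parts(4) .
      qed
      then show False using no by blast
    qed
  qed (use Q Qpos eps h in auto)
  also have "\<dots> \<le> 2 ^ Suc L * \<epsilon> * total"
  proof (intro mult_right_mono)
    have "(2::real) ^ Suc h \<le> 2 ^ Suc L" using h by (intro power_increasing) auto
    then show "(2::real) ^ Suc h - 2 \<le> 2 ^ Suc L" by linarith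
  qed (use eps tot in auto)
  finally show ?thesis .
qed

end

context bip_graph
begin

lemma total_eq: "total = 2 * (\<Sum>v\<in>A. deg v)"
proof -
  have "(\<Sum>a\<in>A. card (N a)) = card (SIGMA a:A. N a)" using finA finN by simp
  also have "\<dots> = card ((\<lambda>(b, a). (a, b)) ` (SIGMA b:V-A. N b))"
  proof (intro arg_cong[of _ _ card] equalityI subsetI)
    fix p assume "p \<in> (SIGMA a:A. N a)"
    then obtain a b where p: "p = (a, b)" "a \<in> A" "b \<in> N a" by auto
    then have "b \<in> V - A" "a \<in> N b" using N_A N_sub N_sym by auto
    then show "p \<in> (\<lambda>(b, a). (a, b)) ` (SIGMA b:V-A. N b)" using p by auto
  next
    fix p assume "p \<in> (\<lambda>(b, a). (a, b)) ` (SIGMA b:V-A. N b)"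
    then obtain a b where p: "p = (a, b)" "b \<in> V - A" "a \<in> N b" by auto
    then have "a \<in> A" "b \<in> N a" using N_B N_sym by auto
    then show "p \<in> (SIGMA a:A. N a)" using p by auto
  qed
  also have "\<dots> = card (SIGMA b:V-A. N b)" by (intro card_image) (auto simp: inj_on_def)
  also have "\<dots> = (\<Sum>b\<in>V-A. card (N b))" using finV finN by simp
  finally have "(\<Sum>a\<in>A. deg a) = (\<Sum>b\<in>V-A. deg b)" unfolding deg_def by (simp flip: of_nat_sum)
  moreover have "total = (\<Sum>b\<in>V-A. deg b) + (\<Sum>a\<in>A. deg a)"
    unfolding total_def using finV A_sub by (intro sum.subset_diff)
  ultimately show ?thesis by simp
qed

text \<open>Of the \<open>2 * k - 1\<close> interior positions of a path starting in
  \<open>A\<close>, the \<open>k\<close> odd ones contribute \<open>1 / D\<close> and the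
  \<open>k - 1\<close> even ones \<open>1 / d\<close>.\<close>

lemma path_scale_even: "k > 0 \<Longrightarrow> path_scale True (2 * k) = d / (d * D) ^ k"
proof (induction k rule: nat_induct_non_zero)
  case 1
  have "{1..<2::nat} = {1}" by auto
  then show ?case using d_pos by (simp add: path_scale_def side_deg_def)
next
  case (Suc k)
  have step: "path_scale True (Suc h) = path_scale True h * (1 / side_deg True h)" if "h \<ge> 1" for h
  proof -
    have "{1..<Suc h} = insert h {1..<h}" using that by auto
    then show ?thesis by (simp add: path_scale_def)
  qed
  have "path_scale True (2 * Suc k) = path_scale True (2 * k) * (1 / side_deg True (2 * k)) * (1 / side_deg True (Suc (2 * k)))"
    using step[of "2 * k"] step[of "Suc (2 * k)"] Suc.hyps by simp
  also have "\<dots> = d / (d * D) ^ Suc k" using Suc.IH d_pos by (simp add: side_deg_def)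
  finally show ?case .
qed

lemma last_in_A: "walk P \<Longrightarrow> length P = Suc L \<Longrightarrow> even L \<Longrightarrow> hd P \<in> A \<Longrightarrow> last P \<in> A"
  using side_nth[of P L] by (simp add: last_conv_nth walk_ne)

lemma sum_deg_A: "(\<Sum>v\<in>A. deg v) \<ge> real (card A) * d"
  using deg_A by (intro sum_bounded_below) auto

text \<open>With \<open>a\<close> the size of \<open>A\<close>, good paths starting in
  \<open>A\<close> carry at least half of the mass \<open>TA \<ge> a * d\<close>. As
  \<open>L\<close> is even they also end in \<open>A\<close>, so they are distributed over
  \<open>a * a\<close> pairs, each of weight at most \<open>path_bd K L * d / (d * D) ^ k\<close>.
  Comparison gives the bound.\<close>

lemma paths_bound:
  fixes k L s t r K :: nat and \<epsilon> Q :: real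
  assumes no: "\<not> has_theta s t r L" and L: "L = 2 * k" "k > 0" and st: "s > 0" "t > 0" and A: "A \<noteq> {}"
    and eps: "\<epsilon> > 0" "2 ^ L * \<epsilon> \<le> 1 / 16" and Q: "\<And>v. v \<in> V \<Longrightarrow> deg v \<ge> Q"
    and K: "s + t + s * t * r * Suc L + 1 + 2 * L \<le> K"
    and q0: "\<epsilon> / 16 * real q0 \<ge> t" "q0 > 0"
    and Qlarge: "\<epsilon> / 16 * Q \<ge> real (Suc L + K + 3 + q0 + s * 2 ^ q0)"
  shows "(d * D) ^ k \<le> 2 * path_bd K L * card A"
proof -
  define TA where "TA = (\<Sum>v\<in>A. deg v)"
  define a where "a = real (card A)"
  have a: "a > 0" using A finA by (simp add: a_def card_gt_0_iff)
  have TA: "TA \<ge> a * d" using sum_deg_A by (simp add: TA_def a_def)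
  have "a * d > 0" using a d_pos by simp
  then have TApos: "TA > 0" using TA by linarith
  have tot: "total = 2 * TA" by (simp add: total_eq TA_def)
  have "even L" using L by simp
  then have bad: "sum wt (walks L - good_paths K L) \<le> 2 ^ Suc L * \<epsilon> * total"
    using TApos tot by (intro mass_good_paths_of_no_theta[OF no _ st _ eps(1) Q K q0 Qlarge]) auto
  have "2 ^ Suc L * \<epsilon> * total = 4 * (2 ^ L * \<epsilon>) * TA" by (simp add: tot)
  also have "\<dots> \<le> 4 * (1 / 16) * TA" using eps TApos by (intro mult_right_mono mult_left_mono) auto
  finally have bad': "sum wt (walks L - good_paths K L) \<le> TA / 2" using bad TApos by simp
  let ?WA = "{P\<in>walks L. hd P \<in> A}" and ?GA = "{P\<in>good_paths K L. hd P \<in> A}"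
  have "sum wt ?WA = TA"
  proof -
    \<comment> \<open>A walk starting in \<open>A\<close> is a spider with one leg, so the mass is
      an instance of \<open>sum_sw_spiders\<close>.\<close>
    have "spiders A 1 (\<lambda>_. L) = (\<lambda>P. [P]) ` ?WA"
    proof (intro equalityI subsetI)
      fix S assume S: "S \<in> spiders A 1 (\<lambda>_. L)"
      then obtain P where "S = [P]" by (auto simp: spiders_def length_Suc_conv)
      then show "S \<in> (\<lambda>P. [P]) ` ?WA" using S by (auto simp: spiders_def walks_def)
    qed (auto simp: spiders_def walks_def)
    moreover have "sw [P] = wt P" for P by (simp add: sw_def wt_def centre_def)
    ultimately have "sum sw (spiders A 1 (\<lambda>_. L)) = sum wt ?WA" by (simp add: sum.reindex inj_on_def)
    then show ?thesis using sum_sw_spiders[of 1 A "\<lambda>_. L"] A_sub by (simp add: TA_def)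
  qed
  moreover have finGA: "finite ?GA" using finite_subset[OF good_paths_walks finite_walks, of K L] by simp
  moreover have "sum wt ?WA \<le> sum wt (?GA \<union> (walks L - good_paths K L))"
    using finite_walks finGA wt_nonneg by (intro sum_mono2) auto
  moreover have "sum wt (?GA \<union> (walks L - good_paths K L)) = sum wt ?GA + sum wt (walks L - good_paths K L)"
    using finite_walks finGA by (intro sum.union_disjoint) auto
  ultimately have good: "TA / 2 \<le> sum wt ?GA" using bad' by linarith
  have "?GA \<subseteq> (\<Union>p\<in>A \<times> A. path_class (good_paths K L) (fst p) (snd p))"
  proof
    fix P assume P: "P \<in> ?GA"
    then have "walk P" "length P = Suc L" using good_paths_walks[of K L] by (auto simp: walks_def)
    then have "last P \<in> A" using last_in_A[of P L] P \<open>even L\<close> by simp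
    then show "P \<in> (\<Union>p\<in>A \<times> A. path_class (good_paths K L) (fst p) (snd p))"
      using P by (intro UN_I[of "(hd P, last P)"]) (auto simp: path_class_def)
  qed
  then have "sum wt ?GA \<le> (\<Sum>p\<in>A \<times> A. sum wt (path_class (good_paths K L) (fst p) (snd p)))"
    using finA finite_subset[OF good_paths_walks finite_walks] by (intro sum_over_union_le) (auto simp: wt_nonneg path_class_def)
  also have "\<dots> \<le> real (card (A \<times> A)) * (path_bd K L * path_scale True L)"
  proof (intro sum_bounded_above)
    fix p assume p: "p \<in> A \<times> A"
    have "sum wt (path_class (good_paths K L) (fst p) (snd p)) \<le> path_bd K L * path_scale (fst p \<in> A) L"
      using L by (intro good_paths_weight_bound) auto
    then show "sum wt (path_class (good_paths K L) (fst p) (snd p)) \<le> path_bd K L * path_scale True L" using p by auto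
  qed
  also have "\<dots> = a * a * (path_bd K L * (d / (d * D) ^ k))"
    using path_scale_even[OF L(2)] L(1) by (simp add: a_def card_cartesian_product)
  finally have "a * d / 2 \<le> a * a * (path_bd K L * (d / (d * D) ^ k))" using good TA by linarith
  then have "(a * d) * (d * D) ^ k \<le> (a * d) * (2 * path_bd K L * a)"
    using d_pos by (simp add: field_simps)
  then show ?thesis using \<open>a * d > 0\<close> by (simp add: a_def mult_le_cancel_left_pos)
qed

text \<open>The count of \<open>paths_bound\<close> with tuples in place of pairs: at least
  \<open>a * d / 2\<close> of mass is distributed over \<open>a ^ s\<close> tuples of ends, each of
  weight at most \<open>spider_bd K L s (s * L) * d / ((d * D) ^ k) ^ s\<close>. The condition on
  \<open>\<epsilon>\<close> makes the spiders that are not good at most half of the mass.\<close>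

lemma spiders_bound:
  fixes k L s t K :: nat and \<epsilon> Q :: real
  assumes no: "\<not> has_theta s t 1 L" and L: "L = 2 * k" "k > 0" and st: "s > 0" "t > 0" and A: "A \<noteq> {}"
    and eps: "\<epsilon> > 0" "2 * (2 ^ (L + 2) * real (s + s * s) + 2) * real ((s + 1) ^ (s * L)) * \<epsilon> \<le> 1"
    and Q: "\<And>v. v \<in> V \<Longrightarrow> deg v \<ge> Q"
    and K: "s + t + s * t * Suc L + 1 + 2 * L \<le> K" "t * Suc (s * L) + s + 2 * (s * L) \<le> K"
    and q0: "\<epsilon> / 16 * real q0 \<ge> t" "q0 > 0"
    and Qlarge: "\<epsilon> / 16 * Q \<ge> real (Suc L + K + 3 + q0 + s * 2 ^ q0)"
      "\<epsilon> / real (4 * s) * Q > real (K + s)" "\<epsilon> * Q \<ge> real (Suc (s * L))"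
  shows "((d * D) ^ k) ^ s \<le> 2 * spider_bd K L s (s * L) * real (card A) ^ (s - 1)"
proof -
  define TA where "TA = (\<Sum>v\<in>A. deg v)"
  define a where "a = real (card A)"
  have a: "a > 0" using A finA by (simp add: a_def card_gt_0_iff)
  have TA: "TA \<ge> a * d" using sum_deg_A by (simp add: TA_def a_def)
  have ad: "a * d > 0" using a d_pos by simp
  then have TApos: "TA > 0" using TA by linarith
  have tot: "total = 2 * TA" by (simp add: total_eq TA_def)
  have evL: "even L" and L2: "L \<ge> 2" using L by auto
  have Qpos: "Q > 0"
  proof -
    have "0 < real (Suc (s * L))" unfolding of_nat_0_less_iff by simp
    then have "0 < \<epsilon> * Q" using Qlarge(3) by linarith
    then show ?thesis using eps(1) by (simp add: zero_less_mult_iff)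
  qed
  \<comment> \<open>The bound \<open>2 ^ Suc L * \<epsilon> * total\<close> for bad walks, expressed
    through \<open>TA\<close> by \<open>total = 2 * TA\<close>.\<close>
  define \<gamma> where "\<gamma> = 2 ^ (L + 2) * \<epsilon>"
  have path: "sum wt (walks h - good_paths K h) \<le> \<gamma> * (\<Sum>v\<in>A. deg v)" if "h \<le> L" for h
  proof -
    have "sum wt (walks h - good_paths K h) \<le> 2 ^ Suc L * \<epsilon> * total"
      using TApos tot K(1) by (intro mass_good_paths_of_no_theta[OF no evL st _ eps(1) Q _ q0 Qlarge(1) that]) auto
    then show ?thesis by (simp add: tot \<gamma>_def TA_def)
  qed
  let ?lg = "\<lambda>_::nat. L"
  have slg: "(\<Sum>i<s. ?lg i) = s * L" by simp
  have "sum sw (spiders A s ?lg - good_spiders K s (s * L) ?lg) \<le>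
      (real s * \<gamma> + real (s * s) * \<gamma> + 2 * \<epsilon>) * real ((s + 1) ^ (s * L)) * (\<Sum>v\<in>A. deg v)"
  proof (rule mass_good_spiders[OF st(1) Q Qlarge(3) Qpos _ path L2 _ slg])
    fix m lg assume lg: "(\<Sum>i<s. lg i) = Suc m" "\<And>i. i < s \<Longrightarrow> lg i \<le> L" "testable_shape s lg"
    show "sum sw (saturated_spiders K s m lg) \<le> \<epsilon> * (\<Sum>v\<in>A. deg v)"
    proof (rule ccontr)
      assume "\<not> ?thesis"
      then have big: "sum sw (saturated_spiders K s m lg) \<ge> \<epsilon> * (\<Sum>v\<in>A. deg v)" by simp
      have "has_theta s t 1 L"
        using TApos by (intro saturated_spiders_imp_has_theta[OF st lg(3,2) evL big _ eps(1) Q K(2) Qlarge(2)]) (auto simp: TA_def)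
      then show False using no by blast
    qed
  qed (use eps in auto)
  also have "\<dots> = (2 * (2 ^ (L + 2) * real (s + s * s) + 2) * real ((s + 1) ^ (s * L)) * \<epsilon>) * (TA / 2)"
    by (simp add: \<gamma>_def TA_def algebra_simps)
  also have "\<dots> \<le> 1 * (TA / 2)" using eps(2) TApos by (intro mult_right_mono) auto
  finally have bad: "sum sw (spiders A s ?lg - good_spiders K s (s * L) ?lg) \<le> TA / 2" by simp
  let ?G = "good_spiders K s (s * L) ?lg"
  have GSP: "?G \<subseteq> spiders A s ?lg" by (rule good_spiders_spiders)
  have finG: "finite ?G" using finite_subset[OF GSP finite_spiders[OF finA]] .
  have "sum sw (spiders A s ?lg) = TA" unfolding TA_def by (rule sum_sw_spiders[OF st(1) A_sub])
  moreover have "sum sw (spiders A s ?lg) = sum sw (spiders A s ?lg - ?G) + sum sw ?G"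
    using GSP finite_spiders[OF finA] by (intro sum.subset_diff)
  ultimately have good: "TA / 2 \<le> sum sw ?G" using bad by linarith
  let ?X = "{xs. set xs \<subseteq> A \<and> length xs = s}"
  have "?G \<subseteq> (\<Union>xs\<in>?X. spider_class ?G xs)"
  proof
    fix S assume S: "S \<in> ?G"
    then have SS: "S \<in> spiders A s ?lg" using GSP by blast
    have "last P \<in> A" if "P \<in> set S" for P
    proof -
      obtain i where "i < s" "P = S ! i" using \<open>P \<in> set S\<close> SS by (auto simp: in_set_conv_nth spiders_def)
      then have "walk P" "length P = Suc L" "hd P \<in> A" using SS st by (auto simp: spiders_iff)
      then show ?thesis using last_in_A evL by blast
    qed
    then have "map last S \<in> ?X" using SS by (auto simp: spiders_def)
    then show "S \<in> (\<Union>xs\<in>?X. spider_class ?G xs)" using S by (intro UN_I[of "map last S"]) (auto simp: spider_class_def)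
  qed
  then have "sum sw ?G \<le> (\<Sum>xs\<in>?X. sum sw (spider_class ?G xs))"
    using finG finite_lists_length_eq[OF finA] by (intro sum_over_union_le) (auto simp: sw_nonneg spider_class_def)
  also have "\<dots> \<le> real (card ?X) * (spider_bd K L s (s * L) * spider_scale s ?lg)"
    using L2 by (intro sum_bounded_above good_spiders_weight_bound[OF st(1) L2 slg]) auto
  also have "real (card ?X) = a ^ s" using card_lists_length_eq[OF finA, of s] by (simp add: a_def)
  also have "spider_scale s ?lg = d / ((d * D) ^ k) ^ s"
    using d_pos path_scale_even[OF L(2)] L(1) by (simp add: spider_scale_def power_divide)
  finally have "a * d / 2 \<le> a ^ s * (spider_bd K L s (s * L) * (d / ((d * D) ^ k) ^ s))" using good TA by linarith
  also have "a ^ s = a * a ^ (s - 1)" using st(1) by (simp add: power_eq_if)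
  finally have le: "a * d / 2 \<le> a * a ^ (s - 1) * (spider_bd K L s (s * L) * (d / ((d * D) ^ k) ^ s))" .
  define x where "x = ((d * D) ^ k) ^ s"
  have x: "x > 0" using d_pos by (simp add: x_def)
  have "a * d / 2 * x \<le> a * a ^ (s - 1) * (spider_bd K L s (s * L) * (d / x)) * x"
    using le x by (intro mult_right_mono) (auto simp: x_def)
  then have "(a * d) * x \<le> (a * d) * (2 * spider_bd K L s (s * L) * a ^ (s - 1))"
    using x by (simp add: field_simps)
  then show ?thesis using ad by (simp add: a_def x_def mult_le_cancel_left_pos)
qed

end

section \<open>Transfer to the extremal number\<close>

lemma (in walk_graph) has_theta_imp_contains_copy:
  assumes theta: "has_theta s t r L" and V: "V \<subseteq> verts G" and L: "L > 0"
    and edge: "\<And>u v. v \<in> N u \<Longrightarrow> {u, v} \<in> edges G"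
  shows "contains_copy G (multi_subdivision (complete_bipartite s t) L r)"
proof -
  obtain \<phi> :: "nat \<Rightarrow> 'a" and P :: "nat \<times> nat \<times> nat \<Rightarrow> 'a list" where inj: "inj_on \<phi> {..<s + t}" and \<phi>V: "\<phi> ` {..<s + t} \<subseteq> V"
    and paths: "\<forall>i<s. \<forall>j\<in>{s..<s + t}. \<forall>c<r. walk (P (i, j, c)) \<and> distinct (P (i, j, c)) \<and>
        length (P (i, j, c)) = Suc L \<and> hd (P (i, j, c)) = \<phi> i \<and> last (P (i, j, c)) = \<phi> j \<and>
        set (P (i, j, c)) \<inter> \<phi> ` {..<s + t} \<subseteq> {\<phi> i, \<phi> j}"
    and disj: "\<forall>x\<in>{..<s} \<times> {s..<s + t} \<times> {..<r}. \<forall>y\<in>{..<s} \<times> {s..<s + t} \<times> {..<r}.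
        x \<noteq> y \<longrightarrow> set (P x) \<inter> set (P y) \<subseteq> \<phi> ` {..<s + t}"
    using theta unfolding has_theta_def by (elim exE conjE) (rule that; assumption)
  let ?H = "multi_subdivision (complete_bipartite s t) L r"
  \<comment> \<open>The smaller element of an edge of \<open>complete_bipartite s t\<close> lies on
    the side of size \<open>s\<close>, so the numbering in \<open>path_vertex\<close> runs in the
    direction of \<open>P\<close>.\<close>
  define R where "R e c = P (Min e, Max e, c)" for e c
  define f where "f x = (case x of Branch i \<Rightarrow> \<phi> i | Internal e c p \<Rightarrow> R e c ! p)" for x
  let ?E = "edges (complete_bipartite s t)"
  have E: "Min e < s" "Max e \<in> {s..<s + t}" "e = {Min e, Max e}" if e: "e \<in> ?E" for e
  proof -
    obtain i j where ij: "e = {i, j}" "i < s" "s \<le> j" "j < s + t" using e by (auto simp: complete_bipartite_def)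
    then have "Min e = i" "Max e = j" by auto
    then show "Min e < s" "Max e \<in> {s..<s + t}" "e = {Min e, Max e}" using ij by auto
  qed
  have R: "walk (R e c)" "distinct (R e c)" "length (R e c) = Suc L" "R e c ! 0 = \<phi> (Min e)" "R e c ! L = \<phi> (Max e)"
    "set (R e c) \<inter> \<phi> ` {..<s + t} \<subseteq> {\<phi> (Min e), \<phi> (Max e)}" if e: "e \<in> ?E" and c: "c < r" for e c
  proof -
    have *: "walk (R e c) \<and> distinct (R e c) \<and> length (R e c) = Suc L \<and> hd (R e c) = \<phi> (Min e) \<and>
        last (R e c) = \<phi> (Max e) \<and> set (R e c) \<inter> \<phi> ` {..<s + t} \<subseteq> {\<phi> (Min e), \<phi> (Max e)}"
      using paths E[OF e] c unfolding R_def by blast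
    then have "R e c \<noteq> []" by auto
    then show "walk (R e c)" "distinct (R e c)" "length (R e c) = Suc L" "R e c ! 0 = \<phi> (Min e)" "R e c ! L = \<phi> (Max e)"
      "set (R e c) \<inter> \<phi> ` {..<s + t} \<subseteq> {\<phi> (Min e), \<phi> (Max e)}"
      using * by (auto simp: hd_conv_nth last_conv_nth)
  qed
  have interior: "R e c ! p \<notin> \<phi> ` {..<s + t}" if e: "e \<in> ?E" and c: "c < r" and p: "0 < p" "p < L" for e c p
  proof
    assume "R e c ! p \<in> \<phi> ` {..<s + t}"
    moreover have "R e c ! p \<in> set (R e c)" using R(3)[OF e c] p by (intro nth_mem) simp
    ultimately have "R e c ! p = R e c ! 0 \<or> R e c ! p = R e c ! L" using R(4-6)[OF e c] by auto
    then show False using R(2,3)[OF e c] p by (auto simp: nth_eq_iff_index_eq)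
  qed
  have fpv: "f (path_vertex L e c p) = R e c ! p" if "e \<in> ?E" "c < r" "p \<le> L" for e c p
    using R(4,5)[OF that(1,2)] by (simp add: path_vertex_def f_def)
  have vH: "verts ?H = Branch ` {..<s + t} \<union> {Internal e i j | e i j. e \<in> ?E \<and> i < r \<and> 0 < j \<and> j < L}"
    by (simp add: multi_subdivision_def complete_bipartite_def)
  have "inj_on f (verts ?H)"
  proof (rule inj_onI)
    fix x y assume x: "x \<in> verts ?H" and y: "y \<in> verts ?H" and eq: "f x = f y"
    show "x = y"
    proof (cases x; cases y)
      fix i j assume "x = Branch i" "y = Branch j"
      then show ?thesis using x y eq inj by (auto simp: vH f_def dest: inj_onD)
    next
      fix i e c p assume *: "x = Branch i" "y = Internal e c p"
      then have "i < s + t" "e \<in> ?E" "c < r" "0 < p" "p < L" using x y by (auto simp: vH)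
      moreover from this have "\<phi> i \<in> \<phi> ` {..<s + t}" by simp
      moreover have "\<phi> i = R e c ! p" using eq * by (simp add: f_def)
      ultimately show ?thesis using interior[of e c p] by simp
    next
      fix i e c p assume *: "x = Internal e c p" "y = Branch i"
      then have "i < s + t" "e \<in> ?E" "c < r" "0 < p" "p < L" using x y by (auto simp: vH)
      moreover from this have "\<phi> i \<in> \<phi> ` {..<s + t}" by simp
      moreover have "\<phi> i = R e c ! p" using eq * by (simp add: f_def)
      ultimately show ?thesis using interior[of e c p] by simp
    next
      fix e c p e' c' p' assume *: "x = Internal e c p" "y = Internal e' c' p'"
      then have e: "e \<in> ?E" "c < r" "0 < p" "p < L" and e': "e' \<in> ?E" "c' < r" "0 < p'" "p' < L"
        using x y by (auto simp: vH)
      have eq': "R e c ! p = R e' c' ! p'" using eq * by (simp add: f_def)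
      have "(Min e, Max e, c) = (Min e', Max e', c')"
      proof (rule ccontr)
        assume ne: "(Min e, Max e, c) \<noteq> (Min e', Max e', c')"
        have "(Min e, Max e, c) \<in> {..<s} \<times> {s..<s + t} \<times> {..<r}" "(Min e', Max e', c') \<in> {..<s} \<times> {s..<s + t} \<times> {..<r}"
          using E(1,2)[OF e(1)] E(1,2)[OF e'(1)] e e' by auto
        then have "set (R e c) \<inter> set (R e' c') \<subseteq> \<phi> ` {..<s + t}" using disj ne unfolding R_def by blast
        moreover have "R e c ! p \<in> set (R e c)" using R(3)[OF e(1,2)] e by (intro nth_mem) simp
        moreover have "R e' c' ! p' \<in> set (R e' c')" using R(3)[OF e'(1,2)] e' by (intro nth_mem) simp
        ultimately have "R e c ! p \<in> \<phi> ` {..<s + t}" using eq' by auto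
        then show False using interior[OF e] by blast
      qed
      then have "e = e'" "c = c'" using E(3)[OF e(1)] E(3)[OF e'(1)] by auto
      moreover have "p = p'" using eq' R(2,3)[OF e(1,2)] e e' calculation by (simp add: nth_eq_iff_index_eq)
      ultimately show ?thesis using * by simp
    qed
  qed
  moreover have "f ` verts ?H \<subseteq> verts G"
  proof (rule image_subsetI)
    fix x assume x: "x \<in> verts ?H"
    show "f x \<in> verts G"
    proof (cases x)
      case (Branch i)
      then have "\<phi> i \<in> \<phi> ` {..<s + t}" using x by (auto simp: vH)
      then show ?thesis using Branch \<phi>V V by (auto simp: f_def)
    next
      case (Internal e c p)
      then have e: "e \<in> ?E" "c < r" "p < L" using x by (auto simp: vH)
      then have "R e c ! p \<in> set (R e c)" using R(3) by (intro nth_mem) simp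
      then show ?thesis using Internal walk_set[OF R(1)[OF e(1,2)]] V by (auto simp: f_def)
    qed
  qed
  moreover have "f ` e' \<in> edges G" if e': "e' \<in> edges ?H" for e'
  proof -
    obtain e c p where e: "e' = {path_vertex L e c p, path_vertex L e c (Suc p)}" "e \<in> ?E" "c < r" "p < L"
      using e' by (auto simp: multi_subdivision_def)
    then have "f ` e' = {R e c ! p, R e c ! Suc p}" using fpv by simp
    moreover have "R e c ! Suc p \<in> N (R e c ! p)" using walk_nth[OF R(1)[OF e(2,3)]] R(3)[OF e(2,3)] e(4) by simp
    ultimately show ?thesis using edge by simp
  qed
  ultimately show ?thesis unfolding contains_copy_def by blast
qed

section \<open>A subgraph with large minimum degrees\<close>

lemma card_edges_bipartite:
  assumes "bipartite_with_parts G A B"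
  shows "card (edges G) = card {p\<in>A \<times> B. {fst p, snd p} \<in> edges G}"
proof -
  have bip: "\<forall>e\<in>edges G. \<exists>a\<in>A. \<exists>b\<in>B. e = {a, b}" and dis: "A \<inter> B = {}"
    using assms by (simp_all add: bipartite_with_parts_def)
  have eq: "edges G = (\<lambda>p. {fst p, snd p}) ` {p\<in>A \<times> B. {fst p, snd p} \<in> edges G}"
  proof (intro equalityI subsetI)
    fix e assume e: "e \<in> edges G"
    then obtain a b where "a \<in> A" "b \<in> B" "e = {a, b}" using bip by blast
    then show "e \<in> (\<lambda>p. {fst p, snd p}) ` {p\<in>A \<times> B. {fst p, snd p} \<in> edges G}"
      using e by (intro image_eqI[of _ _ "(a, b)"]) auto
  qed auto
  have inj: "inj_on (\<lambda>p. {fst p, snd p}) {p\<in>A \<times> B. {fst p, snd p} \<in> edges G}"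
  proof (rule inj_onI)
    fix p p' assume "p \<in> {p\<in>A \<times> B. {fst p, snd p} \<in> edges G}" "p' \<in> {p\<in>A \<times> B. {fst p, snd p} \<in> edges G}"
      "{fst p, snd p} = {fst p', snd p'}"
    then show "p = p'" using dis by (cases p; cases p') (auto simp: doubleton_eq_iff)
  qed
  show ?thesis by (rule trans[OF arg_cong[OF eq, of card] card_image[OF inj]])
qed

text \<open>The subgraph maximising edges minus \<open>x\<close> per vertex on the left and \<open>y\<close> per vertex on
  the right has the required minimum degrees.\<close>

lemma min_degree_subgraph:
  fixes x y :: real and Rel :: "'a \<Rightarrow> 'b \<Rightarrow> bool"
  assumes fin: "finite A" "finite B"
    and big: "real (card {p\<in>A \<times> B. Rel (fst p) (snd p)}) > x * card A + y * card B" and xy: "x \<ge> 0" "y \<ge> 0"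
  shows "\<exists>A' B'. A' \<subseteq> A \<and> B' \<subseteq> B \<and> A' \<noteq> {} \<and>
    (\<forall>a\<in>A'. real (card {b\<in>B'. Rel a b}) \<ge> x) \<and> (\<forall>b\<in>B'. real (card {a\<in>A'. Rel a b}) \<ge> y)"
proof -
  define Ed where "Ed X Y = {p\<in>X \<times> Y. Rel (fst p) (snd p)}" for X Y
  define val where "val p = real (card (Ed (fst p) (snd p))) - x * card (fst p) - y * card (snd p)" for p
  have finP: "finite (Pow A \<times> Pow B)" using fin by simp
  have fd: "finite (Ed X Y)" if "finite X" "finite Y" for X Y using that by (simp add: Ed_def)
  have "finite (val ` (Pow A \<times> Pow B))" "val ` (Pow A \<times> Pow B) \<noteq> {}" using finP by auto
  then have "Max (val ` (Pow A \<times> Pow B)) \<in> val ` (Pow A \<times> Pow B)" by (rule Max_in)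
  then obtain p where p: "p \<in> Pow A \<times> Pow B" "val p = Max (val ` (Pow A \<times> Pow B))" by auto
  obtain A' B' where AB: "p = (A', B')" "A' \<subseteq> A" "B' \<subseteq> B" using p(1) by auto
  have fin': "finite A'" "finite B'" using AB fin finite_subset by blast+
  have mx: "val (X, Y) \<le> val (A', B')" if "X \<subseteq> A" "Y \<subseteq> B" for X Y
    using p(2) AB(1) that finP by (auto intro!: Max_ge)
  have "val (A, B) > 0" using big by (simp add: val_def Ed_def)
  then have pos: "val (A', B') > 0" using mx[of A B] by simp
  \<comment> \<open>Without left vertices there are no edges and the value is at most zero, whereas
    the maximum is positive.\<close>
  have "A' \<noteq> {}"
  proof
    assume "A' = {}"
    then have "val (A', B') \<le> 0" using xy by (simp add: val_def Ed_def)
    then show False using pos by simp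
  qed
  moreover have "real (card {b\<in>B'. Rel a b}) \<ge> x" if a: "a \<in> A'" for a
  proof -
    have "Ed A' B' = Ed (A' - {a}) B' \<union> {a} \<times> {b\<in>B'. Rel a b}" using a by (auto simp: Ed_def)
    moreover have "card (Ed (A' - {a}) B' \<union> {a} \<times> {b\<in>B'. Rel a b}) = card (Ed (A' - {a}) B') + card ({a} \<times> {b\<in>B'. Rel a b})"
      using fin' fd by (intro card_Un_disjoint) (auto simp: Ed_def)
    ultimately have "card (Ed A' B') = card (Ed (A' - {a}) B') + card {b\<in>B'. Rel a b}"
      by (simp add: card_cartesian_product)
    \<comment> \<open>Deleting \<open>a\<close> loses its degree and regains \<open>x\<close>; by
      maximality the degree is at least \<open>x\<close>.\<close>
    moreover have "val (A' - {a}, B') \<le> val (A', B')" using AB by (intro mx) auto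
    moreover have "card A' = Suc (card (A' - {a}))" using a fin' by (metis card_Suc_Diff1)
    ultimately show ?thesis by (simp add: val_def algebra_simps)
  qed
  moreover have "real (card {a\<in>A'. Rel a b}) \<ge> y" if b: "b \<in> B'" for b
  proof -
    have "Ed A' B' = Ed A' (B' - {b}) \<union> {a\<in>A'. Rel a b} \<times> {b}" using b by (auto simp: Ed_def)
    moreover have "card (Ed A' (B' - {b}) \<union> {a\<in>A'. Rel a b} \<times> {b}) = card (Ed A' (B' - {b})) + card ({a\<in>A'. Rel a b} \<times> {b})"
      using fin' fd by (intro card_Un_disjoint) (auto simp: Ed_def)
    ultimately have "card (Ed A' B') = card (Ed A' (B' - {b})) + card {a\<in>A'. Rel a b}"
      by (simp add: card_cartesian_product)
    moreover have "val (A', B' - {b}) \<le> val (A', B')" using AB by (intro mx) auto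
    moreover have "card B' = Suc (card (B' - {b}))" using b fin' by (metis card_Suc_Diff1)
    ultimately show ?thesis by (simp add: val_def algebra_simps)
  qed
  ultimately show ?thesis using AB by blast
qed

lemma exists_bip_subgraph:
  fixes G :: "'a sgraph" and d D :: real
  assumes G: "bipartite_with_parts G A B" and d: "d > 0" "D > 0"
    and big: "real (card (edges G)) > d * card A + D * card B"
  obtains V N A' where "bip_graph V N A' d D" "A' \<subseteq> A" "A' \<noteq> {}" "V \<subseteq> verts G"
    "\<And>u v. v \<in> N u \<Longrightarrow> {u, v} \<in> edges G"
proof -
  have fin: "finite A" "finite B" and dis: "A \<inter> B = {}" and vG: "verts G = A \<union> B"
    and bip: "\<forall>e\<in>edges G. \<exists>a\<in>A. \<exists>b\<in>B. e = {a, b}"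
    using G by (auto simp: bipartite_with_parts_def simple_graph_def)
  obtain A' B' where AB: "A' \<subseteq> A" "B' \<subseteq> B" "A' \<noteq> {}"
    and dA: "\<forall>a\<in>A'. real (card {b\<in>B'. {a, b} \<in> edges G}) \<ge> d"
    and dB: "\<forall>b\<in>B'. real (card {a\<in>A'. {a, b} \<in> edges G}) \<ge> D"
    using min_degree_subgraph[OF fin, of d D "\<lambda>a b. {a, b} \<in> edges G"] big d
    unfolding card_edges_bipartite[OF G] by auto
  define V where "V = A' \<union> B'"
  define N where "N v = {u. u \<in> V \<and> v \<in> V \<and> {u, v} \<in> edges G}" for v
  have opp: "(u \<in> A \<and> v \<in> B) \<or> (u \<in> B \<and> v \<in> A)" if e: "{u, v} \<in> edges G" for u v
  proof -
    obtain a b where "a \<in> A" "b \<in> B" "{u, v} = {a, b}" using bip e by blast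
    then show ?thesis by (auto simp: doubleton_eq_iff)
  qed
  have sym: "{u, v} = {v, u}" for u v :: 'a by auto
  have NA: "N a = {b\<in>B'. {a, b} \<in> edges G}" if a: "a \<in> A'" for a
  proof (intro equalityI subsetI)
    fix u assume "u \<in> N a"
    then have u: "u \<in> A' \<union> B'" "{u, a} \<in> edges G" by (auto simp: N_def V_def)
    then have "u \<in> B" using opp[OF u(2)] a AB dis by auto
    then have "u \<in> B'" using u(1) AB dis by auto
    then show "u \<in> {b\<in>B'. {a, b} \<in> edges G}" using u(2) sym[of u a] by simp
  next
    fix u assume "u \<in> {b\<in>B'. {a, b} \<in> edges G}"
    then show "u \<in> N a" using a sym[of u a] by (simp add: N_def V_def)
  qed
  have NB: "N b = {a\<in>A'. {a, b} \<in> edges G}" if b: "b \<in> B'" for b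
  proof (intro equalityI subsetI)
    fix u assume "u \<in> N b"
    then have u: "u \<in> A' \<union> B'" "{u, b} \<in> edges G" by (auto simp: N_def V_def)
    then have "u \<in> A" using opp[OF u(2)] b AB dis by auto
    then have "u \<in> A'" using u(1) AB dis by auto
    then show "u \<in> {a\<in>A'. {a, b} \<in> edges G}" using u(2) by simp
  next
    fix u assume "u \<in> {a\<in>A'. {a, b} \<in> edges G}"
    then show "u \<in> N b" using b by (simp add: N_def V_def)
  qed
  have V_A: "x \<in> B'" if "x \<in> V - A'" for x using that by (auto simp: V_def)
  have degA: "real (card (N a)) \<ge> d" if "a \<in> A'" for a using dA that by (simp add: NA)
  have degB: "real (card (N b)) \<ge> D" if "b \<in> V - A'" for b using dB V_A[OF that] by (simp add: NB)
  interpret walk_graph V N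
  proof
    show "finite V" using AB fin finite_subset by (auto simp: V_def)
    show "N v \<subseteq> V" for v by (auto simp: N_def)
    show "u \<in> N v \<Longrightarrow> v \<in> N u" for u v using sym by (auto simp: N_def)
    show "v \<notin> N v" for v using opp[of v v] dis by (auto simp: N_def)
    show "N v \<noteq> {}" if "v \<in> V" for v
    proof -
      have "real (card (N v)) > 0" using degA[of v] degB[of v] d that by (cases "v \<in> A'") auto
      then show ?thesis by auto
    qed
  qed
  have "bip_graph V N A' d D"
  proof
    show "A' \<subseteq> V" by (simp add: V_def)
    show "N x \<inter> A' = {}" if "x \<in> A'" for x using NA[OF that] AB dis by auto
    show "N x \<subseteq> A'" if "x \<in> V - A'" for x using NB[OF V_A[OF that]] by auto
    show "d \<le> deg x" if "x \<in> A'" for x using degA[OF that] by (simp add: deg_def)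
    show "D \<le> deg x" if "x \<in> V - A'" for x using degB[OF that] by (simp add: deg_def)
  qed (use d in auto)
  moreover have "V \<subseteq> verts G" using AB vG by (auto simp: V_def)
  moreover have "{u, v} \<in> edges G" if "v \<in> N u" for u v using that sym by (auto simp: N_def)
  ultimately show ?thesis using AB that by blast
qed

section \<open>From degree inequalities to the extremal number\<close>

lemma ex_bip_le:
  fixes x :: real and H :: "'b sgraph"
  assumes "edges H \<noteq> {}"
    and "\<And>(G :: nat sgraph) A B. bipartite_with_parts G A B \<Longrightarrow> card A = m \<Longrightarrow> card B = n \<Longrightarrow>
      real (card (edges G)) > x \<Longrightarrow> contains_copy G H"
  shows "real (ex_bip m n H) \<le> x"
proof -
  have "ex_bip m n H \<in> bip_free_sizes m n H"
    unfolding ex_bip_def using finite_bip_free_sizes bip_free_sizes_nonempty[OF assms(1)] by (intro Max_in)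
  then obtain G :: "nat sgraph" and A B where "ex_bip m n H = card (edges G)"
    "bipartite_with_parts G A B" "card A = m" "card B = n" "\<not> contains_copy G H"
    unfolding bip_free_sizes_def by blast
  then show ?thesis using assms(2)[of G A B] by force
qed

lemma multi_subdivision_edges_ne:
  assumes "s > 0" "t > 0" "r > 0" "L > 0"
  shows "edges (multi_subdivision (complete_bipartite s t) L r) \<noteq> {}"
proof -
  have "{0, s} \<in> edges (complete_bipartite s t)"
    using assms unfolding complete_bipartite_def snd_conv by (intro CollectI exI[of _ 0] exI[of _ s]) auto
  then have "{path_vertex L {0, s} 0 0, path_vertex L {0, s} 0 (Suc 0)} \<in> edges (multi_subdivision (complete_bipartite s t) L r)"
    using assms unfolding multi_subdivision_def by auto
  then show ?thesis by blast
qed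

text \<open>The first bound is the case \<open>j = e = 1\<close>, the second \<open>j = s\<close>, \<open>e = s - 1\<close>.\<close>

lemma ex_bip_bound_of_degrees:
  fixes H :: "'b sgraph" and k j e :: nat and F Q :: real
  assumes ne: "edges H \<noteq> {}" and k: "k > 0" "j > 0" and Q: "Q > 0" and F: "F \<ge> 0"
    and main: "\<And>(G :: nat sgraph) V N A d D. bip_graph V N A d D \<Longrightarrow> A \<noteq> {} \<Longrightarrow> V \<subseteq> verts G \<Longrightarrow>
      (\<And>u v. v \<in> N u \<Longrightarrow> {u, v} \<in> edges G) \<Longrightarrow> \<not> contains_copy G H \<Longrightarrow> d \<ge> Q \<Longrightarrow> D \<ge> Q \<Longrightarrow>
      ((d * D) ^ k) ^ j \<le> F * real (card A) ^ e"
  shows "\<exists>C>0. \<forall>m n. 2 \<le> m \<and> m \<le> n \<longrightarrow> real (ex_bip m n H) \<le>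
    C * (real m powr (1 / 2 + real e / (2 * real k * real j)) * real n powr (1 / 2) + real n * ln (real m))"
proof -
  \<comment> \<open>\<open>C / 4\<close> has to dominate \<open>Q / ln 2\<close>, so that both
    degree bounds exceed \<open>Q\<close>, and \<open>F + 1\<close>, so that the inequality supplied
    by \<open>main\<close> fails.\<close>
  define C where "C = 4 * (Q / ln 2 + F + 1)"
  have l2: "ln (2::real) > 0" by simp
  have C0: "C > 0" using Q F l2 by (simp add: C_def add_pos_nonneg add_nonneg_pos)
  have "real (ex_bip m n H) \<le>
      C * (real m powr (1 / 2 + real e / (2 * real k * real j)) * real n powr (1 / 2) + real n * ln (real m))"
    if mn: "2 \<le> m" "m \<le> n" for m n
  proof (rule ex_bip_le[OF ne], rule ccontr)
    fix G :: "nat sgraph" and A B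
    assume G: "bipartite_with_parts G A B" "card A = m" "card B = n"
      and big: "C * (real m powr (1 / 2 + real e / (2 * real k * real j)) * real n powr (1 / 2) + real n * ln (real m)) < real (card (edges G))"
      and free: "\<not> contains_copy G H"
    define E where "E = real (card (edges G))"
    define a where "a = 1 / 2 + real e / (2 * real k * real j)"
    have m0: "real m > 0" "real n > 0" using mn by auto
    have lnm: "ln (real m) \<ge> ln 2" using mn by simp
    have p0: "real m powr a * real n powr (1 / 2) > 0" using m0 by simp
    have nl: "real n * ln (real m) \<ge> real n * ln 2" using lnm m0 by (intro mult_left_mono) auto
    have nl0: "real n * ln (real m) \<ge> 0" using nl l2 m0 by (meson mult_nonneg_nonneg less_imp_le order_trans)
    have E1: "E > C * (real n * ln (real m))"
    proof -
      have "C * (real n * ln (real m)) \<le> C * (real m powr a * real n powr (1 / 2) + real n * ln (real m))"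
        using C0 p0 by (intro mult_left_mono) auto
      then show ?thesis using big by (simp add: E_def a_def)
    qed
    have E2: "E > C * (real m powr a * real n powr (1 / 2))"
    proof -
      have "C * (real m powr a * real n powr (1 / 2)) \<le> C * (real m powr a * real n powr (1 / 2) + real n * ln (real m))"
        using C0 nl0 by (intro mult_left_mono) auto
      then show ?thesis using big by (simp add: E_def a_def)
    qed
    \<comment> \<open>By \<open>m \<ge> 2\<close> the term \<open>n * ln m\<close> is at least
      \<open>n * ln 2\<close>; this becomes \<open>D \<ge> Q\<close>, and \<open>d \<ge> D\<close>
      because \<open>m \<le> n\<close>.\<close>
    have E3: "E > 4 * Q * real n"
    proof -
      have "4 * Q * real n = 4 * (Q / ln 2) * (real n * ln 2)" using l2 by simp
      also have "\<dots> \<le> C * (real n * ln (real m))"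
        using nl Q F l2 m0 C0 by (intro mult_mono) (auto simp: C_def)
      finally show ?thesis using E1 by linarith
    qed
    have E0: "E > 0" using E3 Q m0 by (meson less_trans mult_pos_pos zero_less_numeral)
    define d where "d = E / (4 * real m)"
    define D where "D = E / (4 * real n)"
    have dD: "d > 0" "D > 0" using E0 m0 by (auto simp: d_def D_def)
    have DQ: "D \<ge> Q" using E3 m0 by (simp add: D_def field_simps)
    have "d \<ge> D" unfolding d_def D_def using mn E0 m0 by (intro divide_left_mono) auto
    then have dQ: "d \<ge> Q" using DQ by simp
    have "d * card A + D * card B = E / 2" using G m0 by (simp add: d_def D_def)
    then have "real (card (edges G)) > d * card A + D * card B" using E0 by (simp add: E_def)
    from exists_bip_subgraph[OF G(1) dD this] obtain V N A' where sub: "bip_graph V N A' d D" "A' \<subseteq> A" "A' \<noteq> {}"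
      "V \<subseteq> verts G" "\<And>u v. v \<in> N u \<Longrightarrow> {u, v} \<in> edges G" by blast
    have "((d * D) ^ k) ^ j \<le> F * real (card A') ^ e"
      by (rule main[OF sub(1,3,4,5) free dQ DQ])
    also have "\<dots> \<le> F * real m ^ e"
    proof (intro mult_left_mono power_mono)
      have "finite A" using G(1) by (auto simp: bipartite_with_parts_def simple_graph_def)
      then show "real (card A') \<le> real m" using card_mono[OF _ sub(2)] G(2) by simp
    qed (use F in auto)
    finally have up: "((d * D) ^ k) ^ j \<le> F * real m ^ e" .
    \<comment> \<open>The lower bound on \<open>E\<close> turns \<open>d * D\<close>, which is the
      square of \<open>E\<close> over \<open>16 * m * n\<close>, into at least
      \<open>C * C / 16 * z\<close>. The exponent \<open>a\<close> is such that
      \<open>z ^ (k * j) = m ^ e\<close>, the growth rate in \<open>main\<close>.\<close>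
    define z where "z = real m powr (2 * a - 1)"
    have z0: "z > 0" using m0 by (simp add: z_def)
    have "C\<^sup>2 / 16 * z \<le> d * D"
    proof -
      have "(real m powr a * real n powr (1 / 2))\<^sup>2 = real m powr (2 * a) * real n"
      proof -
        have "real m powr a * real m powr a = real m powr (2 * a)" by (simp flip: powr_add)
        moreover have "real n powr (1 / 2) * real n powr (1 / 2) = real n"
          using m0 by (simp flip: powr_add)
        ultimately show ?thesis by (simp add: power2_eq_square mult_ac)
      qed
      also have "real m powr (2 * a) = z * real m" using m0 by (simp add: z_def powr_diff)
      finally have sq: "(real m powr a * real n powr (1 / 2))\<^sup>2 = z * real m * real n" .
      have "(C * (real m powr a * real n powr (1 / 2)))\<^sup>2 \<le> E\<^sup>2"
        using E2 C0 p0 by (intro power_mono) auto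
      then have "C\<^sup>2 * (z * real m * real n) \<le> E\<^sup>2" by (simp only: power_mult_distrib[of C] sq)
      then show ?thesis using m0 by (simp add: d_def D_def field_simps power2_eq_square)
    qed
    moreover have "C\<^sup>2 / 16 \<ge> F + 1"
    proof -
      have "C / 4 \<ge> F + 1" using Q l2 by (simp add: C_def)
      then have "(C / 4)\<^sup>2 \<ge> (F + 1)\<^sup>2" using F by (intro power_mono) auto
      moreover have "(F + 1)\<^sup>2 \<ge> F + 1" using F by (simp add: power2_eq_square algebra_simps)
      ultimately show ?thesis by (simp add: power_divide)
    qed
    ultimately have "(F + 1) * z \<le> d * D" using z0 by (meson mult_right_mono less_imp_le order_trans)
    then have "((F + 1) * z) ^ (k * j) \<le> (d * D) ^ (k * j)" using F z0 by (intro power_mono) auto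
    moreover have "(F + 1) ^ (k * j) \<ge> F + 1" using F k by (intro self_le_power) auto
    then have "(F + 1) * z ^ (k * j) \<le> (F + 1) ^ (k * j) * z ^ (k * j)" using z0 by (intro mult_right_mono) auto
    moreover have "z ^ (k * j) = real m ^ e"
    proof -
      have "z ^ (k * j) = real m powr ((2 * a - 1) * real (k * j))"
        unfolding powr_realpow[OF z0, symmetric] by (simp only: z_def powr_powr)
      also have "(2 * a - 1) * real (k * j) = real e" using k by (simp add: a_def field_simps)
      finally show ?thesis using m0 by (simp add: powr_realpow)
    qed
    ultimately have "(F + 1) * real m ^ e \<le> (d * D) ^ (k * j)" by (simp add: power_mult_distrib)
    \<comment> \<open>The gap between \<open>F + 1\<close> and \<open>F\<close> provides the
      contradiction, also in the case \<open>F = 0\<close>.\<close>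
    then have "(F + 1) * real m ^ e \<le> F * real m ^ e" using up by (simp add: power_mult)
    moreover have "real m ^ e > 0" using m0 by simp
    ultimately show False by (simp add: algebra_simps)
  qed
  then show ?thesis using C0 by blast
qed

theorem theorem1p6:
  fixes k r s t :: nat
  assumes "k > 0" and "r > 0" and "s > 0" and "t > 0"
  shows "\<exists>C::real. C > 0 \<and> (\<forall>m n :: nat. 2 \<le> m \<and> m \<le> n \<longrightarrow>
      real (ex_bip m n (multi_subdivision (complete_bipartite s t) (2 * k) r))
        \<le> C * (real m powr (1 / 2 + 1 / (2 * real k)) * real n powr (1 / 2) + real n * ln (real m))
    \<and> real (ex_bip m n (subdivision (complete_bipartite s t) (2 * k)))
        \<le> C * (real m powr (1 / 2 + 1 / (2 * real k) - 1 / (2 * real k * real s)) * real n powr (1 / 2)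
               + real n * ln (real m)))"
proof -
  define L where "L = 2 * k"
  have L: "L = 2 * k" "L > 0" using assms by (auto simp: L_def)
  \<comment> \<open>The sum of the requirements for paths and for spiders, so that one value serves
    both bounds.\<close>
  define K where "K = s + t + s * t * r * Suc L + 1 + 2 * L + (t * Suc (s * L) + s + 2 * (s * L))"
  \<comment> \<open>Twice the coefficient of \<open>\<epsilon>\<close> in the bound of
    \<open>mass_good_spiders\<close> at level \<open>s * L\<close> with
    \<open>\<gamma> = 2 ^ (L + 2) * \<epsilon>\<close>; thus \<open>\<epsilon> = 1 / c\<close>
    leaves at most half of the mass to spiders that are not good.\<close>
  define c where "c = 2 * (2 ^ (L + 2) * real (s + s * s) + 2) * real ((s + 1) ^ (s * L))"
  define \<epsilon> where "\<epsilon> = 1 / c"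
  \<comment> \<open>This is the condition \<open>2 ^ L * \<epsilon> \<le> 1 / 16\<close> of
    \<open>paths_bound\<close>; it follows from \<open>s + s * s \<ge> 2\<close>.\<close>
  have c32: "c \<ge> 16 * 2 ^ L"
  proof -
    have "real (s + s * s) \<ge> 2" using assms by (cases s) auto
    then have "2 * (2 ^ (L + 2) * real (s + s * s) + 2) \<ge> 2 * (2 ^ (L + 2) * 2 + 2)" by simp
    moreover have "real ((s + 1) ^ (s * L)) \<ge> 1" by simp
    ultimately have "c \<ge> 2 * (2 ^ (L + 2) * 2 + 2) * 1" unfolding c_def by (intro mult_mono) auto
    then show ?thesis by simp
  qed
  have c0: "c > 0" using c32 by (smt (verit) zero_less_power)
  have eps: "\<epsilon> > 0" "2 ^ L * \<epsilon> \<le> 1 / 16" "c * \<epsilon> \<le> 1" using c0 c32 by (auto simp: \<epsilon>_def field_simps)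
  obtain q0 :: nat where q0: "\<epsilon> / 16 * real q0 \<ge> t" "q0 > 0"
  proof -
    obtain q1 :: nat where "real q1 \<ge> 16 * t / \<epsilon>" using real_arch_simple by blast
    then have "\<epsilon> / 16 * real (Suc q1) \<ge> t" using eps(1) by (simp add: field_simps)
    then show ?thesis using that by blast
  qed
  define X where "X = real (Suc L + K + 3 + q0 + s * 2 ^ q0 + (K + s + 1) + Suc (s * L))"
  \<comment> \<open>The factor \<open>16 * s / \<epsilon>\<close> clears the denominators
    \<open>16\<close> and \<open>4 * s\<close> of the degree conditions, and \<open>X\<close>
    exceeds each of their right-hand sides.\<close>
  define Q where "Q = 16 * real s / \<epsilon> * X"
  have s1: "real s \<ge> 1" using assms by simp
  have X0: "X > 0" unfolding X_def of_nat_0_less_iff by simp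
  have Q0: "Q > 0" using X0 eps s1 by (simp add: Q_def)
  have Qlarge: "\<epsilon> / 16 * Q \<ge> real (Suc L + K + 3 + q0 + s * 2 ^ q0)"
    "\<epsilon> / real (4 * s) * Q > real (K + s)" "\<epsilon> * Q \<ge> real (Suc (s * L))"
  proof -
    have "\<epsilon> / 16 * Q = real s * X" using eps by (simp add: Q_def)
    moreover have "real s * X \<ge> 1 * X" using s1 X0 by (intro mult_right_mono) auto
    moreover have "X \<ge> real (Suc L + K + 3 + q0 + s * 2 ^ q0)" unfolding X_def by (simp only: of_nat_le_iff)
    ultimately show "\<epsilon> / 16 * Q \<ge> real (Suc L + K + 3 + q0 + s * 2 ^ q0)" by linarith
    have "\<epsilon> / real (4 * s) * Q = 4 * X" using eps s1 by (simp add: Q_def)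
    moreover have "X > real (K + s)" unfolding X_def by (simp only: of_nat_less_iff)
    ultimately show "\<epsilon> / real (4 * s) * Q > real (K + s)" using X0 by linarith
    have "\<epsilon> * Q = 16 * (real s * X)" using eps by (simp add: Q_def)
    moreover have "X \<ge> real (Suc (s * L))" unfolding X_def by (simp only: of_nat_le_iff)
    ultimately show "\<epsilon> * Q \<ge> real (Suc (s * L))" using \<open>real s * X \<ge> 1 * X\<close> X0 by linarith
  qed
  have K1: "s + t + s * t * r * Suc L + 1 + 2 * L \<le> K" and K2: "s + t + s * t * Suc L + 1 + 2 * L \<le> K"
    "t * Suc (s * L) + s + 2 * (s * L) \<le> K"
  proof -
    have "s * t * 1 * Suc L \<le> s * t * r * Suc L" using assms by (intro mult_le_mono) auto
    then show "s + t + s * t * Suc L + 1 + 2 * L \<le> K" by (simp add: K_def)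
  qed (simp_all add: K_def)
  have degs: "walk_graph.deg N v \<ge> Q"
    if b: "bip_graph V N A d D" "d \<ge> Q" "D \<ge> Q" "v \<in> V" for V :: "nat set" and N A d D v
  proof -
    interpret bip_graph V N A d D by (rule b(1))
    show ?thesis using deg_A[of v] deg_B[of v] b by (cases "v \<in> A") auto
  qed
  have "\<exists>C>0. \<forall>m n. 2 \<le> m \<and> m \<le> n \<longrightarrow> real (ex_bip m n (multi_subdivision (complete_bipartite s t) L r)) \<le>
    C * (real m powr (1 / 2 + real 1 / (2 * real k * real 1)) * real n powr (1 / 2) + real n * ln (real m))"
  proof (rule ex_bip_bound_of_degrees[where F = "2 * path_bd K L" and Q = Q])
    show "edges (multi_subdivision (complete_bipartite s t) L r) \<noteq> {}"
      using assms L by (intro multi_subdivision_edges_ne) auto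
    fix G :: "nat sgraph" and V N A d D
    assume b: "bip_graph V N A d D" "A \<noteq> {}" "V \<subseteq> verts G" "\<And>u v. v \<in> N u \<Longrightarrow> {u, v} \<in> edges G"
      "\<not> contains_copy G (multi_subdivision (complete_bipartite s t) L r)" "d \<ge> Q" "D \<ge> Q"
    interpret bip_graph V N A d D by (rule b(1))
    have "\<not> has_theta s t r L" using has_theta_imp_contains_copy[OF _ b(3) L(2) b(4)] b(5) by blast
    then have "(d * D) ^ k \<le> 2 * path_bd K L * card A"
      using degs[OF b(1,6,7)] by (intro paths_bound[OF _ L(1) assms(1,3,4) b(2) eps(1,2) _ K1 q0 Qlarge(1)])
    then show "((d * D) ^ k) ^ 1 \<le> 2 * path_bd K L * real (card A) ^ 1" by simp
  qed (use assms Q0 path_bd_nonneg in auto)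
  then obtain C1 where C1: "C1 > 0" "\<And>m n. 2 \<le> m \<Longrightarrow> m \<le> n \<Longrightarrow>
      real (ex_bip m n (multi_subdivision (complete_bipartite s t) L r)) \<le>
      C1 * (real m powr (1 / 2 + 1 / (2 * real k)) * real n powr (1 / 2) + real n * ln (real m))" by auto
  have "\<exists>C>0. \<forall>m n. 2 \<le> m \<and> m \<le> n \<longrightarrow> real (ex_bip m n (multi_subdivision (complete_bipartite s t) L 1)) \<le>
    C * (real m powr (1 / 2 + real (s - 1) / (2 * real k * real s)) * real n powr (1 / 2) + real n * ln (real m))"
  proof (rule ex_bip_bound_of_degrees[where F = "2 * spider_bd K L s (s * L)" and Q = Q])
    show "edges (multi_subdivision (complete_bipartite s t) L 1) \<noteq> {}"
      using assms L by (intro multi_subdivision_edges_ne) auto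
    show "0 \<le> 2 * spider_bd K L s (s * L)" using spider_bd_mono1 by simp
    fix G :: "nat sgraph" and V N A d D
    assume b: "bip_graph V N A d D" "A \<noteq> {}" "V \<subseteq> verts G" "\<And>u v. v \<in> N u \<Longrightarrow> {u, v} \<in> edges G"
      "\<not> contains_copy G (multi_subdivision (complete_bipartite s t) L 1)" "d \<ge> Q" "D \<ge> Q"
    interpret bip_graph V N A d D by (rule b(1))
    have "\<not> has_theta s t 1 L" using has_theta_imp_contains_copy[OF _ b(3) L(2) b(4)] b(5) by blast
    then show "((d * D) ^ k) ^ s \<le> 2 * spider_bd K L s (s * L) * real (card A) ^ (s - 1)"
      using degs[OF b(1,6,7)] eps(3) unfolding c_def
      by (intro spiders_bound[OF _ L(1) assms(1,3,4) b(2) eps(1) _ _ K2 q0 Qlarge])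
  qed (use assms Q0 in auto)
  then obtain C2 where C2: "C2 > 0" "\<And>m n. 2 \<le> m \<Longrightarrow> m \<le> n \<Longrightarrow>
      real (ex_bip m n (multi_subdivision (complete_bipartite s t) L 1)) \<le>
      C2 * (real m powr (1 / 2 + real (s - 1) / (2 * real k * real s)) * real n powr (1 / 2) + real n * ln (real m))" by auto
  have expo: "1 / 2 + real (s - 1) / (2 * real k * real s) = 1 / 2 + 1 / (2 * real k) - 1 / (2 * real k * real s)"
    using assms by (simp add: field_simps of_nat_diff)
  show ?thesis
  proof (intro exI[of _ "C1 + C2"] conjI allI impI)
    show "C1 + C2 > 0" using C1(1) C2(1) by simp
    fix m n :: nat assume mn: "2 \<le> m \<and> m \<le> n"
    have nn: "real m powr x * real n powr (1 / 2) + real n * ln (real m) \<ge> 0" for x using mn by simp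
    have mono: "x \<le> (C1 + C2) * y" if "x \<le> C1 * y \<or> x \<le> C2 * y" "y \<ge> 0" for x y
    proof -
      have "C1 * y \<ge> 0" "C2 * y \<ge> 0" using C1(1) C2(1) that(2) by simp_all
      then show ?thesis using that(1) unfolding distrib_right by linarith
    qed
    show "real (ex_bip m n (multi_subdivision (complete_bipartite s t) (2 * k) r))
        \<le> (C1 + C2) * (real m powr (1 / 2 + 1 / (2 * real k)) * real n powr (1 / 2) + real n * ln (real m))"
      using C1(2)[of m n] mn unfolding L_def by (intro mono nn) simp
    show "real (ex_bip m n (multi_subdivision (complete_bipartite s t) (2 * k) 1))
        \<le> (C1 + C2) * (real m powr (1 / 2 + 1 / (2 * real k) - 1 / (2 * real k * real s)) * real n powr (1 / 2)
               + real n * ln (real m))"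
      using C2(2)[of m n] mn unfolding L_def expo by (intro mono nn) simp
  qed
qed

end
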